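(* Let $d\ge1$ be an integer and $\beta\in(0,d]$. There exist a finite collection $\mathcal{F}$ of Schwartz seminorms and a constant $C=C(\beta,d)>0$ such that $$\|\mathrm{M}_{\mathcal{F},d-\beta}\, \mu\|_{L^1(\mathcal{H}_\infty^\beta)} \leq C\|\mu\|_{DS_\beta(\mathbb{R}^d)}$$ for all $\mu \in DS_\beta(\mathbb{R}^d)$.
   Context: $M_b(\mathbb{R}^d)$ is the space of finite (signed) Radon measures on $\mathbb{R}^d$; $|\mu|$ denotes total variation. $e^{t\Delta}\mu(x)=\int_{\mathbb{R}^d}(4\pi t)^{-d/2}e^{-|x-y|^2/4t}\,d\mu(y)$ is the heat semigroup. $\beta$-atom: a measure $a\in M_b(\mathbb{R}^d)$ for which there is a cube $Q\subset\mathbb{R}^d$ with sides parallel to the coordinate axes, of side length $l(Q)$, such that (1) $\operatorname{supp} a\subset Q$; (2) $a(Q)=0$; (3) $\sup_{x\in\mathbb{R}^d,\,t>0}|t^{(d-\beta)/2}e^{t\Delta}a(x)|\le l(Q)^{-\beta}$; (4) $|a|(\mathbb{R}^d)\le 1$. $DS_\beta(\mathbb{R}^d)$ is the set of $\mu\in M_b(\mathbb{R}^d)$ for which there are scalars $\lambda_{i,n}$ and $\beta$-atoms $a_{i,n}$ ($1\le i\le n$, $n\in\mathbb{N}$) with $\limsup_{n\to\infty}\sum_{i=1}^n|\lambda_{i,n}|<+\infty$ and $\mu=\lim_{n\to\infty}\sum_{i=1}^n\lambda_{i,n}a_{i,n}$ weakly-star as measures (tested against all $\varphi\in C_0(\mathbb{R}^d)$).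 Its norm $\|\mu\|_{DS_\beta(\mathbb{R}^d)}$ is the infimum of $\limsup_{n\to\infty}\sum_{i=1}^n|\lambda_{i,n}|$ over all such representations. Fractional grand maximal function: a finite collection $\mathcal{F}$ of Schwartz seminorms is a finite set of pairs $(p,q)\in\mathbb{Z}_+\times\mathbb{Z}_+$, with seminorms $\|\Phi\|_{p,q}=\sup_{x\in\mathbb{R}^d,\,|\gamma|\le q}(1+|x|)^p|\partial^\gamma\Phi(x)|$; $\|\Phi\|_{\mathcal{F}}=\max_{(p,q)\in\mathcal{F}}\|\Phi\|_{p,q}$. With $\Phi_t(x)=t^{-d}\Phi(x/t)$, for a tempered distribution $f$ and $\gamma\in[0,d]$, $$\mathrm{M}_{\mathcal{F},\gamma}f(x)=\sup\{t^\gamma|f*\Phi_t(x)| : t>0,\ \Phi\in\mathcal{S}(\mathbb{R}^d),\ \|\Phi\|_{\mathcal{F}}\le1\}.$$ Hausdorff content: $\mathcal{H}_\infty^\beta(E)=\inf\{\sum_i\omega_\beta r_i^\beta: E\subset\bigcup_iB(x_i,r_i)\}$ (countable covers by balls), $\omega_\beta=\pi^{\beta/2}/\Gamma(\beta/2+1)$. The norm is the Choquet integral $\|f\|_{L^1(\mathcal{H}_\infty^\beta)}=\int_{\mathbb{R}^d}|f|\,d\mathcal{H}_\infty^\beta=\int_0^\infty\mathcal{H}_\infty^\beta(\{|f|>t\})\,dt$. *)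

theory Defs
  imports "HOL-Analysis.Analysis"
begin

section \<open>Finite signed Radon measures\<close>

text \<open>Every finite Borel measure on a Euclidean space is Radon, so a finite signed Radon measure is
  a real-valued countably additive function on the Borel sets. Its values on other sets are
  irrelevant: no notion below depends on them.\<close>

type_synonym 'n set_fun = "(real^'n) set \<Rightarrow> real"

definition signed_measure :: "'n::finite set_fun \<Rightarrow> bool" where
  "signed_measure \<mu> \<longleftrightarrow>
     \<mu> {} = 0 \<and>
     (\<forall>A :: nat \<Rightarrow> (real^'n) set. range A \<subseteq> sets borel \<longrightarrow> disjoint_family A \<longrightarrow>
        (\<lambda>i. \<mu> (A i)) sums \<mu> (\<Union>i. A i))"

definition total_variation :: "'n::finite set_fun \<Rightarrow> (real^'n) set \<Rightarrow> ennreal" where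
  "total_variation \<mu> E =
     (SUP P \<in> {P. finite P \<and> P \<subseteq> sets borel \<and> disjoint P \<and> \<Union>P = E}. \<Sum>A\<in>P. ennreal \<bar>\<mu> A\<bar>)"

definition supp :: "'n::finite set_fun \<Rightarrow> (real^'n) set" where
  "supp \<mu> = {x. \<forall>U. open U \<longrightarrow> x \<in> U \<longrightarrow> total_variation \<mu> U \<noteq> 0}"

text \<open>Jordan decomposition. Since \<open>ennreal\<close> truncates negative reals to 0 and \<open>B = {}\<close> competes,
  the supremum is that of the values of \<open>\<mu>\<close> on Borel subsets of \<open>A\<close>.\<close>

definition pos_part :: "'n::finite set_fun \<Rightarrow> (real^'n) measure" where
  "pos_part \<mu> =
     measure_of UNIV (sets borel) (\<lambda>A. SUP B \<in> {B \<in> sets borel. B \<subseteq> A}. ennreal (\<mu> B))"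

definition neg_part :: "'n::finite set_fun \<Rightarrow> (real^'n) measure" where
  "neg_part \<mu> = pos_part (\<lambda>A. - \<mu> A)"

definition signed_integral ::
    "'n::finite set_fun \<Rightarrow> (real^'n \<Rightarrow> 'b) \<Rightarrow> 'b::{banach, second_countable_topology}" where
  "signed_integral \<mu> f = (\<integral>x. f x \<partial>pos_part \<mu>) - (\<integral>x. f x \<partial>neg_part \<mu>)"


section \<open>Atoms and the space $DS_\beta$\<close>

definition heat :: "real \<Rightarrow> 'n::finite set_fun \<Rightarrow> real^'n \<Rightarrow> real" where
  "heat t \<mu> x = signed_integral \<mu>
     (\<lambda>y. (4 * pi * t) powr (- real CARD('n) / 2) * exp (- (norm (x - y))\<^sup>2 / (4 * t)))"

text \<open>Cubes are taken closed, with corner \<open>c\<close> and side length \<open>l\<close>. Passing to the closure of the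
  cube affects none of the four conditions.\<close>

definition atom :: "real \<Rightarrow> 'n::finite set_fun \<Rightarrow> bool" where
  "atom \<beta> a \<longleftrightarrow> signed_measure a \<and>
     (\<exists>(c :: real^'n) l Q. 0 < l \<and> Q = cbox c (\<chi> i. c $ i + l) \<and>
        supp a \<subseteq> Q \<and>
        a Q = 0 \<and>
        (\<forall>x. \<forall>t>0. \<bar>t powr ((real CARD('n) - \<beta>) / 2) * heat t a x\<bar> \<le> l powr (- \<beta>)) \<and>
        total_variation a UNIV \<le> 1)"

definition C0 :: "(real^'n::finite \<Rightarrow> real) set" where
  "C0 = {\<phi>. continuous_on UNIV \<phi> \<and> (\<phi> \<longlongrightarrow> 0) at_infinity}"

definition weak_star_lim :: "(nat \<Rightarrow> 'n::finite set_fun) \<Rightarrow> 'n set_fun \<Rightarrow> bool" where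
  "weak_star_lim \<nu> \<mu> \<longleftrightarrow>
     (\<forall>\<phi>\<in>C0. (\<lambda>n. signed_integral (\<nu> n) \<phi>) \<longlonglongrightarrow> signed_integral \<mu> \<phi>)"

definition coeff_size :: "(nat \<Rightarrow> nat \<Rightarrow> real) \<Rightarrow> ennreal" where
  "coeff_size lam = limsup (\<lambda>n. \<Sum>i=1..n. ennreal \<bar>lam i n\<bar>)"

definition atomic_rep ::
    "real \<Rightarrow> (nat \<Rightarrow> nat \<Rightarrow> real) \<Rightarrow> (nat \<Rightarrow> nat \<Rightarrow> 'n::finite set_fun) \<Rightarrow> 'n set_fun \<Rightarrow> bool" where
  "atomic_rep \<beta> lam a \<mu> \<longleftrightarrow>
     (\<forall>n. \<forall>i\<in>{1..n}. atom \<beta> (a i n)) \<and>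
     coeff_size lam < \<infinity> \<and>
     weak_star_lim (\<lambda>n E. \<Sum>i=1..n. lam i n * a i n E) \<mu>"

definition DS :: "real \<Rightarrow> 'n::finite set_fun set" where
  "DS \<beta> = {\<mu>. signed_measure \<mu> \<and> (\<exists>lam a. atomic_rep \<beta> lam a \<mu>)}"

definition DS_norm :: "real \<Rightarrow> 'n::finite set_fun \<Rightarrow> ennreal" where
  "DS_norm \<beta> \<mu> = Inf {coeff_size lam | lam a. atomic_rep \<beta> lam a \<mu>}"


section \<open>Schwartz functions and the fractional grand maximal function\<close>

definition partial_deriv ::
    "'n \<Rightarrow> (real^'n::finite \<Rightarrow> 'b::real_normed_vector) \<Rightarrow> real^'n \<Rightarrow> 'b" where
  "partial_deriv i f x = vector_derivative (\<lambda>h. f (x + h *\<^sub>R axis i 1)) (at 0)"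

text \<open>A multi-index of order \<open>k\<close> is encoded as a list of \<open>k\<close> coordinate directions. For smooth
  functions the order of the list is immaterial by symmetry of mixed partial derivatives, so
  ranging over lists of length at most \<open>q\<close> is ranging over multi-indices of order at most \<open>q\<close>.\<close>

primrec iter_deriv ::
    "'n list \<Rightarrow> (real^'n::finite \<Rightarrow> 'b::real_normed_vector) \<Rightarrow> real^'n \<Rightarrow> 'b" where
  "iter_deriv [] f = f"
| "iter_deriv (i # is) f = partial_deriv i (iter_deriv is f)"

definition smooth :: "(real^'n::finite \<Rightarrow> 'b::real_normed_vector) \<Rightarrow> bool" where
  "smooth f \<longleftrightarrow> (\<forall>is x. iter_deriv is f differentiable at x)"

definition seminorm ::
    "nat \<Rightarrow> nat \<Rightarrow> (real^'n::finite \<Rightarrow> 'b::real_normed_vector) \<Rightarrow> ennreal" where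
  "seminorm p q \<Phi> =
     (SUP x. SUP is \<in> {is. length is \<le> q}. ennreal ((1 + norm x) ^ p * norm (iter_deriv is \<Phi> x)))"

definition schwartz :: "(real^'n::finite \<Rightarrow> complex) set" where
  "schwartz = {\<Phi>. smooth \<Phi> \<and> (\<forall>p q. seminorm p q \<Phi> < \<infinity>)}"

definition seminorm_max ::
    "(nat \<times> nat) set \<Rightarrow> (real^'n::finite \<Rightarrow> 'b::real_normed_vector) \<Rightarrow> ennreal" where
  "seminorm_max \<F> \<Phi> = Max ((\<lambda>(p, q). seminorm p q \<Phi>) ` \<F>)"

definition dilate :: "real \<Rightarrow> (real^'n::finite \<Rightarrow> complex) \<Rightarrow> real^'n \<Rightarrow> complex" where
  "dilate t \<Phi> x = of_real (t powr (- real CARD('n))) * \<Phi> ((1 / t) *\<^sub>R x)"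

text \<open>A tempered distribution is given by its action \<open>f\<close> on Schwartz functions, and
  $(f * \Psi)(x) = f(\Psi(x - \cdot))$. A finite signed measure \<open>\<mu>\<close> acts by
  \<open>signed_integral \<mu>\<close>.\<close>

definition conv ::
    "((real^'n::finite \<Rightarrow> complex) \<Rightarrow> complex) \<Rightarrow> (real^'n \<Rightarrow> complex) \<Rightarrow> real^'n \<Rightarrow> complex" where
  "conv f \<Psi> x = f (\<lambda>y. \<Psi> (x - y))"

definition grand_maximal ::
    "(nat \<times> nat) set \<Rightarrow> real \<Rightarrow> ((real^'n::finite \<Rightarrow> complex) \<Rightarrow> complex) \<Rightarrow> real^'n \<Rightarrow> ennreal" where
  "grand_maximal \<F> \<gamma> f x =
     Sup {ennreal (t powr \<gamma> * norm (conv f (dilate t \<Phi>) x)) | t \<Phi>.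
            0 < t \<and> \<Phi> \<in> schwartz \<and> seminorm_max \<F> \<Phi> \<le> 1}"


section \<open>Hausdorff content and the Choquet integral\<close>

text \<open>A ball of radius 0 is empty and contributes 0, so finite covers are included. The constant
  \<open>unit_ball_vol \<beta>\<close> is $\pi^{\beta/2} / \Gamma(\beta/2+1)$.\<close>

definition hausdorff_content :: "real \<Rightarrow> (real^'n::finite) set \<Rightarrow> ennreal" where
  "hausdorff_content \<beta> E =
     Inf {(\<Sum>i. ennreal (unit_ball_vol \<beta> * r i powr \<beta>)) | (x :: nat \<Rightarrow> real^'n) r.
            (\<forall>i. 0 \<le> r i) \<and> E \<subseteq> (\<Union>i. ball (x i) (r i))}"

definition choquet_norm :: "real \<Rightarrow> (real^'n::finite \<Rightarrow> ennreal) \<Rightarrow> ennreal" where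
  "choquet_norm \<beta> f = (\<integral>\<^sup>+t\<in>{0<..}. hausdorff_content \<beta> {x. ennreal t < f x} \<partial>lborel)"

end

theory Submission
  imports Defs
begin

text \<open>Write \<open>d\<close> for the dimension. The maximal function is estimated for one atom by an explicit sum of
multiples of indicators of dyadic cubes, and such sums are easy to add up for Hausdorff content.

\<^bold>\<open>One atom.\<close> Let \<open>a\<close> be an atom for a cube of side \<open>l\<close> with corner \<open>c\<close>. The quantity
\<open>t powr (d - \<beta>) * \<bar>a * \<Phi>\<^sub>t (x)\<bar>\<close> obeys two bounds, uniformly in \<open>t\<close> and in the normalised Schwartz
function \<open>\<Phi>\<close>. First, it is at most \<open>C * l powr (- \<beta>)\<close> everywhere (\<open>atom_near_bound\<close>). The definition of
an atom gives this for Gaussians only. To reach a general \<open>\<Phi>\<close>, subtract from it its average over a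
Gaussian of width \<open>1\<close>, from the remainder the average over width \<open>u\<close>, then \<open>u\<^sup>2\<close>, and so on. Averages of
width \<open>s\<close> are controlled by the heat extension of \<open>a\<close> at a cost of \<open>s powr (- (d - \<beta>))\<close>, while each
subtraction gains a factor \<open>s\<close> in exchange for one derivative of \<open>\<Phi>\<close>. Since \<open>d\<close> derivatives beat
the exponent \<open>d - \<beta>\<close>, the resulting series converges geometrically (\<open>bound_from_gauss_averages\<close>).
Secondly, at distance \<open>\<rho>\<close> much larger than \<open>l\<close> the cancellation \<open>a(Q) = 0\<close> and the decay of \<open>\<Phi>\<close> give
\<open>C * l * \<rho> powr (- \<beta> - 1)\<close> (\<open>atom_far_bound\<close>). Together these are dominated by \<open>\<Sum> w\<^sub>Q 1\<^sub>Q\<close>, where \<open>Q\<close> runs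
over boundedly many dyadic cubes of each side comparable to \<open>2 ^ k * l\<close> around the atom and
\<open>\<Sum> w\<^sub>Q side(Q) powr \<beta>\<close> is bounded (\<open>cube_sum_majorant\<close>).

\<^bold>\<open>Adding atoms.\<close> Hausdorff content is at most a constant times its analogue for half-open dyadic cubes
(\<open>hausdorff_content_le_dcontent\<close>). Two dyadic cubes are nested or disjoint, and this alone shows, by
splitting off the largest cube, that the Choquet integral of \<open>\<Sum> w\<^sub>Q 1\<^sub>Q\<close> is at most
\<open>\<Sum> w\<^sub>Q side(Q) powr \<beta>\<close> (\<open>dchoquet_weighted_cubes\<close>).

\<^bold>\<open>The limit.\<close> Weak-star convergence controls one test \<open>(t, \<Phi>, x)\<close> at a time. The bound for atoms is
nontangential: shifting \<open>x\<close> by at most \<open>t\<close> changes \<open>\<Phi>\<close> into another function with comparable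
seminorms, so one test bounds the dyadic sums from below on the whole ball of radius \<open>t\<close> around \<open>x\<close>.
Hence for finitely many tests the union of the balls where the value exceeds a level lies, for some late
\<open>n\<close>, in a level set of the sum that belongs to the \<open>n\<close>-th approximation (\<open>finite_stage_bound\<close>).
By Lindelof's theorem countably many tests exhaust all level sets of the maximal function of \<open>\<mu>\<close>, and
dyadic content is continuous along increasing sequences of open sets (\<open>dcontent_UN_incseq\<close>), so
monotone convergence finishes the proof (\<open>choquet_norm_le_if_finite_stages_le\<close>).\<close>

section \<open>Dyadic cubes\<close>

definition side :: "int \<times> (int^'n::finite) \<Rightarrow> real" where
  "side q = 2 powr (- real_of_int (fst q))"

text \<open>A pair \<open>(j, v)\<close> stands for the half-open cube of side \<open>2 powr - j\<close> whose lower corner is \<open>v\<close> times the side;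
large \<open>j\<close> means small cubes. Working with the index instead of the set makes the side length available
and the collection of all cubes a countable type.\<close>

definition cube :: "int \<times> (int^'n::finite) \<Rightarrow> (real^'n) set" where
  "cube q = {x. \<forall>i. \<lfloor>x $ i * 2 powr real_of_int (fst q)\<rfloor> = snd q $ i}"

definition cube_at :: "int \<Rightarrow> real^'n::finite \<Rightarrow> int \<times> (int^'n)" where
  "cube_at j x = (j, \<chi> i. \<lfloor>x $ i * 2 powr real_of_int j\<rfloor>)"

text \<open>The scales are compared explicitly, so that the inclusion never has to be converted into an inequality of
side lengths.\<close>

definition subcube :: "int \<times> (int^'n::finite) \<Rightarrow> int \<times> (int^'n) \<Rightarrow> bool" where
  "subcube q q' \<longleftrightarrow> fst q' \<le> fst q \<and> cube q \<subseteq> cube q'"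

lemma side_pos [simp]: "0 < side q"
  by (simp add: side_def)

lemma fst_cube_at [simp]: "fst (cube_at j x) = j"
  by (simp add: cube_at_def)

lemma mem_cube_iff: "x \<in> cube q \<longleftrightarrow> q = cube_at (fst q) x"
  by (cases q) (auto simp: cube_def cube_at_def vec_eq_iff)

lemma mem_cube_at [simp]: "x \<in> cube (cube_at j x)"
  by (simp add: mem_cube_iff)

text \<open>The coarser index of a point is a function of its finer index; this is why dyadic cubes are nested.\<close>

lemma floor_scale_down:
  fixes x :: real
  assumes "i \<le> j"
  shows "\<lfloor>x * 2 powr real_of_int i\<rfloor> = \<lfloor>x * 2 powr real_of_int j\<rfloor> div 2 ^ nat (j - i)"
proof -
  have "(2::real) powr real_of_int j = 2 powr real_of_int i * real_of_int (2 ^ nat (j - i))"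
    using assms by (simp add: powr_realpow [symmetric] powr_add [symmetric])
  then have "x * 2 powr real_of_int i = x * 2 powr real_of_int j / real_of_int (2 ^ nat (j - i))"
    by simp
  then show ?thesis
    by (metis floor_divide_real_eq_div zero_le_numeral zero_le_power)
qed

lemma cube_at_mono:
  assumes "cube_at j x = cube_at j y" "i \<le> j"
  shows "cube_at i x = cube_at i y"
  using assms by (auto simp: cube_at_def vec_eq_iff floor_scale_down[OF assms(2)])

lemma cube_nonempty: "cube q \<noteq> {}"
proof -
  have "(\<chi> i. real_of_int (snd q $ i) * side q) \<in> cube q"
    by (auto simp: cube_def side_def mult.assoc simp flip: powr_add)
  then show ?thesis by blast
qed

lemma subcube_if_meets:
  assumes "x \<in> cube q" "x \<in> cube q'" "fst q' \<le> fst q"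
  shows "subcube q q'"
  unfolding subcube_def
proof (intro conjI subsetI)
  fix y assume "y \<in> cube q"
  then have "cube_at (fst q) x = cube_at (fst q) y"
    using assms(1) mem_cube_iff by metis
  then have "cube_at (fst q') x = cube_at (fst q') y"
    using cube_at_mono assms(3) by blast
  then show "y \<in> cube q'"
    using assms(2) mem_cube_iff by metis
qed (fact assms(3))

lemma subcube_antisym_scale:
  assumes "subcube q q'" "fst q' = fst q"
  shows "q' = q"
  using assms cube_nonempty[of q] mem_cube_iff unfolding subcube_def
  by (metis all_not_in_conv subsetD)

lemma subcube_refl [simp]: "subcube q q"
  by (simp add: subcube_def)

section \<open>Dyadic content\<close>

text \<open>The total \<open>\<beta>\<close>-cost of a family of cubes, as a measure on the countable set of all cubes. Monotonicity,
additivity over disjoint families and continuity then come from measure theory.\<close>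

definition cost :: "real \<Rightarrow> (int \<times> (int^'n::finite)) measure" where
  "cost \<beta> = density (count_space UNIV) (\<lambda>q. ennreal (side q powr \<beta>))"

lemma sets_cost [simp]: "sets (cost \<beta>) = UNIV"
  by (simp add: cost_def)

lemma emeasure_cost_singleton: "emeasure (cost \<beta>) {q} = ennreal (side q powr \<beta>)"
  by (simp add: cost_def emeasure_density)

definition dcontent :: "real \<Rightarrow> (real^'n::finite) set \<Rightarrow> ennreal" where
  "dcontent \<beta> E = (INF \<C> \<in> {\<C>. E \<subseteq> (\<Union>q\<in>\<C>. cube q)}. emeasure (cost \<beta>) \<C>)"

lemma dcontent_le: "E \<subseteq> (\<Union>q\<in>\<C>. cube q) \<Longrightarrow> dcontent \<beta> E \<le> emeasure (cost \<beta>) \<C>"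
  unfolding dcontent_def by (rule INF_lower) auto

lemma dcontent_mono: "E \<subseteq> F \<Longrightarrow> dcontent \<beta> E \<le> dcontent \<beta> F"
  unfolding dcontent_def by (rule INF_superset_mono) auto

lemma dcontent_cube_le: "dcontent \<beta> (cube q) \<le> ennreal (side q powr \<beta>)"
  using dcontent_le[of "cube q" "{q}" \<beta>] by (simp add: emeasure_cost_singleton)

lemma dcontent_empty [simp]: "dcontent \<beta> {} = 0"
  using dcontent_le[of "{}" "{}" \<beta>] by simp

lemma dcontent_lessE:
  assumes "dcontent \<beta> E < c"
  obtains \<C> where "E \<subseteq> (\<Union>q\<in>\<C>. cube q)" "emeasure (cost \<beta>) \<C> < c"
  using assms unfolding dcontent_def by (auto simp: INF_less_iff)

lemma dcontent_Un: "dcontent \<beta> (E \<union> F) \<le> dcontent \<beta> E + dcontent \<beta> F"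
proof (rule ennreal_le_epsilon)
  fix e :: real assume fin: "dcontent \<beta> E + dcontent \<beta> F < top" and e: "0 < e"
  have "dcontent \<beta> E < dcontent \<beta> E + ennreal (e/2)" "dcontent \<beta> F < dcontent \<beta> F + ennreal (e/2)"
    using fin e by (auto simp: ennreal_add_eq_top less_top intro!: ennreal_add_left_cancel_less[THEN iffD2, of _ 0, simplified])
  then obtain C D where C: "E \<subseteq> (\<Union>q\<in>C. cube q)" "emeasure (cost \<beta>) C < dcontent \<beta> E + ennreal (e/2)"
    and D: "F \<subseteq> (\<Union>q\<in>D. cube q)" "emeasure (cost \<beta>) D < dcontent \<beta> F + ennreal (e/2)"
    by (meson dcontent_lessE)
  have "dcontent \<beta> (E \<union> F) \<le> emeasure (cost \<beta>) (C \<union> D)"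
    using C D by (intro dcontent_le) auto
  also have "\<dots> \<le> emeasure (cost \<beta>) C + emeasure (cost \<beta>) D"
    by (intro emeasure_subadditive) auto
  also have "\<dots> \<le> (dcontent \<beta> E + ennreal (e/2)) + (dcontent \<beta> F + ennreal (e/2))"
    using C D by (intro add_mono) auto
  also have "\<dots> = dcontent \<beta> E + dcontent \<beta> F + ennreal e"
    using ennreal_plus[of "e/2" "e/2"] e by (simp add: ac_simps)
  finally show "dcontent \<beta> (E \<union> F) \<le> dcontent \<beta> E + dcontent \<beta> F + ennreal e" .
qed

text \<open>Localisation at one scale. If covering \<open>E\<close> is cheaper than a single cube of scale \<open>j - 1\<close>, then every
cheap cover uses only cubes of scale at least \<open>j\<close>. Each of them lies in exactly one cube of scale \<open>j\<close>, so
its cost is the sum, over the cubes of scale \<open>j\<close>, of the cost of covering the piece of \<open>E\<close> in them.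
A family \<open>Z\<close> that is cheaper than every piece locally is therefore cheaper than \<open>E\<close> globally.\<close>

lemma cost_le_dcontent_by_scale:
  fixes E :: "(real^'n::finite) set"
  assumes \<beta>: "0 < \<beta>"
    and small: "dcontent \<beta> E < ennreal ((2 powr (- real_of_int (j - 1))) powr \<beta>)"
    and Z: "\<And>q. q \<in> Z \<Longrightarrow> j \<le> fst q"
    and loc: "\<And>c. fst c = j \<Longrightarrow> emeasure (cost \<beta>) {q\<in>Z. subcube q c} \<le> dcontent \<beta> (E \<inter> cube c)"
  shows "emeasure (cost \<beta>) Z \<le> dcontent \<beta> E"
proof (rule ccontr)
  assume "\<not> ?thesis"
  then have "dcontent \<beta> E < min (emeasure (cost \<beta>) Z) (ennreal ((2 powr (- real_of_int (j - 1))) powr \<beta>))"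
    using small by simp
  then obtain C where C: "E \<subseteq> (\<Union>q\<in>C. cube q)" "emeasure (cost \<beta>) C < emeasure (cost \<beta>) Z"
    "emeasure (cost \<beta>) C < ennreal ((2 powr (- real_of_int (j - 1))) powr \<beta>)"
    by (metis dcontent_lessE min_less_iff_conj)
  have Cj: "j \<le> fst q" if "q \<in> C" for q
  proof (rule ccontr)
    assume "\<not> j \<le> fst q"
    then have "2 powr (- real_of_int (j - 1)) \<le> side q"
      by (simp add: side_def)
    then have "(2 powr (- real_of_int (j - 1))) powr \<beta> \<le> side q powr \<beta>"
      using \<beta> by (intro powr_mono2[of \<beta>]) auto
    then have "ennreal ((2 powr (- real_of_int (j - 1))) powr \<beta>) \<le> emeasure (cost \<beta>) {q}"
      by (simp add: emeasure_cost_singleton ennreal_leI)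
    also have "\<dots> \<le> emeasure (cost \<beta>) C"
      using that by (intro emeasure_mono) auto
    finally show False using C(3) by simp
  qed
  define I where "I = {c :: int \<times> (int^'n). fst c = j}"
  have part: "emeasure (cost \<beta>) Y = (\<integral>\<^sup>+c. emeasure (cost \<beta>) {q\<in>Y. subcube q c} \<partial>count_space I)"
    if Y: "\<And>q. q \<in> Y \<Longrightarrow> j \<le> fst q" for Y
  proof -
    have "Y = (\<Union>c\<in>I. {q\<in>Y. subcube q c})"
    proof (intro equalityI subsetI)
      fix q assume q: "q \<in> Y"
      obtain x where "x \<in> cube q" using cube_nonempty by blast
      then have "subcube q (cube_at j x)"
        using Y[OF q] by (intro subcube_if_meets) auto
      then show "q \<in> (\<Union>c\<in>I. {q\<in>Y. subcube q c})"
        using q by (auto simp: I_def simp del: split_paired_Ex intro!: exI[of _ "cube_at j x"])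
    qed auto
    moreover have "disjoint_family_on (\<lambda>c. {q\<in>Y. subcube q c}) I"
    unfolding disjoint_family_on_def
    proof (intro ballI impI)
      fix c c' assume "c \<in> I" "c' \<in> I" "c \<noteq> c'"
      then show "{q\<in>Y. subcube q c} \<inter> {q\<in>Y. subcube q c'} = {}"
        using cube_nonempty mem_cube_iff unfolding subcube_def I_def
        by (smt (verit, best) disjoint_iff ex_in_conv mem_Collect_eq subsetD)
    qed
    ultimately show ?thesis
      by (subst (1) \<open>Y = _\<close>, intro emeasure_UN_countable) auto
  qed
  have "emeasure (cost \<beta>) Z = (\<integral>\<^sup>+c. emeasure (cost \<beta>) {q\<in>Z. subcube q c} \<partial>count_space I)"
    using Z by (rule part)
  also have "\<dots> \<le> (\<integral>\<^sup>+c. emeasure (cost \<beta>) {q\<in>C. subcube q c} \<partial>count_space I)"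
  proof (rule nn_integral_mono)
    fix c assume "c \<in> space (count_space I)"
    then have c: "fst c = j" by (simp add: I_def)
    have "E \<inter> cube c \<subseteq> (\<Union>q\<in>{q\<in>C. subcube q c}. cube q)"
    proof
      fix x assume x: "x \<in> E \<inter> cube c"
      then obtain q where q: "q \<in> C" "x \<in> cube q" using C(1) by blast
      then have "subcube q c"
        using Cj[of q] c x by (intro subcube_if_meets) auto
      then show "x \<in> (\<Union>q\<in>{q\<in>C. subcube q c}. cube q)"
        using q by blast
    qed
    then show "emeasure (cost \<beta>) {q\<in>Z. subcube q c} \<le> emeasure (cost \<beta>) {q\<in>C. subcube q c}"
      using loc[OF c] dcontent_le order_trans by blast
  qed
  also have "\<dots> = emeasure (cost \<beta>) C"
    using Cj by (rule part[symmetric])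
  finally show False using C(2) by simp
qed


lemma cube_borel [measurable]: "cube q \<in> sets borel"
proof -
  have "cube q = (\<Inter>i\<in>UNIV. {x. \<lfloor>x $ i * 2 powr real_of_int (fst q)\<rfloor> = snd q $ i})"
    by (auto simp: cube_def)
  also have "\<dots> \<in> sets borel"
    by (intro sets.countable_INT'') auto
  finally show ?thesis .
qed

lemma emeasure_cube:
  fixes q :: "int \<times> (int^'n::finite)"
  shows "emeasure lborel (cube q) = ennreal (side q ^ CARD('n))"
proof -
  define s where "s = side q"
  have s: "0 < s" by (simp add: s_def)
  define a where "a = (\<chi> i. s * real_of_int (snd q $ i))"
  define b where "b = (\<chi> i. s * real_of_int (snd q $ i) + s)"
  have mem: "x \<in> cube q \<longleftrightarrow> (\<forall>i. a $ i \<le> x $ i \<and> x $ i < b $ i)" for x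
  proof -
    have "\<lfloor>y * 2 powr real_of_int (fst q)\<rfloor> = k \<longleftrightarrow> s * k \<le> y \<and> y < s * k + s" for y and k :: int
    proof -
      have "y * 2 powr real_of_int (fst q) = y / s"
        by (simp add: s_def side_def powr_minus_divide)
      moreover have "\<lfloor>y / s\<rfloor> = k \<longleftrightarrow> s * k \<le> y \<and> y < s * k + s"
        using s by (simp add: floor_eq_iff field_simps)
      ultimately show ?thesis by simp
    qed
    then show ?thesis by (simp add: cube_def a_def b_def)
  qed
  have ab: "\<And>i. i \<in> Basis \<Longrightarrow> a \<bullet> i \<le> b \<bullet> i"
    using s by (auto simp: a_def b_def Basis_vec_def inner_axis)
  have prod: "(\<Prod>i\<in>Basis. (b - a) \<bullet> i) = s ^ CARD('n)"
  proof -
    have "(\<Prod>i\<in>Basis. (b - a) \<bullet> i) = (\<Prod>i\<in>(Basis :: (real^'n) set). s)"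
      by (intro prod.cong) (auto simp: a_def b_def Basis_vec_def inner_axis)
    then show ?thesis by simp
  qed
  have "emeasure lborel (box a b) \<le> emeasure lborel (cube q)"
    by (intro emeasure_mono) (auto simp: mem box_def Basis_vec_def inner_axis less_imp_le)
  moreover have "emeasure lborel (cube q) \<le> emeasure lborel (cbox a b)"
    by (intro emeasure_mono) (auto simp: mem cbox_def Basis_vec_def inner_axis less_imp_le)
  moreover have "emeasure lborel (box a b) = ennreal (s ^ CARD('n))"
    using ab by (subst emeasure_lborel_box) (auto simp: prod)
  moreover have "emeasure lborel (cbox a b) = ennreal (s ^ CARD('n))"
    using ab by (subst emeasure_lborel_cbox) (auto simp: prod)
  ultimately show ?thesis
    by (simp add: s_def)
qed

lemma emeasure_UN_countable_le:
  assumes [measurable]: "\<And>i. i \<in> I \<Longrightarrow> X i \<in> sets M" and [simp]: "countable I"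
  shows "emeasure M (\<Union>(X ` I)) \<le> (\<integral>\<^sup>+i. emeasure M (X i) \<partial>count_space I)"
proof -
  note sets.countable_UN'[unfolded subset_eq, measurable]
  have "emeasure M (\<Union>(X ` I)) = (\<integral>\<^sup>+x. indicator (\<Union>(X ` I)) x \<partial>M)"
    by simp
  also have "\<dots> \<le> (\<integral>\<^sup>+x. \<integral>\<^sup>+i. indicator (X i) x \<partial>count_space I \<partial>M)"
  proof (rule nn_integral_mono)
    fix x
    show "indicator (\<Union>(X ` I)) x \<le> (\<integral>\<^sup>+i. indicator (X i) x \<partial>count_space I)"
    proof (cases "x \<in> \<Union>(X ` I)")
      case True
      then obtain j where j: "j \<in> I" "x \<in> X j" by blast
      have "(1::ennreal) = (\<integral>\<^sup>+i. indicator {j} i \<partial>count_space I)"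
        using j by simp
      also have "\<dots> \<le> (\<integral>\<^sup>+i. indicator (X i) x \<partial>count_space I)"
        using j by (intro nn_integral_mono) (auto split: split_indicator)
      finally show ?thesis using True by simp
    qed simp
  qed
  also have "\<dots> = (\<integral>\<^sup>+i. \<integral>\<^sup>+x. indicator (X i) x \<partial>M \<partial>count_space I)"
    by (simp add: nn_integral_count_space_nn_integral)
  finally show ?thesis
    by (simp cong: nn_integral_cong_simp)
qed

text \<open>A cube cannot be covered more cheaply than by itself. If all covering cubes are smaller than \<open>q\<close>, then
\<open>side r ^ d\<close> is at most \<open>side q powr (d - \<beta>) * side r powr \<beta>\<close>, and summing compares Lebesgue measure
with cost. This is where \<open>\<beta> \<le> d\<close> enters.\<close>

lemma dcontent_cube_ge:
  fixes q :: "int \<times> (int^'n::finite)"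
  assumes \<beta>: "0 < \<beta>" "\<beta> \<le> real CARD('n)"
  shows "ennreal (side q powr \<beta>) \<le> dcontent \<beta> (cube q)"
  unfolding dcontent_def
proof (rule INF_greatest, clarify)
  fix C assume C: "cube q \<subseteq> (\<Union>r\<in>C. cube r)"
  show "ennreal (side q powr \<beta>) \<le> emeasure (cost \<beta>) C"
  proof (cases "\<exists>r\<in>C. side q \<le> side r")
    case True
    then obtain r where r: "r \<in> C" "side q \<le> side r" by blast
    have "ennreal (side q powr \<beta>) \<le> emeasure (cost \<beta>) {r}"
      using r \<beta> by (simp add: emeasure_cost_singleton powr_mono2 ennreal_leI less_imp_le)
    also have "\<dots> \<le> emeasure (cost \<beta>) C"
      using r by (intro emeasure_mono) auto
    finally show ?thesis .
  next
    case False
    define \<gamma> where "\<gamma> = real CARD('n) - \<beta>"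
    have pw: "side r ^ CARD('n) = side r powr \<beta> * side r powr \<gamma>" for r :: "int \<times> (int^'n)"
      by (simp add: \<gamma>_def powr_add[symmetric] powr_realpow)
    have "ennreal (side q powr \<gamma>) * ennreal (side q powr \<beta>) = emeasure lborel (cube q)"
      by (simp add: emeasure_cube pw ennreal_mult mult.commute)
    also have "\<dots> \<le> emeasure lborel (\<Union>r\<in>C. cube r)"
      using C by (intro emeasure_mono sets.countable_UN') auto
    also have "\<dots> \<le> (\<integral>\<^sup>+r. emeasure lborel (cube r) \<partial>count_space C)"
      by (rule emeasure_UN_countable_le) auto
    also have "\<dots> \<le> (\<integral>\<^sup>+r. ennreal (side q powr \<gamma>) * ennreal (side r powr \<beta>) \<partial>count_space C)"
    proof (rule nn_integral_mono)
      fix r assume "r \<in> space (count_space C)"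
      then have "side r powr \<gamma> \<le> side q powr \<gamma>"
        using False \<beta> by (intro powr_mono2) (auto simp: \<gamma>_def not_le less_imp_le)
      then show "emeasure lborel (cube r) \<le> ennreal (side q powr \<gamma>) * ennreal (side r powr \<beta>)"
        by (simp add: emeasure_cube pw ennreal_mult[symmetric] ennreal_leI mult.commute[of "side r powr \<beta>"] mult_right_mono)
    qed
    also have "\<dots> = ennreal (side q powr \<gamma>) * emeasure (cost \<beta>) C"
      by (simp add: cost_def emeasure_density nn_integral_cmult nn_integral_count_space_indicator)
    finally show ?thesis
      by (subst (asm) ennreal_mult_le_mult_iff) (auto simp: side_pos[THEN less_imp_neq, symmetric])
  qed
qed


lemma cube_diff_less:
  assumes "x \<in> cube q" "y \<in> cube q"
  shows "\<bar>x $ i - y $ i\<bar> < side q"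
proof -
  have "\<lfloor>x $ i * 2 powr real_of_int (fst q)\<rfloor> = \<lfloor>y $ i * 2 powr real_of_int (fst q)\<rfloor>"
    using assms by (simp add: cube_def)
  then have "\<bar>x $ i * 2 powr real_of_int (fst q) - y $ i * 2 powr real_of_int (fst q)\<bar> < 1"
    by linarith
  then have "\<bar>x $ i - y $ i\<bar> * 2 powr real_of_int (fst q) < 1"
    by (simp add: left_diff_distrib[symmetric] abs_mult)
  then show ?thesis
    by (simp add: side_def powr_minus_divide field_simps)
qed

lemma cube_norm_diff_less:
  fixes x y :: "real^'n::finite"
  assumes "x \<in> cube q" "y \<in> cube q"
  shows "norm (x - y) < real CARD('n) * side q"
proof -
  have "norm (x - y) \<le> (\<Sum>i\<in>UNIV. \<bar>(x - y) $ i\<bar>)"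
    by (rule norm_le_l1_cart)
  also have "\<dots> < (\<Sum>i\<in>(UNIV::'n set). side q)"
    using cube_diff_less[OF assms] by (intro sum_strict_mono) auto
  finally show ?thesis by simp
qed

lemma open_contains_dyadic_cube:
  fixes x :: "real^'n::finite"
  assumes "open U" "x \<in> U"
  obtains q where "x \<in> cube q" "cube q \<subseteq> U"
proof -
  obtain e where e: "0 < e" "ball x e \<subseteq> U"
    using assms open_contains_ball by blast
  have "0 < e / real CARD('n)"
    using e by simp
  then obtain n where n: "(1/2::real) ^ n < e / real CARD('n)"
    using real_arch_pow_inv[of "e / real CARD('n)" "1/2"] by auto
  let ?q = "cube_at (int n) x"
  have sd: "side ?q = (1/2) ^ n"
    by (simp add: side_def powr_minus powr_realpow power_one_over inverse_eq_divide)
  have "cube ?q \<subseteq> ball x e"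
  proof
    fix y assume "y \<in> cube ?q"
    then have "norm (x - y) < real CARD('n) * (1/2) ^ n"
      using cube_norm_diff_less[of x ?q y] by (simp add: sd)
    also have "\<dots> < e"
      using n by (simp add: field_simps)
    finally show "y \<in> ball x e" by (simp add: dist_norm)
  qed
  then show thesis
    using that[of ?q] e by auto
qed

text \<open>Continuity of dyadic content along increasing open sets. Call a cube full for \<open>n\<close> if the part of \<open>E n\<close> in
it costs as much as the cube itself, and let \<open>T\<close> be the family of all maximal full cubes. Every point
of an open \<open>E n\<close> lies in a small cube inside \<open>E n\<close>, which is full, and full cubes have bounded size, so \<open>T\<close> covers the union. On the other
hand, above a full cube that is maximal no cube is full, so \<open>cost_le_dcontent_by_scale\<close> applies at
every coarser scale and, descending from a scale so coarse that nothing is full there, bounds the cost of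
those members of \<open>T\<close> that are already full for \<open>n\<close> by the content of \<open>E n\<close>.\<close>

lemma dcontent_UN_incseq:
  fixes E :: "nat \<Rightarrow> (real^'n::finite) set"
  assumes \<beta>: "0 < \<beta>" "\<beta> \<le> real CARD('n)"
    and inc: "incseq E" and op: "\<And>n. open (E n)"
  shows "dcontent \<beta> (\<Union>n. E n) \<le> (SUP n. dcontent \<beta> (E n))"
proof (cases "(SUP n. dcontent \<beta> (E n)) = top")
  case False
  define A where "A = (SUP n. dcontent \<beta> (E n))"
  have EA: "dcontent \<beta> (E n) \<le> A" for n
    unfolding A_def by (rule SUP_upper) simp
  (* full cubes cost at most A, so none has scale below j0 *)
  obtain j0 where j0: "A < ennreal ((2 powr (- real_of_int (j0 - 1))) powr \<beta>)"
  proof -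
    obtain a where a: "A = ennreal a" "0 \<le> a"
      using False by (cases A) (auto simp: A_def)
    have "1 < (2::real) powr \<beta>"
      using \<beta> by simp
    then obtain N where "a < (2 powr \<beta>) ^ N"
      using real_arch_pow by blast
    also have "(2 powr \<beta>) ^ N = (2 powr real N) powr \<beta>"
      by (simp add: powr_realpow[symmetric] powr_powr mult.commute)
    finally show thesis
      using a that[of "1 - int N"] by (simp add: ennreal_lessI)
  qed
  define S where "S n = {q. ennreal (side q powr \<beta>) \<le> dcontent \<beta> (E n \<inter> cube q)}" for n
  define T where "T = {q\<in>\<Union>n. S n. \<forall>q'\<in>\<Union>n. S n. subcube q q' \<longrightarrow> q' = q}"
  have S_inc: "S m \<subseteq> S n" if "m \<le> n" for m n
  proof -
    have "dcontent \<beta> (E m \<inter> cube q) \<le> dcontent \<beta> (E n \<inter> cube q)" for q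
      using incseqD[OF inc that] by (intro dcontent_mono) auto
    then show ?thesis
      unfolding S_def by (blast intro: order_trans)
  qed
  have S_scale: "j0 \<le> fst q" if "q \<in> S n" for q n
  proof (rule ccontr)
    assume "\<not> j0 \<le> fst q"
    then have "2 powr (- real_of_int (j0 - 1)) \<le> side q"
      by (simp add: side_def)
    then have "(2 powr (- real_of_int (j0 - 1))) powr \<beta> \<le> side q powr \<beta>"
      using \<beta> by (intro powr_mono2) auto
    then have "ennreal ((2 powr (- real_of_int (j0 - 1))) powr \<beta>) \<le> ennreal (side q powr \<beta>)"
      by (rule ennreal_leI)
    also have "\<dots> \<le> dcontent \<beta> (E n \<inter> cube q)"
      using that by (simp add: S_def)
    also have "\<dots> \<le> A"
      using EA[of n] dcontent_mono[of "E n \<inter> cube q" "E n"] by (meson inf_le1 order_trans)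
    finally show False using j0 by simp
  qed
  have loc: "emeasure (cost \<beta>) {q\<in>T \<inter> S n. subcube q P \<and> fst q \<le> fst P + int k}
      \<le> dcontent \<beta> (E n \<inter> cube P)" for n k P
  proof (induction k arbitrary: P)
    case 0
    show ?case
    proof (cases "P \<in> S n")
      case True
      then have "{q\<in>T \<inter> S n. subcube q P \<and> fst q \<le> fst P + int 0} \<subseteq> {P}"
        unfolding T_def by blast
      then have "emeasure (cost \<beta>) {q\<in>T \<inter> S n. subcube q P \<and> fst q \<le> fst P + int 0}
          \<le> emeasure (cost \<beta>) {P}"
        by (intro emeasure_mono) auto
      with True show ?thesis
        by (simp add: emeasure_cost_singleton S_def)
    next
      case False
      then have "{q\<in>T \<inter> S n. subcube q P \<and> fst q \<le> fst P + int 0} = {}"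
      proof (intro equals0I)
        fix q assume q: "q \<in> {q\<in>T \<inter> S n. subcube q P \<and> fst q \<le> fst P + int 0}"
        then have "fst P = fst q" by (simp add: subcube_def)
        then have "P = q" using q by (intro subcube_antisym_scale) auto
        then show False using q False by simp
      qed
      then show ?thesis by (simp only: emeasure_empty zero_le)
    qed
  next
    case (Suc k)
    show ?case
    proof (cases "P \<in> S n")
      case True
      then have "{q\<in>T \<inter> S n. subcube q P \<and> fst q \<le> fst P + int (Suc k)} \<subseteq> {P}"
        unfolding T_def by blast
      then have "emeasure (cost \<beta>) {q\<in>T \<inter> S n. subcube q P \<and> fst q \<le> fst P + int (Suc k)}
          \<le> emeasure (cost \<beta>) {P}"
        by (intro emeasure_mono) auto
      with True show ?thesis
        by (simp add: emeasure_cost_singleton S_def)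
    next
      case False
      let ?Z = "{q\<in>T \<inter> S n. subcube q P \<and> fst q \<le> fst P + int (Suc k)}"
      show ?thesis
      (* P is not full, so the part of E n in P may be localised to the children of P *)
      proof (rule cost_le_dcontent_by_scale[where j = "fst P + 1"])
        show "dcontent \<beta> (E n \<inter> cube P) < ennreal ((2 powr (- real_of_int (fst P + 1 - 1))) powr \<beta>)"
          using False by (simp add: S_def side_def)
        show "fst P + 1 \<le> fst q" if "q \<in> ?Z" for q
        proof -
          have "q \<in> S n" "subcube q P" using that by auto
          then have "fst P \<noteq> fst q"
            using False subcube_antisym_scale by blast
          moreover have "fst P \<le> fst q"
            using \<open>subcube q P\<close> by (simp add: subcube_def)
          ultimately show ?thesis by simp
        qed
        show "emeasure (cost \<beta>) {q \<in> ?Z. subcube q c} \<le> dcontent \<beta> (E n \<inter> cube P \<inter> cube c)"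
          if c: "fst c = fst P + 1" for c
        proof (cases "{q \<in> ?Z. subcube q c} = {}")
          case False
          then obtain q where q: "subcube q P" "subcube q c" by blast
          obtain x where "x \<in> cube q" using cube_nonempty by blast
          then have "x \<in> cube P" "x \<in> cube c"
            using q by (auto simp: subcube_def)
          then have "subcube c P"
            using c by (intro subcube_if_meets) auto
          then have eq: "E n \<inter> cube P \<inter> cube c = E n \<inter> cube c"
            by (auto simp: subcube_def)
          have "emeasure (cost \<beta>) {q \<in> ?Z. subcube q c}
              \<le> emeasure (cost \<beta>) {q\<in>T \<inter> S n. subcube q c \<and> fst q \<le> fst c + int k}"
            using c by (intro emeasure_mono) auto
          also have "\<dots> \<le> dcontent \<beta> (E n \<inter> cube c)"
            by (rule Suc.IH)
          finally show ?thesis by (simp add: eq)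
        qed (simp only: emeasure_empty zero_le)
      qed (fact \<beta>)
    qed
  qed
  have top: "emeasure (cost \<beta>) {q\<in>T \<inter> S n. fst q \<le> j0 + int k} \<le> dcontent \<beta> (E n)" for n k
  proof (rule cost_le_dcontent_by_scale[where j = j0])
    show "dcontent \<beta> (E n) < ennreal ((2 powr (- real_of_int (j0 - 1))) powr \<beta>)"
      using EA j0 order_le_less_trans by blast
    show "j0 \<le> fst q" if "q \<in> {q\<in>T \<inter> S n. fst q \<le> j0 + int k}" for q
      using that S_scale by blast
    show "emeasure (cost \<beta>) {q \<in> {q\<in>T \<inter> S n. fst q \<le> j0 + int k}. subcube q c}
        \<le> dcontent \<beta> (E n \<inter> cube c)" if c: "fst c = j0" for c
    proof -
      have "emeasure (cost \<beta>) {q \<in> {q\<in>T \<inter> S n. fst q \<le> j0 + int k}. subcube q c}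
          \<le> emeasure (cost \<beta>) {q\<in>T \<inter> S n. subcube q c \<and> fst q \<le> fst c + int k}"
        using c by (intro emeasure_mono) auto
      also have "\<dots> \<le> dcontent \<beta> (E n \<inter> cube c)"
        by (rule loc)
      finally show ?thesis .
    qed
  qed (fact \<beta>)
  have cover: "(\<Union>n. E n) \<subseteq> (\<Union>q\<in>T. cube q)"
  proof
    fix x assume "x \<in> (\<Union>n. E n)"
    then obtain n where n: "x \<in> E n" by blast
    obtain q where q: "x \<in> cube q" "cube q \<subseteq> E n"
      using open_contains_dyadic_cube[OF op n] by blast
    have "E n \<inter> cube q = cube q" using q by auto
    then have qS: "q \<in> S n"
      using dcontent_cube_ge[OF \<beta>, of q] by (simp add: S_def)
    define good where "good k \<longleftrightarrow> cube_at (j0 + int k) x \<in> (\<Union>n. S n)" for k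
    have "good (nat (fst q - j0))"
      using qS q(1) S_scale[OF qS] mem_cube_iff[of x q] by (auto simp: good_def)
    then have good: "good (Least good)"
      by (rule LeastI)
    let ?q = "cube_at (j0 + int (Least good)) x"
    have "?q \<in> T"
      unfolding T_def
    proof (intro CollectI conjI ballI impI)
      show "?q \<in> (\<Union>n. S n)"
        using good by (simp add: good_def)
      fix q' assume q': "q' \<in> (\<Union>n. S n)" "subcube ?q q'"
      then have j: "j0 \<le> fst q'" "fst q' \<le> j0 + int (Least good)"
        using S_scale by (blast, simp add: subcube_def)
      have "x \<in> cube q'"
        using q'(2) mem_cube_at unfolding subcube_def by blast
      then have eq: "q' = cube_at (fst q') x"
        by (simp add: mem_cube_iff)
      have "good (nat (fst q' - j0))"
        using q'(1) eq j by (simp add: good_def)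
      then have "Least good \<le> nat (fst q' - j0)"
        by (rule Least_le)
      then have "fst q' = j0 + int (Least good)"
        using j by linarith
      then show "q' = ?q"
        using eq by simp
    qed
    then show "x \<in> (\<Union>q\<in>T. cube q)"
      using mem_cube_at by blast
  qed
  define U where "U n = {q\<in>T \<inter> S n. fst q \<le> j0 + int n}" for n
  have "T = (\<Union>n. U n)"
  proof (intro equalityI subsetI)
    fix q assume q: "q \<in> T"
    then obtain m where m: "q \<in> S m" by (auto simp: T_def)
    define k where "k = max m (nat (fst q - j0))"
    have "q \<in> S k"
      using m S_inc[of m k] by (auto simp: k_def)
    then have "q \<in> U k"
      using q by (auto simp: U_def k_def)
    then show "q \<in> (\<Union>n. U n)" by blast
  qed (auto simp: U_def)
  moreover have "incseq U"
  proof (rule incseq_SucI)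
    fix n
    show "U n \<subseteq> U (Suc n)"
      using S_inc[of n "Suc n"] unfolding U_def by auto
  qed
  ultimately have "emeasure (cost \<beta>) T = (SUP n. emeasure (cost \<beta>) (U n))"
    by (simp add: SUP_emeasure_incseq)
  also have "\<dots> \<le> (SUP n. dcontent \<beta> (E n))"
    unfolding U_def by (intro SUP_mono) (use top in blast)
  finally show ?thesis
    using dcontent_le[OF cover, of \<beta>] by (meson order_trans)
qed (simp only: top_greatest)

section \<open>The Choquet integral for dyadic content\<close>

lemma antimono_ennreal_borel:
  fixes g :: "real \<Rightarrow> ennreal"
  assumes "antimono g"
  shows "g \<in> borel_measurable borel"
proof (rule borel_measurableI_greater)
  fix y
  define S where "S = {x. y < g x}"
  have down: "x \<in> S" if "z \<in> S" "x \<le> z" for x z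
    using that antimonoD[OF assms that(2)] unfolding S_def by auto
  have "S \<in> sets borel"
  proof (cases "S = {} \<or> \<not> bdd_above S")
    case True
    have "S = UNIV" if "\<not> bdd_above S"
      using that down unfolding bdd_above_def by (auto simp: not_le) (meson less_imp_le)
    then show ?thesis using True by auto
  next
    case False
    then have "{..<Sup S} \<subseteq> S" "S \<subseteq> {..Sup S}"
      using down less_cSup_iff[of S] cSup_upper[of _ S] by (auto simp: less_imp_le)
    then have "S = {..<Sup S} \<or> S = {..Sup S}"
      using ivl_disj_un_singleton(2)[of "Sup S"] by blast
    then show ?thesis by (metis atMost_borel lessThan_borel)
  qed
  then show "{x \<in> space borel. y < g x} \<in> sets borel"
    by (simp add: S_def)
qed

definition dchoquet :: "real \<Rightarrow> (real^'n::finite \<Rightarrow> real) \<Rightarrow> ennreal" where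
  "dchoquet \<beta> f = (\<integral>\<^sup>+t\<in>{0<..}. dcontent \<beta> {x. t < f x} \<partial>lborel)"

lemma level_content_measurable [measurable]:
  fixes f :: "real^'n::finite \<Rightarrow> real"
  shows "(\<lambda>t. dcontent \<beta> {x. t < f x}) \<in> borel_measurable borel"
  by (intro antimono_ennreal_borel antimonoI dcontent_mono) auto

text \<open>Split off one largest cube \<open>Q m\<close>. Every other cube lies inside it or is disjoint from it. Inside \<open>Q m\<close> the sum
is the constant \<open>c m\<close> plus the sum over the smaller cubes, so the levels up to \<open>c m\<close> cost at most the whole
cube and the higher ones are levels of the smaller sum shifted by \<open>c m\<close>; outside only the disjoint cubes
contribute.\<close>

lemma dchoquet_weighted_cubes:
  fixes Q :: "'i \<Rightarrow> int \<times> (int^'n::finite)"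
  assumes "finite I" and "\<And>i. i \<in> I \<Longrightarrow> 0 \<le> c i"
  shows "dchoquet \<beta> (\<lambda>x. \<Sum>i\<in>I. c i * indicator (cube (Q i)) x)
    \<le> ennreal (\<Sum>i\<in>I. c i * side (Q i) powr \<beta>)"
  using assms
proof (induction "card I" arbitrary: I rule: less_induct)
  case less
  show ?case
  proof (cases "I = {}")
    case True
    then have "dcontent \<beta> {x. t < (\<Sum>i\<in>I. c i * indicator (cube (Q i)) x)} * indicator {0<..} t = 0" for t :: real
      by (cases "0 < t") auto
    then show ?thesis by (simp only: dchoquet_def nn_integral_const mult_zero_left zero_le)
  next
    case False
    obtain m where m: "m \<in> I" "\<And>i. i \<in> I \<Longrightarrow> fst (Q m) \<le> fst (Q i)"
    proof -
      have "Min ((\<lambda>i. fst (Q i)) ` I) \<in> (\<lambda>i. fst (Q i)) ` I"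
        using False less.prems(1) by (intro Min_in) auto
      then obtain m where "m \<in> I" "fst (Q m) = Min ((\<lambda>i. fst (Q i)) ` I)"
        by auto
      then show thesis
        using that less.prems(1) by simp
    qed
    define J where "J = {i\<in>I - {m}. subcube (Q i) (Q m)}"
    define K where "K = {i\<in>I. \<not> subcube (Q i) (Q m)}"
    have I: "I = insert m (J \<union> K)" "m \<notin> J \<union> K" "J \<inter> K = {}" "finite J" "finite K"
      using m less.prems by (auto simp: J_def K_def)
    have c: "card J < card I" "card K < card I"
    proof -
      have "m \<notin> K" by (simp add: K_def)
      then have "J \<subset> I" "K \<subset> I"
        using m unfolding J_def K_def by blast+
      then show "card J < card I" "card K < card I"
        using less.prems by (auto intro: psubset_card_mono)
    qed
    define fJ where "fJ x = (\<Sum>i\<in>J. c i * indicator (cube (Q i)) x)" for x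
    define fK where "fK x = (\<Sum>i\<in>K. c i * indicator (cube (Q i)) x)" for x
    define f where "f x = (\<Sum>i\<in>I. c i * indicator (cube (Q i)) x)" for x
    have split: "sum h I = h m + (sum h J + sum h K)" for h :: "'i \<Rightarrow> real"
    proof -
      have "sum h I = sum h (insert m (J \<union> K))" using I(1) by (rule arg_cong)
      also have "\<dots> = h m + sum h (J \<union> K)"
        using I by (intro sum.insert) auto
      also have "sum h (J \<union> K) = sum h J + sum h K"
        using I by (intro sum.union_disjoint) auto
      finally show ?thesis .
    qed
    have fsplit: "f x = c m * indicator (cube (Q m)) x + (fJ x + fK x)" for x
      unfolding f_def fJ_def fK_def by (rule split)
    have cJK: "0 \<le> c i" if "i \<in> J \<or> i \<in> K" for i
      using that less.prems(2) unfolding J_def K_def by blast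
    have IH: "dchoquet \<beta> fJ \<le> ennreal (\<Sum>i\<in>J. c i * side (Q i) powr \<beta>)"
      "dchoquet \<beta> fK \<le> ennreal (\<Sum>i\<in>K. c i * side (Q i) powr \<beta>)"
    proof -
      show "dchoquet \<beta> fJ \<le> ennreal (\<Sum>i\<in>J. c i * side (Q i) powr \<beta>)"
        unfolding fJ_def by (rule less.hyps[OF c(1) I(4)]) (use cJK in blast)
      show "dchoquet \<beta> fK \<le> ennreal (\<Sum>i\<in>K. c i * side (Q i) powr \<beta>)"
        unfolding fK_def by (rule less.hyps[OF c(2) I(5)]) (use cJK in blast)
    qed
    have fin: "f x = c m + fJ x" if "x \<in> cube (Q m)" for x
    proof -
      have "fK x = 0"
        unfolding fK_def
      proof (intro sum.neutral ballI)
        fix i assume "i \<in> K"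
        then have "x \<notin> cube (Q i)"
          using m(2) that subcube_if_meets unfolding K_def by blast
        then show "c i * indicator (cube (Q i)) x = 0" by simp
      qed
      then show ?thesis
        using that by (simp add: fsplit)
    qed
    have fout: "f x = fK x" if "x \<notin> cube (Q m)" for x
    proof -
      have "fJ x = 0"
        unfolding fJ_def
      proof (intro sum.neutral ballI)
        fix i assume "i \<in> J"
        then have "x \<notin> cube (Q i)"
          using that unfolding J_def subcube_def by blast
        then show "c i * indicator (cube (Q i)) x = 0" by simp
      qed
      then show ?thesis
        using that by (simp add: fsplit)
    qed
    have cm: "0 \<le> c m" using m less.prems by blast
    have level: "dcontent \<beta> {x. t < f x} \<le>
        ennreal (side (Q m) powr \<beta>) * indicator {0<..c m} t
          + dcontent \<beta> {x. t - c m < fJ x} * indicator {c m<..} t + dcontent \<beta> {x. t < fK x}"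
      if t: "0 < t" for t
    proof -
      have "dcontent \<beta> {x. t < f x} \<le> dcontent \<beta> (({x. t < f x} \<inter> cube (Q m)) \<union> {x. t < fK x})"
      proof (intro dcontent_mono subsetI)
        fix x assume "x \<in> {x. t < f x}"
        then show "x \<in> ({x. t < f x} \<inter> cube (Q m)) \<union> {x. t < fK x}"
          by (cases "x \<in> cube (Q m)") (auto simp: fout)
      qed
      also have "\<dots> \<le> dcontent \<beta> ({x. t < f x} \<inter> cube (Q m)) + dcontent \<beta> {x. t < fK x}"
        by (rule dcontent_Un)
      also have "dcontent \<beta> ({x. t < f x} \<inter> cube (Q m)) \<le> ennreal (side (Q m) powr \<beta>) * indicator {0<..c m} t
          + dcontent \<beta> {x. t - c m < fJ x} * indicator {c m<..} t"
      proof (cases "t \<le> c m")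
        case True
        have "dcontent \<beta> ({x. t < f x} \<inter> cube (Q m)) \<le> dcontent \<beta> (cube (Q m))"
          by (intro dcontent_mono) auto
        then show ?thesis
          using True t dcontent_cube_le[of \<beta> "Q m"] by (auto intro: order_trans)
      next
        case False
        have "dcontent \<beta> ({x. t < f x} \<inter> cube (Q m)) \<le> dcontent \<beta> {x. t - c m < fJ x}"
          using fin by (intro dcontent_mono) auto
        then show ?thesis
          using False by auto
      qed
      finally show ?thesis by (simp add: add_right_mono)
    qed
    have "dchoquet \<beta> f \<le> (\<integral>\<^sup>+t. ennreal (side (Q m) powr \<beta>) * indicator {0<..c m} t
        + dcontent \<beta> {x. t - c m < fJ x} * indicator {c m<..} t
        + dcontent \<beta> {x. t < fK x} * indicator {0<..} t \<partial>lborel)"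
      unfolding dchoquet_def
    proof (rule nn_integral_mono)
      fix t :: real
      show "dcontent \<beta> {x. t < f x} * indicator {0<..} t \<le> ennreal (side (Q m) powr \<beta>) * indicator {0<..c m} t
        + dcontent \<beta> {x. t - c m < fJ x} * indicator {c m<..} t
        + dcontent \<beta> {x. t < fK x} * indicator {0<..} t"
        using level[of t] by (cases "0 < t") auto
    qed
    also have "\<dots> = (\<integral>\<^sup>+t. ennreal (side (Q m) powr \<beta>) * indicator {0<..c m} t \<partial>lborel)
        + (\<integral>\<^sup>+t. dcontent \<beta> {x. t - c m < fJ x} * indicator {c m<..} t \<partial>lborel)
        + dchoquet \<beta> fK"
    proof -
      have [measurable]: "(\<lambda>t. dcontent \<beta> {x. t - c m < fJ x}) \<in> borel_measurable borel"
        by (intro antimono_ennreal_borel antimonoI dcontent_mono) auto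
      show ?thesis
        unfolding dchoquet_def by (simp add: nn_integral_add)
    qed
    also have "(\<integral>\<^sup>+t. ennreal (side (Q m) powr \<beta>) * indicator {0<..c m} t \<partial>lborel)
        = ennreal (c m * side (Q m) powr \<beta>)"
      using cm by (simp add: nn_integral_cmult_indicator ennreal_mult[symmetric] mult.commute)
    also have "(\<integral>\<^sup>+t. dcontent \<beta> {x. t - c m < fJ x} * indicator {c m<..} t \<partial>lborel) = dchoquet \<beta> fJ"
    proof -
      have [measurable]: "(\<lambda>t. dcontent \<beta> {x. t - c m < fJ x}) \<in> borel_measurable borel"
        by (intro antimono_ennreal_borel antimonoI dcontent_mono) auto
      show ?thesis
        unfolding dchoquet_def
        by (subst nn_integral_real_affine[where c = 1 and t = "c m"])
          (auto intro!: nn_integral_cong split: split_indicator)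
    qed
    finally have "dchoquet \<beta> f \<le> ennreal (c m * side (Q m) powr \<beta>)
        + ennreal (\<Sum>i\<in>J. c i * side (Q i) powr \<beta>) + ennreal (\<Sum>i\<in>K. c i * side (Q i) powr \<beta>)"
      using IH by (meson add_mono order_refl order_trans)
    also have "\<dots> = ennreal (\<Sum>i\<in>I. c i * side (Q i) powr \<beta>)"
    proof -
      have "0 \<le> (\<Sum>i\<in>J. c i * side (Q i) powr \<beta>)" "0 \<le> (\<Sum>i\<in>K. c i * side (Q i) powr \<beta>)"
        using cJK by (auto intro!: sum_nonneg)
      then show ?thesis
        using cm by (simp add: split add.assoc flip: ennreal_plus)
    qed
    finally show ?thesis
      unfolding f_def .
  qed
qed

lemma ennreal_le_mult_if_divide_le:
  assumes "0 < c" "x / ennreal c \<le> y"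
  shows "x \<le> ennreal c * y"
proof -
  have "x / ennreal c * ennreal c \<le> y * ennreal c"
    using assms(2) by (rule mult_right_mono) simp
  moreover have "x / ennreal c * ennreal c = x"
    using assms(1) by (simp add: ennreal_divide_times ennreal_divide_self)
  ultimately show ?thesis by (simp add: mult.commute)
qed

text \<open>A cube of side \<open>s\<close> lies in a ball of radius \<open>d * s\<close> around any of its points.\<close>

lemma hausdorff_content_le_dcontent:
  fixes E :: "(real^'n::finite) set"
  assumes \<beta>: "0 < \<beta>"
  shows "hausdorff_content \<beta> E \<le> ennreal (unit_ball_vol \<beta> * real CARD('n) powr \<beta>) * dcontent \<beta> E"
proof -
  define k where "k = unit_ball_vol \<beta> * real CARD('n) powr \<beta>"
  have k: "0 < k" using \<beta> by (simp add: k_def)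
  have "hausdorff_content \<beta> E \<le> ennreal k * emeasure (cost \<beta>) C"
    if C: "E \<subseteq> (\<Union>q\<in>C. cube q)" for C
  proof -
    define r where "r n = (if n \<in> to_nat ` C then real CARD('n) * side (from_nat n :: int \<times> (int^'n)) else 0)" for n
    define x where "x n = (SOME y. y \<in> cube (from_nat n :: int \<times> (int^'n)))" for n
    have x: "x (to_nat q) \<in> cube q" for q :: "int \<times> (int^'n)"
      using cube_nonempty[of q] unfolding x_def from_nat_to_nat by (metis ex_in_conv someI_ex)
    have r: "r (to_nat q) = real CARD('n) * side q" if "q \<in> C" for q
      using that by (simp add: r_def)
    have cov: "E \<subseteq> (\<Union>n. ball (x n) (r n))"
    proof
      fix y assume "y \<in> E"
      then obtain q where q: "q \<in> C" "y \<in> cube q" using C by blast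
      then have "y \<in> ball (x (to_nat q)) (r (to_nat q))"
        using cube_norm_diff_less[OF x q(2)] by (simp add: r dist_norm)
      then show "y \<in> (\<Union>n. ball (x n) (r n))" by blast
    qed
    have "hausdorff_content \<beta> E \<le> (\<Sum>n. ennreal (unit_ball_vol \<beta> * r n powr \<beta>))"
      unfolding hausdorff_content_def
    proof (intro Inf_lower CollectI exI conjI)
      show "\<forall>i. 0 \<le> r i" by (simp add: r_def less_imp_le)
    qed (use cov in auto)
    also have "\<dots> = (\<integral>\<^sup>+n. ennreal (unit_ball_vol \<beta> * r n powr \<beta>) \<partial>count_space UNIV)"
      by (simp add: nn_integral_count_space_nat)
    also have "\<dots> = (\<integral>\<^sup>+n. ennreal (unit_ball_vol \<beta> * r n powr \<beta>) \<partial>count_space (to_nat ` C))"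
      using \<beta> by (intro nn_integral_count_space_eq) (auto simp: r_def)
    also have "\<dots> = (\<integral>\<^sup>+q. ennreal (unit_ball_vol \<beta> * r (to_nat q) powr \<beta>) \<partial>count_space C)"
      by (intro nn_integral_bij_count_space[symmetric] bij_betw_imageI) (auto simp: inj_on_def)
    also have "\<dots> = (\<integral>\<^sup>+q. ennreal k * ennreal (side q powr \<beta>) \<partial>count_space C)"
      by (intro nn_integral_cong) (auto simp: r k_def powr_mult ennreal_mult'[symmetric] mult_ac less_imp_le)
    also have "\<dots> = ennreal k * emeasure (cost \<beta>) C"
      by (simp add: cost_def emeasure_density nn_integral_cmult nn_integral_count_space_indicator)
    finally show ?thesis .
  qed
  then have "hausdorff_content \<beta> E / ennreal k \<le> dcontent \<beta> E"
    unfolding dcontent_def using k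
    by (intro INF_greatest) (auto simp: divide_le_posI_ennreal mult.commute)
  then have "hausdorff_content \<beta> E \<le> ennreal k * dcontent \<beta> E"
    by (rule ennreal_le_mult_if_divide_le[OF k])
  then show ?thesis
    by (simp only: k_def)
qed

section \<open>Finite signed measures\<close>

lemma signed_measure_empty: "signed_measure \<mu> \<Longrightarrow> \<mu> {} = 0"
  by (simp add: signed_measure_def)

lemma signed_measure_sums:
  "signed_measure \<mu> \<Longrightarrow> (\<And>i::nat. A i \<in> sets borel) \<Longrightarrow> disjoint_family A \<Longrightarrow>
    (\<lambda>i. \<mu> (A i)) sums \<mu> (\<Union>i. A i)"
  by (auto simp: signed_measure_def)

lemma signed_measure_Un:
  assumes "signed_measure \<mu>" "A \<in> sets borel" "B \<in> sets borel" "A \<inter> B = {}"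
  shows "\<mu> (A \<union> B) = \<mu> A + \<mu> B"
proof -
  have "(\<lambda>i. \<mu> (binaryset A B i)) sums \<mu> (\<Union>i. binaryset A B i)"
    using assms by (intro signed_measure_sums) (auto simp: binaryset_def disjoint_family_on_def)
  moreover have "(\<lambda>i. \<mu> (binaryset A B i)) sums (\<mu> A + \<mu> B)"
    using signed_measure_empty[OF assms(1)] by (rule binaryset_sums)
  ultimately show ?thesis
    using sums_unique2 by (simp add: UN_binaryset_eq) blast
qed

lemma signed_measure_Diff:
  assumes "signed_measure \<mu>" "A \<in> sets borel" "B \<in> sets borel" "B \<subseteq> A"
  shows "\<mu> (A - B) = \<mu> A - \<mu> B"
proof -
  have "\<mu> (B \<union> (A - B)) = \<mu> B + \<mu> (A - B)"
    using assms by (intro signed_measure_Un) auto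
  moreover have "B \<union> (A - B) = A" using assms by auto
  ultimately show ?thesis by simp
qed

lemma signed_measure_cmult: "signed_measure \<mu> \<Longrightarrow> signed_measure (\<lambda>A. c * \<mu> A)"
  unfolding signed_measure_def by (auto intro: sums_mult)

lemma signed_measure_uminus: "signed_measure \<mu> \<Longrightarrow> signed_measure (\<lambda>A. - \<mu> A)"
  using signed_measure_cmult[of \<mu> "-1"] by simp

lemma signed_measure_sum:
  "(\<And>i. i \<in> I \<Longrightarrow> signed_measure (\<mu> i)) \<Longrightarrow> signed_measure (\<lambda>A. \<Sum>i\<in>I. \<mu> i A)"
  unfolding signed_measure_def by (auto intro!: sums_sum)

text \<open>If the values were unbounded, then one could split off again and again a piece of measure at least \<open>1\<close> in
modulus while keeping the values on the rest unbounded; the pieces would contradict countable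
additivity. This is what makes the Jordan parts finite measures.\<close>

lemma signed_measure_bounded:
  fixes \<mu> :: "'n::finite set_fun"
  assumes \<mu>: "signed_measure \<mu>"
  obtains K where "\<And>A. A \<in> sets borel \<Longrightarrow> \<bar>\<mu> A\<bar> \<le> K"
proof -
  define unb where "unb E \<longleftrightarrow> E \<in> sets borel \<and> (\<forall>K. \<exists>A\<in>sets borel. A \<subseteq> E \<and> K < \<bar>\<mu> A\<bar>)"
    for E :: "(real^'n) set"
  have step: "\<exists>E'. unb E' \<and> E' \<subseteq> E \<and> 1 \<le> \<bar>\<mu> (E - E')\<bar>" if E: "unb E" for E
  proof -
    have Eb: "E \<in> sets borel" using E by (simp add: unb_def)
    obtain B where B: "B \<in> sets borel" "B \<subseteq> E" "\<bar>\<mu> E\<bar> + 1 < \<bar>\<mu> B\<bar>"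
      using E unfolding unb_def by meson
    (* whichever of B and E - B keeps unbounded values, the other one is a piece to split off *)
    have big: "1 \<le> \<bar>\<mu> (E - B)\<bar>" "1 \<le> \<bar>\<mu> (E - (E - B))\<bar>"
    proof -
      show "1 \<le> \<bar>\<mu> (E - B)\<bar>"
        using B signed_measure_Diff[OF \<mu> Eb B(1,2)] by linarith
      have "E - (E - B) = B" using B by auto
      then show "1 \<le> \<bar>\<mu> (E - (E - B))\<bar>" using B(3) by simp
    qed
    have "unb B \<or> unb (E - B)"
    proof (rule ccontr)
      assume "\<not> ?thesis"
      then have n: "\<not> unb B" "\<not> unb (E - B)" by auto
      have EB: "E - B \<in> sets borel" using B Eb by auto
      obtain K1 where K1: "\<And>A. A \<in> sets borel \<Longrightarrow> A \<subseteq> B \<Longrightarrow> \<bar>\<mu> A\<bar> \<le> K1"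
        using n(1) B(1) unfolding unb_def not_less[symmetric] by blast
      obtain K2 where K2: "\<And>A. A \<in> sets borel \<Longrightarrow> A \<subseteq> E - B \<Longrightarrow> \<bar>\<mu> A\<bar> \<le> K2"
        using n(2) EB unfolding unb_def not_less[symmetric] by blast
      obtain A where A: "A \<in> sets borel" "A \<subseteq> E" "K1 + K2 < \<bar>\<mu> A\<bar>"
        using E unfolding unb_def by meson
      have "\<mu> ((A \<inter> B) \<union> (A - B)) = \<mu> (A \<inter> B) + \<mu> (A - B)"
        using \<mu> A B by (intro signed_measure_Un) auto
      moreover have "(A \<inter> B) \<union> (A - B) = A" by auto
      ultimately have "\<mu> A = \<mu> (A \<inter> B) + \<mu> (A - B)" by simp
      moreover have "\<bar>\<mu> (A \<inter> B)\<bar> \<le> K1" "\<bar>\<mu> (A - B)\<bar> \<le> K2"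
        using A B Eb by (auto intro!: K1 K2)
      ultimately show False using A(3) by linarith
    qed
    then show ?thesis
    proof
      assume "unb B"
      then show ?thesis using big(1) B(2) by (intro exI[of _ B] conjI)
    next
      assume "unb (E - B)"
      then show ?thesis using big(2) by (intro exI[of _ "E - B"] conjI Diff_subset)
    qed
  qed
  have "\<not> unb UNIV"
  proof
    assume "unb UNIV"
    then have "\<exists>f. \<forall>n::nat. unb (f n) \<and> (f (Suc n) \<subseteq> f n \<and> 1 \<le> \<bar>\<mu> (f n - f (Suc n))\<bar>)"
      using step by (intro dependent_nat_choice) auto
    then obtain f where f: "\<And>n::nat. unb (f n)" "\<And>n. f (Suc n) \<subseteq> f n" "\<And>n. 1 \<le> \<bar>\<mu> (f n - f (Suc n))\<bar>"
      by blast
    have dec: "f n \<subseteq> f m" if "m \<le> n" for m n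
      using f(2) that by (rule lift_Suc_antimono_le)
    have "disjoint_family (\<lambda>n. f n - f (Suc n))"
      unfolding disjoint_family_on_def
    proof (intro ballI impI)
      fix m n :: nat assume "m \<noteq> n"
      then have "Suc m \<le> n \<or> Suc n \<le> m" by linarith
      then show "(f m - f (Suc m)) \<inter> (f n - f (Suc n)) = {}"
        using dec[of "Suc m" n] dec[of "Suc n" m] by auto
    qed
    then have "(\<lambda>n. \<mu> (f n - f (Suc n))) sums \<mu> (\<Union>n. f n - f (Suc n))"
      using f(1) by (intro signed_measure_sums[OF \<mu>]) (auto simp: unb_def)
    then have "(\<lambda>n. \<mu> (f n - f (Suc n))) \<longlonglongrightarrow> 0"
      by (intro summable_LIMSEQ_zero sums_summable)
    then have "\<exists>n. \<bar>\<mu> (f n - f (Suc n))\<bar> < 1"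
      using LIMSEQ_D[of _ 0 1] by fastforce
    then show False using f(3) by (meson not_less)
  qed
  then show thesis
    using that unfolding unb_def by (metis linorder_not_less sets.top space_borel subset_UNIV)
qed

text \<open>The set function from which \<open>pos_part\<close> is generated.\<close>

definition upper_variation :: "'n::finite set_fun \<Rightarrow> (real^'n) set \<Rightarrow> ennreal" where
  "upper_variation \<mu> A = (SUP B \<in> {B \<in> sets borel. B \<subseteq> A}. ennreal (\<mu> B))"

lemma upper_variation_ge: "B \<in> sets borel \<Longrightarrow> B \<subseteq> A \<Longrightarrow> ennreal (\<mu> B) \<le> upper_variation \<mu> A"
  unfolding upper_variation_def by (rule SUP_upper) auto

lemma upper_variation_finite:
  assumes "signed_measure \<mu>"
  shows "upper_variation \<mu> A < top"
proof -
  obtain K where "\<And>A. A \<in> sets borel \<Longrightarrow> \<bar>\<mu> A\<bar> \<le> K"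
    using signed_measure_bounded[OF assms] by blast
  then have "upper_variation \<mu> A \<le> ennreal K"
    unfolding upper_variation_def by (intro SUP_least ennreal_leI) force
  then show ?thesis
    using ennreal_less_top order_le_less_trans by blast
qed

text \<open>The cases with a negative value are reduced to one summand, because \<open>ennreal\<close> replaces it by \<open>0\<close>.\<close>

lemma upper_variation_superadditive:
  assumes \<mu>: "signed_measure \<mu>" and AB: "A \<inter> B = {}"
  shows "upper_variation \<mu> A + upper_variation \<mu> B \<le> upper_variation \<mu> (A \<union> B)"
proof -
  have 1: "ennreal (\<mu> C) + ennreal (\<mu> D) \<le> upper_variation \<mu> (A \<union> B)"
    if "C \<in> sets borel" "C \<subseteq> A" "D \<in> sets borel" "D \<subseteq> B" for C D
  proof -
    consider "\<mu> C \<le> 0" | "\<mu> D \<le> 0" | "0 \<le> \<mu> C" "0 \<le> \<mu> D" by linarith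
    then show ?thesis
    proof cases
      case 1
      then show ?thesis using that upper_variation_ge[of D "A \<union> B" \<mu>] by (auto simp: ennreal_neg)
    next
      case 2
      then show ?thesis using that upper_variation_ge[of C "A \<union> B" \<mu>] by (auto simp: ennreal_neg)
    next
      case 3
      have "\<mu> (C \<union> D) = \<mu> C + \<mu> D"
        using that AB by (intro signed_measure_Un[OF \<mu>]) auto
      moreover have "ennreal (\<mu> (C \<union> D)) \<le> upper_variation \<mu> (A \<union> B)"
        using that by (intro upper_variation_ge) auto
      ultimately show ?thesis using 3 by simp
    qed
  qed
  have 2: "ennreal (\<mu> C) + upper_variation \<mu> B \<le> upper_variation \<mu> (A \<union> B)" if "C \<in> sets borel" "C \<subseteq> A" for C
    unfolding upper_variation_def[of \<mu> B] using that
    by (subst ennreal_SUP_add_right) (auto intro!: SUP_least 1)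
  have "upper_variation \<mu> B + upper_variation \<mu> A \<le> upper_variation \<mu> (A \<union> B)"
    unfolding upper_variation_def[of \<mu> A]
    by (subst ennreal_SUP_add_right) (auto intro!: SUP_least 2 simp: add.commute[of "upper_variation \<mu> B"])
  then show ?thesis by (simp add: add.commute)
qed

lemma upper_variation_empty: "signed_measure \<mu> \<Longrightarrow> upper_variation \<mu> {} = 0"
  by (auto simp: upper_variation_def signed_measure_empty SUP_constant intro!: antisym SUP_least)

lemma upper_variation_mono: "A \<subseteq> B \<Longrightarrow> upper_variation \<mu> A \<le> upper_variation \<mu> B"
  unfolding upper_variation_def by (rule SUP_subset_mono) auto

lemma ennreal_sum_le: "ennreal (sum f A) \<le> (\<Sum>i\<in>A. ennreal (f i))"
proof -
  have "ennreal (sum f A) \<le> ennreal (\<Sum>i\<in>A. max 0 (f i))"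
    by (intro ennreal_leI sum_mono) auto
  also have "\<dots> = (\<Sum>i\<in>A. ennreal (max 0 (f i)))"
    by (rule sum_ennreal[symmetric]) auto
  also have "\<dots> = (\<Sum>i\<in>A. ennreal (f i))"
    by (intro sum.cong) (auto simp: max_def ennreal_neg)
  finally show ?thesis .
qed

lemma upper_variation_countably_additive:
  fixes \<mu> :: "'n::finite set_fun"
  assumes \<mu>: "signed_measure \<mu>"
  shows "countably_additive (sets borel) (upper_variation \<mu>)"
proof (rule countably_additiveI)
  fix A :: "nat \<Rightarrow> (real^'n) set"
  assume A: "range A \<subseteq> sets borel" "disjoint_family A"
  show "(\<Sum>i. upper_variation \<mu> (A i)) = upper_variation \<mu> (\<Union>i. A i)"
  proof (rule antisym)
    have part: "(\<Sum>i<n. upper_variation \<mu> (A i)) \<le> upper_variation \<mu> (\<Union>i<n. A i)" for n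
    proof (induction n)
      case (Suc n)
      have "(\<Sum>i<Suc n. upper_variation \<mu> (A i)) \<le> upper_variation \<mu> (\<Union>i<n. A i) + upper_variation \<mu> (A n)"
        using Suc by (simp add: add_right_mono)
      also have "\<dots> \<le> upper_variation \<mu> ((\<Union>i<n. A i) \<union> A n)"
      proof (rule upper_variation_superadditive[OF \<mu>])
        have "A i \<inter> A n = {}" if "i < n" for i
          using A(2) that unfolding disjoint_family_on_def by (metis UNIV_I less_irrefl)
        then show "(\<Union>i<n. A i) \<inter> A n = {}" by auto
      qed
      also have "(\<Union>i<n. A i) \<union> A n = (\<Union>i<Suc n. A i)"
        by (auto simp: less_Suc_eq)
      finally show ?case .
    qed (simp add: upper_variation_empty[OF \<mu>])
    have "(\<Sum>i<n. upper_variation \<mu> (A i)) \<le> upper_variation \<mu> (\<Union>i. A i)" for n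
      by (rule order_trans[OF part upper_variation_mono]) auto
    then show "(\<Sum>i. upper_variation \<mu> (A i)) \<le> upper_variation \<mu> (\<Union>i. A i)"
      by (intro suminf_le_const) auto
  next
    show "upper_variation \<mu> (\<Union>i. A i) \<le> (\<Sum>i. upper_variation \<mu> (A i))"
      unfolding upper_variation_def[of \<mu> "\<Union>i. A i"]
    proof (rule SUP_least, clarify)
      fix B assume B: "B \<in> sets borel" "B \<subseteq> (\<Union>i. A i)"
      have "(\<lambda>i. \<mu> (B \<inter> A i)) sums \<mu> (\<Union>i. B \<inter> A i)"
        using A B by (intro signed_measure_sums[OF \<mu>]) (auto simp: disjoint_family_on_def)
      moreover have "(\<Union>i. B \<inter> A i) = B" using B by auto
      ultimately have "(\<lambda>n. ennreal (\<Sum>i<n. \<mu> (B \<inter> A i))) \<longlonglongrightarrow> ennreal (\<mu> B)"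
        by (intro tendsto_ennrealI) (simp add: sums_def)
      moreover have "ennreal (\<Sum>i<n. \<mu> (B \<inter> A i)) \<le> (\<Sum>i. upper_variation \<mu> (A i))" for n
      proof -
        have "ennreal (\<Sum>i<n. \<mu> (B \<inter> A i)) \<le> (\<Sum>i<n. ennreal (\<mu> (B \<inter> A i)))"
          by (rule ennreal_sum_le)
        also have "\<dots> \<le> (\<Sum>i<n. upper_variation \<mu> (A i))"
          using A B by (intro sum_mono upper_variation_ge) auto
        also have "\<dots> \<le> (\<Sum>i. upper_variation \<mu> (A i))"
          by (intro sum_le_suminf) auto
        finally show ?thesis .
      qed
      ultimately show "ennreal (\<mu> B) \<le> (\<Sum>i. upper_variation \<mu> (A i))"
        by (intro LIMSEQ_le_const2) auto
    qed
  qed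
qed

lemma sets_pos_part [simp, measurable_cong]: "sets (pos_part \<mu>) = sets borel"
  unfolding pos_part_def by (simp add: sets.sigma_sets_eq[of borel, simplified])

lemma space_pos_part [simp]: "space (pos_part \<mu>) = UNIV"
  using sets_eq_imp_space_eq[OF sets_pos_part] by simp

lemma emeasure_pos_part:
  fixes \<mu> :: "'n::finite set_fun"
  assumes "signed_measure \<mu>" "A \<in> sets borel"
  shows "emeasure (pos_part \<mu>) A = upper_variation \<mu> A"
  unfolding pos_part_def
proof (subst emeasure_measure_of_sigma)
  show "sigma_algebra UNIV (sets (borel :: (real^'n) measure))"
    using sets.sigma_algebra_axioms[of borel] by simp
  show "positive (sets borel) (\<lambda>A. SUP B\<in>{B \<in> sets borel. B \<subseteq> A}. ennreal (\<mu> B))"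
    using upper_variation_empty[OF assms(1)] by (simp add: positive_def upper_variation_def)
  show "countably_additive (sets borel) (\<lambda>A. SUP B\<in>{B \<in> sets borel. B \<subseteq> A}. ennreal (\<mu> B))"
    using upper_variation_countably_additive[OF assms(1)] unfolding upper_variation_def .
qed (use assms in \<open>auto simp: upper_variation_def\<close>)

lemma finite_measure_pos_part:
  assumes "signed_measure \<mu>"
  shows "finite_measure (pos_part \<mu>)"
  using upper_variation_finite[OF assms] emeasure_pos_part[OF assms]
  by (intro finite_measureI) (auto simp: less_top)

lemma sets_neg_part [simp, measurable_cong]: "sets (neg_part \<mu>) = sets borel"
  by (simp add: neg_part_def)

lemma space_neg_part [simp]: "space (neg_part \<mu>) = UNIV"
  by (simp add: neg_part_def)

lemma finite_measure_neg_part: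
  assumes "signed_measure \<mu>"
  shows "finite_measure (neg_part \<mu>)"
  unfolding neg_part_def by (intro finite_measure_pos_part signed_measure_uminus assms)

lemma pos_part_eq_add_neg_part:
  assumes \<mu>: "signed_measure \<mu>" and A: "A \<in> sets borel"
  shows "measure (pos_part \<mu>) A = \<mu> A + measure (neg_part \<mu>) A"
proof -
  have le: "measure (pos_part \<mu>) A \<le> \<mu> A + measure (neg_part \<mu>) A" if \<mu>: "signed_measure \<mu>" for \<mu>
  proof -
    interpret p: finite_measure "pos_part \<mu>" by (rule finite_measure_pos_part[OF \<mu>])
    interpret n: finite_measure "neg_part \<mu>" by (rule finite_measure_neg_part[OF \<mu>])
    have le: "\<mu> B \<le> \<mu> A + measure (neg_part \<mu>) A" if B: "B \<in> sets borel" "B \<subseteq> A" for B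
    proof -
      have "ennreal (- \<mu> (A - B)) \<le> emeasure (neg_part \<mu>) A"
        unfolding neg_part_def using A B
        by (subst emeasure_pos_part[OF signed_measure_uminus[OF \<mu>]]) (auto intro!: upper_variation_ge[where \<mu> = "\<lambda>A. - \<mu> A"])
      then have "- \<mu> (A - B) \<le> measure (neg_part \<mu>) A"
        by (simp add: n.emeasure_eq_measure)
      then show ?thesis
        using signed_measure_Diff[OF \<mu> A B] by simp
    qed
    have nn: "0 \<le> \<mu> A + measure (neg_part \<mu>) A"
      using le[of "{}"] signed_measure_empty[OF \<mu>] by simp
    have "emeasure (pos_part \<mu>) A \<le> ennreal (\<mu> A + measure (neg_part \<mu>) A)"
      unfolding emeasure_pos_part[OF \<mu> A] upper_variation_def using le by (intro SUP_least ennreal_leI) auto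
    then show ?thesis
      using nn by (simp add: p.emeasure_eq_measure)
  qed
  have "measure (neg_part \<mu>) A \<le> - \<mu> A + measure (pos_part \<mu>) A"
    using le[OF signed_measure_uminus[OF \<mu>]] by (simp add: neg_part_def)
  with le[OF \<mu>] show ?thesis by simp
qed

lemma integrable_pos_part:
  fixes f :: "real^'n::finite \<Rightarrow> 'b::{banach, second_countable_topology}"
  assumes "signed_measure \<mu>" "f \<in> borel_measurable borel" "\<And>x. norm (f x) \<le> b"
  shows "integrable (pos_part \<mu>) f" "integrable (neg_part \<mu>) f"
proof -
  interpret p: finite_measure "pos_part \<mu>" by (rule finite_measure_pos_part[OF assms(1)])
  interpret n: finite_measure "neg_part \<mu>" by (rule finite_measure_neg_part[OF assms(1)])
  show "integrable (pos_part \<mu>) f" "integrable (neg_part \<mu>) f"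
    using assms(2,3) by (auto intro!: p.integrable_const_bound[where B = b] n.integrable_const_bound[where B = b])
qed

lemma signed_integral_indicator:
  assumes "signed_measure \<mu>" "A \<in> sets borel"
  shows "signed_integral \<mu> (indicator A) = \<mu> A"
  using pos_part_eq_add_neg_part[OF assms] assms(2) by (simp add: signed_integral_def)

definition mass :: "'n::finite set_fun \<Rightarrow> real" where
  "mass \<mu> = measure (pos_part \<mu>) UNIV + measure (neg_part \<mu>) UNIV"

lemma mass_nonneg: "0 \<le> mass \<mu>" by (simp add: mass_def)

lemma signed_integral_bound:
  fixes f :: "real^'n::finite \<Rightarrow> real"
  assumes \<mu>: "signed_measure \<mu>" and f: "f \<in> borel_measurable borel" "\<And>x. \<bar>f x\<bar> \<le> b"
  shows "\<bar>signed_integral \<mu> f\<bar> \<le> mass \<mu> * b"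
proof -
  interpret p: finite_measure "pos_part \<mu>" by (rule finite_measure_pos_part[OF \<mu>])
  interpret n: finite_measure "neg_part \<mu>" by (rule finite_measure_neg_part[OF \<mu>])
  have i: "integrable (pos_part \<mu>) f" "integrable (neg_part \<mu>) f"
    using integrable_pos_part[OF \<mu>, of f b] f by auto
  have "\<bar>\<integral>x. f x \<partial>pos_part \<mu>\<bar> \<le> (\<integral>x. b \<partial>pos_part \<mu>)" "\<bar>\<integral>x. f x \<partial>neg_part \<mu>\<bar> \<le> (\<integral>x. b \<partial>neg_part \<mu>)"
    using i f(2) by (auto simp del: lebesgue_integral_const intro!: order_trans[OF integral_abs_bound] integral_mono)
  then show ?thesis
    by (simp add: signed_integral_def mass_def algebra_simps)
qed

lemma signed_integral_diff:
  fixes f g :: "real^'n::finite \<Rightarrow> real"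
  assumes \<mu>: "signed_measure \<mu>" and f: "f \<in> borel_measurable borel" "\<And>x. \<bar>f x\<bar> \<le> b"
    and g: "g \<in> borel_measurable borel" "\<And>x. \<bar>g x\<bar> \<le> c"
  shows "signed_integral \<mu> (\<lambda>x. f x - g x) = signed_integral \<mu> f - signed_integral \<mu> g"
  using integrable_pos_part[OF \<mu>, of f b] integrable_pos_part[OF \<mu>, of g c] f g
  by (simp add: signed_integral_def)

text \<open>The Jordan parts of a linear combination are not the combinations of the Jordan parts, so linearity in the
measure is not visible from the definition. The difference of the two sides is a bounded linear functional
of \<open>f\<close> that vanishes on indicators, and bounded Borel functions are uniform limits of finite combinations
of indicators.\<close>

lemma signed_integral_linear_combination:
  fixes a :: "'i \<Rightarrow> 'n::finite set_fun" and f :: "real^'n \<Rightarrow> real"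
  assumes I: "finite I" and a: "\<And>i. i \<in> I \<Longrightarrow> signed_measure (a i)"
    and f: "f \<in> borel_measurable borel" "\<And>x. \<bar>f x\<bar> \<le> b"
  shows "signed_integral (\<lambda>E. \<Sum>i\<in>I. l i * a i E) f = (\<Sum>i\<in>I. l i * signed_integral (a i) f)"
proof -
  let ?\<nu> = "\<lambda>E. \<Sum>i\<in>I. l i * a i E"
  have \<nu>: "signed_measure ?\<nu>"
  proof (rule signed_measure_sum)
    fix i assume "i \<in> I"
    then show "signed_measure (\<lambda>E. l i * a i E)"
      by (rule signed_measure_cmult[OF a])
  qed
  define T where "T g = signed_integral ?\<nu> g - (\<Sum>i\<in>I. l i * signed_integral (a i) g)" for g :: "real^'n \<Rightarrow> real"
  define K where "K = mass ?\<nu> + (\<Sum>i\<in>I. \<bar>l i\<bar> * mass (a i))"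
  have Tb: "\<bar>T g\<bar> \<le> K * c" if "g \<in> borel_measurable borel" "\<And>x. \<bar>g x\<bar> \<le> c" for g c
  proof -
    have "\<bar>T g\<bar> \<le> \<bar>signed_integral ?\<nu> g\<bar> + (\<Sum>i\<in>I. \<bar>l i * signed_integral (a i) g\<bar>)"
      unfolding T_def by (rule order_trans[OF abs_triangle_ineq4 add_left_mono[OF sum_abs]])
    also have "\<dots> \<le> mass ?\<nu> * c + (\<Sum>i\<in>I. \<bar>l i\<bar> * (mass (a i) * c))"
      using signed_integral_bound[OF \<nu> that] signed_integral_bound[OF a that]
      by (intro add_mono sum_mono) (auto simp: abs_mult intro!: mult_left_mono)
    also have "\<dots> = K * c"
      by (simp add: K_def algebra_simps sum_distrib_left)
    finally show ?thesis .
  qed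
  have Td: "T (\<lambda>x. g x - h x) = T g - T h"
    if "g \<in> borel_measurable borel" "\<And>x. \<bar>g x\<bar> \<le> c" "h \<in> borel_measurable borel" "\<And>x. \<bar>h x\<bar> \<le> d" for g h c d
    using signed_integral_diff[OF \<nu> that] signed_integral_diff[OF a that]
    by (simp add: T_def right_diff_distrib sum_subtractf)
  have Tc: "T (\<lambda>x. r * indicator A x) = 0" if "A \<in> sets borel" for r and A :: "(real^'n) set"
  proof -
    have "signed_integral \<mu> (\<lambda>x. r * indicator A x) = r * \<mu> A" if "signed_measure \<mu>" for \<mu> :: "'n set_fun"
      using signed_integral_indicator[OF that \<open>A \<in> sets borel\<close>]
      by (simp add: signed_integral_def right_diff_distrib[symmetric])
    then show ?thesis
      using a \<nu> by (simp add: T_def sum_distrib_left mult_ac)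
  qed
  have Ts: "T (\<lambda>x. f x - (\<Sum>j\<in>J. r j * indicator (A j) x)) = T f"
    if "finite J" "\<And>j. A j \<in> sets borel" for J :: "int set" and r and A :: "int \<Rightarrow> (real^'n) set"
    using \<open>finite J\<close>
  proof induction
    case (insert k J)
    have [measurable]: "\<And>j. A j \<in> sets borel" by fact
    note [measurable] = f(1)
    have bnd: "\<bar>r k * indicator (A k) x\<bar> \<le> \<bar>r k\<bar>" for x k by (auto simp: indicator_def)
    have "\<bar>f x - (\<Sum>j\<in>J. r j * indicator (A j) x)\<bar> \<le> b + (\<Sum>j\<in>J. \<bar>r j\<bar>)" for x
    proof -
      have "\<bar>\<Sum>j\<in>J. r j * indicator (A j) x\<bar> \<le> (\<Sum>j\<in>J. \<bar>r j\<bar>)"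
        by (rule order_trans[OF sum_abs sum_mono]) (rule bnd)
      then show ?thesis using f(2)[of x] by linarith
    qed
    then have "T (\<lambda>x. (f x - (\<Sum>j\<in>J. r j * indicator (A j) x)) - r k * indicator (A k) x)
        = T (\<lambda>x. f x - (\<Sum>j\<in>J. r j * indicator (A j) x)) - T (\<lambda>x. r k * indicator (A k) x)"
      using bnd by (intro Td) auto
    moreover have "(\<lambda>x. f x - (\<Sum>j\<in>insert k J. r j * indicator (A j) x))
        = (\<lambda>x. (f x - (\<Sum>j\<in>J. r j * indicator (A j) x)) - r k * indicator (A k) x)"
      by (simp only: sum.insert[OF insert.hyps(1,2)] diff_add_eq_diff_diff_swap)
    ultimately show ?case
      using insert.IH Tc[of "A k" "r k"] by (simp only: diff_zero) simp
  qed simp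
  have small: "\<bar>T f\<bar> \<le> K * e" if e: "0 < e" for e
  proof -
    (* g rounds f down to multiples of e; the bound on f leaves finitely many values *)
    define N where "N = \<lceil>b / e\<rceil> + 1"
    define A where "A k = {x. \<lfloor>f x / e\<rfloor> = k}" for k :: int
    have A: "A k \<in> sets borel" for k
      unfolding A_def using f(1) by measurable
    define g where "g x = (\<Sum>k\<in>{-N..N}. (e * real_of_int k) * indicator (A k) x)" for x
    have g: "g x = e * real_of_int \<lfloor>f x / e\<rfloor>" for x
    proof -
      have "\<bar>f x / e\<bar> \<le> b / e"
        using e f(2)[of x] by (simp add: divide_right_mono)
      then have "\<lfloor>f x / e\<rfloor> \<in> {-N..N}"
        unfolding N_def by (simp, linarith)
      moreover have "g x = (\<Sum>k\<in>{-N..N}. if k = \<lfloor>f x / e\<rfloor> then e * real_of_int k else 0)"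
        unfolding g_def by (intro sum.cong) (auto simp: A_def indicator_def)
      ultimately show ?thesis by simp
    qed
    have "\<bar>f x - g x\<bar> \<le> e" for x
    proof -
      have "f x - g x = e * (f x / e - real_of_int \<lfloor>f x / e\<rfloor>)"
        using e by (simp add: g right_diff_distrib)
      moreover have "\<bar>f x / e - real_of_int \<lfloor>f x / e\<rfloor>\<bar> \<le> 1" by linarith
      ultimately show ?thesis
        using e by (simp add: abs_mult)
    qed
    moreover have "(\<lambda>x. f x - g x) \<in> borel_measurable borel"
      unfolding g_def using f(1) A by measurable
    ultimately have "\<bar>T (\<lambda>x. f x - g x)\<bar> \<le> K * e"
      by (intro Tb) auto
    moreover have "T (\<lambda>x. f x - g x) = T f"
      unfolding g_def using A by (intro Ts) auto
    ultimately show ?thesis by (simp only:)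
  qed
  have K: "0 \<le> K"
    unfolding K_def by (intro add_nonneg_nonneg mass_nonneg sum_nonneg mult_nonneg_nonneg) auto
  have "\<bar>T f\<bar> \<le> 0"
  proof (rule field_le_epsilon)
    fix e :: real assume "0 < e"
    have "\<bar>T f\<bar> \<le> K * (e / (K + 1))"
      using K \<open>0 < e\<close> by (intro small) auto
    also have "\<dots> \<le> e"
      using K \<open>0 < e\<close> by (simp add: field_simps)
    finally show "\<bar>T f\<bar> \<le> 0 + e" by simp
  qed
  then show ?thesis by (simp add: T_def)
qed

lemma abs_le_total_variation:
  assumes "A \<in> sets borel" "E \<in> sets borel" "A \<subseteq> E"
  shows "ennreal \<bar>\<mu> A\<bar> \<le> total_variation \<mu> E"
proof -
  have "ennreal \<bar>\<mu> A\<bar> \<le> (\<Sum>B\<in>{A, E - A}. ennreal \<bar>\<mu> B\<bar>)"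
    by (rule member_le_sum) auto
  also have "\<dots> \<le> total_variation \<mu> E"
    unfolding total_variation_def using assms
    by (intro SUP_upper) (auto simp: disjoint_def)
  finally show ?thesis .
qed

lemma mass_le_total_variation:
  fixes \<mu> :: "'n::finite set_fun"
  assumes \<mu>: "signed_measure \<mu>" and tv: "total_variation \<mu> UNIV \<le> 1"
  shows "mass \<mu> \<le> 2"
proof -
  have le: "measure (pos_part \<nu>) UNIV \<le> 1" if \<nu>: "signed_measure \<nu>" "\<And>A. \<bar>\<nu> A\<bar> = \<bar>\<mu> A\<bar>" for \<nu>
  proof -
    interpret p: finite_measure "pos_part \<nu>" by (rule finite_measure_pos_part[OF \<nu>(1)])
    have "emeasure (pos_part \<nu>) UNIV \<le> 1"
      unfolding emeasure_pos_part[OF \<nu>(1), of UNIV, simplified] upper_variation_def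
    proof (rule SUP_least, clarify)
      fix B :: "(real^'n) set" assume "B \<in> sets borel"
      then have "ennreal \<bar>\<mu> B\<bar> \<le> total_variation \<mu> UNIV"
        by (intro abs_le_total_variation) auto
      then have "ennreal \<bar>\<mu> B\<bar> \<le> 1" using tv by (rule order_trans)
      moreover have "ennreal (\<nu> B) \<le> ennreal \<bar>\<mu> B\<bar>"
        using \<nu>(2)[of B] by (intro ennreal_leI) linarith
      ultimately show "ennreal (\<nu> B) \<le> 1" by simp
    qed
    then show ?thesis by (simp add: p.emeasure_eq_measure)
  qed
  show ?thesis
    using le[OF \<mu>] le[OF signed_measure_uminus[OF \<mu>]] by (simp add: mass_def neg_part_def)
qed

text \<open>The complement of the support is covered by open sets of variation zero, hence by countably many of them.\<close>

lemma null_outside_supp: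
  fixes \<mu> :: "'n::finite set_fun"
  assumes \<mu>: "signed_measure \<mu>" and supp: "supp \<mu> \<subseteq> Q" and Q: "closed Q"
    and B: "B \<in> sets borel" "B \<inter> Q = {}"
  shows "\<mu> B = 0"
proof -
  define \<U> where "\<U> = {U. open U \<and> total_variation \<mu> U = 0}"
  obtain \<V> where V: "\<V> \<subseteq> \<U>" "countable \<V>" "\<Union>\<V> = \<Union>\<U>"
    using Lindelof[of \<U>] unfolding \<U>_def by blast
  have cov: "B \<subseteq> \<Union>\<V>"
    using B supp V(3) unfolding supp_def \<U>_def by auto
  show ?thesis
  proof (cases "\<V> = {}")
    case True
    then show ?thesis using cov signed_measure_empty[OF \<mu>] by simp
  next
    case False
    define U where "U = from_nat_into \<V>"
    have U: "range U = \<V>" unfolding U_def using V False by (simp add: range_from_nat_into)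
    have Uo: "open (U i)" "total_variation \<mu> (U i) = 0" for i
      using U V(1) unfolding \<U>_def by auto
    define A where "A i = B \<inter> disjointed U i" for i
    have Ab: "A i \<in> sets borel" for i
    proof -
      have "range (disjointed U) \<subseteq> sets borel"
        using Uo by (intro sets.range_disjointed_sets) auto
      then show ?thesis unfolding A_def using B by auto
    qed
    have zero: "\<mu> (A i) = 0" for i
    proof -
      have "ennreal \<bar>\<mu> (A i)\<bar> \<le> total_variation \<mu> (U i)"
        using Uo Ab disjointed_subset[of U i] by (intro abs_le_total_variation) (auto simp: A_def)
      then show ?thesis using Uo(2)[of i] by simp
    qed
    have "(\<lambda>i. \<mu> (A i)) sums \<mu> (\<Union>i. A i)"
      using Ab disjoint_family_disjointed[of U]
      by (intro signed_measure_sums[OF \<mu>]) (auto simp: A_def disjoint_family_on_def)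
    moreover have "(\<Union>i. A i) = B"
      using cov U UN_disjointed_eq[of U] unfolding A_def by auto
    ultimately show ?thesis
      using zero sums_unique2[OF sums_zero] by fastforce
  qed
qed

lemma signed_integral_cong_supp:
  fixes f g :: "real^'n::finite \<Rightarrow> real"
  assumes \<mu>: "signed_measure \<mu>" and supp: "supp \<mu> \<subseteq> Q" and Q: "closed Q"
    and [measurable]: "f \<in> borel_measurable borel" "g \<in> borel_measurable borel"
    and eq: "\<And>x. x \<in> Q \<Longrightarrow> f x = g x"
  shows "signed_integral \<mu> f = signed_integral \<mu> g"
proof -
  have [measurable]: "Q \<in> sets borel" using Q by simp
  have null: "AE x in pos_part \<nu>. x \<in> Q" if \<nu>: "signed_measure \<nu>" "\<And>A. \<bar>\<nu> A\<bar> = \<bar>\<mu> A\<bar>" for \<nu>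
  proof -
    have "emeasure (pos_part \<nu>) (- Q) = 0"
    proof -
      have "\<nu> B = 0" if "B \<in> sets borel" "B \<subseteq> - Q" for B
      proof -
        have "\<mu> B = 0" using that by (intro null_outside_supp[OF \<mu> supp Q]) auto
        then show ?thesis using \<nu>(2)[of B] by simp
      qed
      then show ?thesis
        by (subst emeasure_pos_part[OF \<nu>(1)]) (auto simp: upper_variation_def SUP_constant intro!: antisym SUP_least)
    qed
    then show ?thesis
      by (intro AE_I[of _ _ "- Q"]) auto
  qed
  have "AE x in pos_part \<mu>. f x = g x"
    using null[OF \<mu>] eq by (auto elim!: eventually_mono)
  moreover have "AE x in neg_part \<mu>. f x = g x"
    unfolding neg_part_def using null[OF signed_measure_uminus[OF \<mu>]] eq by (auto elim!: eventually_mono)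
  ultimately show ?thesis
    unfolding signed_integral_def by (intro arg_cong2[where f = "(-)"] integral_cong_AE) auto
qed

section \<open>Test functions measured by iterated differences\<close>

text \<open>By the mean value theorem a shift by \<open>z\<close> costs \<open>d * norm z\<close>; the power accounts for the change of the
weight \<open>(1 + norm y) ^ p\<close> between the two ends of the shift.\<close>

definition diff_weight :: "nat \<Rightarrow> real^'n::finite \<Rightarrow> real" where
  "diff_weight p z = real CARD('n) * norm z * (1 + norm z) ^ p"

text \<open>A quantitative smoothness class with decay of order \<open>p\<close>: iterated differences up to order \<open>m\<close> are bounded
by the product of the \<open>diff_weight\<close>s of the shifts. Unlike conditions on derivatives, this passes to
averages of translates by integrating the bounds, without differentiating under an integral.\<close>

fun test_class :: "nat \<Rightarrow> nat \<Rightarrow> real \<Rightarrow> (real^'n::finite \<Rightarrow> real) \<Rightarrow> bool" where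
  "test_class p 0 B f \<longleftrightarrow>
     f \<in> borel_measurable borel \<and> (\<forall>y. \<bar>f y\<bar> * (1 + norm y) ^ p \<le> B)"
| "test_class p (Suc m) B f \<longleftrightarrow>
     test_class p 0 B f \<and> (\<forall>z. test_class p m (B * diff_weight p z) (\<lambda>y. f y - f (y - z)))"

lemma diff_weight_nonneg: "0 \<le> diff_weight p z"
  by (simp add: diff_weight_def)

declare test_class.simps [simp del]

lemma test_class_zeroI:
  "f \<in> borel_measurable borel \<Longrightarrow> (\<And>y. \<bar>f y\<bar> * (1 + norm y) ^ p \<le> B) \<Longrightarrow> test_class p 0 B f"
  by (simp add: test_class.simps)

lemma test_class_SucI:
  "test_class p 0 B f \<Longrightarrow> (\<And>z. test_class p m (B * diff_weight p z) (\<lambda>y. f y - f (y - z))) \<Longrightarrow>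
    test_class p (Suc m) B f"
  by (simp add: test_class.simps(2))

lemma test_class_SucD:
  "test_class p (Suc m) B f \<Longrightarrow> test_class p m (B * diff_weight p z) (\<lambda>y. f y - f (y - z))"
  by (simp add: test_class.simps(2))

lemma test_class_zero: "test_class p m B f \<Longrightarrow> test_class p 0 B f"
  by (cases m) (simp_all add: test_class.simps(2))

lemma test_class_measurable: "test_class p m B f \<Longrightarrow> f \<in> borel_measurable borel"
  by (drule test_class_zero) (simp add: test_class.simps(1))

lemma test_class_decay: "test_class p m B f \<Longrightarrow> \<bar>f y\<bar> * (1 + norm y) ^ p \<le> B"
  by (drule test_class_zero) (simp add: test_class.simps(1))

lemma test_class_bounded: 
  assumes "test_class p m B f"
  shows "\<bar>f y\<bar> \<le> B"
proof -
  have "\<bar>f y\<bar> * 1 \<le> \<bar>f y\<bar> * (1 + norm y) ^ p"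
    by (intro mult_left_mono one_le_power) auto
  then show ?thesis using test_class_decay[OF assms, of y] by simp
qed

lemma test_class_nonneg: "test_class p m B f \<Longrightarrow> 0 \<le> B"
  using test_class_bounded abs_ge_zero order_trans by blast

lemma test_class_mono: "test_class p m B f \<Longrightarrow> B \<le> C \<Longrightarrow> test_class p m C f"
proof (induction m arbitrary: B C f)
  case 0
  show ?case
    by (intro test_class_zeroI test_class_measurable[OF 0(1)] order_trans[OF test_class_decay[OF 0(1)] 0(2)])
next
  case (Suc m)
  show ?case
  proof (rule test_class_SucI)
    show "test_class p 0 C f"
      by (intro test_class_zeroI test_class_measurable[OF Suc.prems(1)]
          order_trans[OF test_class_decay[OF Suc.prems(1)] Suc.prems(2)])
    show "test_class p m (C * diff_weight p z) (\<lambda>y. f y - f (y - z))" for z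
      using Suc.prems(2) by (intro Suc.IH[OF test_class_SucD[OF Suc.prems(1)]] mult_right_mono diff_weight_nonneg)
  qed
qed

lemma test_class_Suc_down: "test_class p (Suc m) B f \<Longrightarrow> test_class p m B f"
proof (induction m arbitrary: B f)
  case 0
  then show ?case by (rule test_class_zero)
next
  case (Suc m)
  show ?case
  proof (rule test_class_SucI)
    show "test_class p 0 B f"
      by (rule test_class_zero[OF Suc.prems])
    show "test_class p m (B * diff_weight p z) (\<lambda>y. f y - f (y - z))" for z
      by (rule Suc.IH[OF test_class_SucD[OF Suc.prems]])
  qed
qed

lemma test_class_down: "test_class p m B f \<Longrightarrow> k \<le> m \<Longrightarrow> test_class p k B f"
proof (induction m)
  case (Suc m)
  then show ?case using test_class_Suc_down by (cases "k = Suc m") auto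
qed simp

lemma test_class_diff:
  "test_class p m B f \<Longrightarrow> test_class p m C g \<Longrightarrow> test_class p m (B + C) (\<lambda>y. f y - g y)"
proof (induction m arbitrary: B C f g)
  case 0
  have [measurable]: "f \<in> borel_measurable borel" "g \<in> borel_measurable borel"
    using 0 by (auto dest: test_class_measurable)
  have "\<bar>f y - g y\<bar> * (1 + norm y) ^ p \<le> B + C" for y
  proof -
    have "\<bar>f y - g y\<bar> * (1 + norm y) ^ p \<le> (\<bar>f y\<bar> + \<bar>g y\<bar>) * (1 + norm y) ^ p"
      by (intro mult_right_mono abs_triangle_ineq4) auto
    also have "\<dots> \<le> B + C"
      unfolding distrib_right by (intro add_mono test_class_decay[OF 0(1)] test_class_decay[OF 0(2)])
    finally show ?thesis .
  qed
  then show ?case by (intro test_class_zeroI) auto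
next
  case (Suc m)
  show ?case
  proof (rule test_class_SucI)
    show "test_class p 0 (B + C) (\<lambda>y. f y - g y)"
      using Suc.IH[OF Suc.prems[THEN test_class_Suc_down]] by (rule test_class_zero)
    fix z
    have "test_class p m (B * diff_weight p z + C * diff_weight p z) (\<lambda>y. (f y - f (y - z)) - (g y - g (y - z)))"
      by (rule Suc.IH[OF Suc.prems(1)[THEN test_class_SucD] Suc.prems(2)[THEN test_class_SucD]])
    then show "test_class p m ((B + C) * diff_weight p z) (\<lambda>y. f y - g y - (f (y - z) - g (y - z)))"
      by (simp add: algebra_simps)
  qed
qed

section \<open>Gaussian averages\<close>

text \<open>The heat kernel at time \<open>1\<close> without its normalising factor. The averages below divide by its integral
\<open>gauss_mass\<close> instead.\<close>

definition gauss :: "real^'n::finite \<Rightarrow> real" where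
  "gauss w = exp (- (norm w)\<^sup>2 / 4)"

lemma gauss_pos: "0 < gauss w" by (simp add: gauss_def)

lemma gauss_measurable [measurable]: "gauss \<in> borel_measurable borel"
  unfolding gauss_def by measurable

lemma norm_add_weight: "1 + norm y \<le> (1 + norm (y - z)) * (1 + norm z)" for y z :: "'a::real_normed_vector"
proof -
  have "norm y \<le> norm (y - z) + norm z"
    using norm_triangle_ineq[of "y - z" z] by simp
  moreover have "0 \<le> norm (y - z) * norm z" by simp
  moreover have "(1 + norm (y - z)) * (1 + norm z) = 1 + norm (y - z) + norm z + norm (y - z) * norm z"
    by (simp add: algebra_simps)
  ultimately show ?thesis by linarith
qed

lemma weight_shift: "(1 + norm y) ^ p \<le> (1 + norm (y - z)) ^ p * (1 + norm z) ^ p"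
  for y z :: "'a::real_normed_vector"
  unfolding power_mult_distrib[symmetric] by (intro power_mono norm_add_weight) auto

text \<open>Compare with the sum over \<open>k\<close> of \<open>1 / (k + 1) ^ p\<close> times the indicator of the ball of radius \<open>k + 1\<close>.\<close>

lemma integrable_weight:
  assumes "CARD('n::finite) + 2 \<le> p"
  shows "integrable lborel (\<lambda>y::real^'n. 1 / (1 + norm y) ^ p)"
proof (rule integrableI_bounded)
  let ?d = "CARD('n)"
  define v where "v = unit_ball_vol (real ?d)"
  have v: "0 \<le> v" by (simp add: v_def)
  have term_le: "g k \<le> suminf g" for g :: "nat \<Rightarrow> ennreal" and k
    using sum_le_suminf[of g "{k}"] by simp
  have "(\<integral>\<^sup>+y. ennreal (norm (1 / (1 + norm (y :: real^'n)) ^ p)) \<partial>lborel)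
      \<le> (\<integral>\<^sup>+y. (\<Sum>k. ennreal (1 / real (Suc k) ^ p) * indicator (ball 0 (real (Suc k))) (y :: real^'n)) \<partial>lborel)"
  proof (rule nn_integral_mono)
    fix y :: "real^'n"
    define k where "k = nat \<lfloor>norm y\<rfloor>"
    have k: "real k \<le> norm y" "norm y < real (Suc k)"
      unfolding k_def by (simp_all add: of_nat_nat, linarith)
    have "ennreal (norm (1 / (1 + norm (y :: real^'n)) ^ p)) \<le> ennreal (1 / real (Suc k) ^ p) * indicator (ball 0 (real (Suc k))) (y :: real^'n)"
      using k by (auto intro!: ennreal_leI divide_left_mono power_mono simp: power_le_one_iff)
    also have "\<dots> \<le> (\<Sum>k. ennreal (1 / real (Suc k) ^ p) * indicator (ball 0 (real (Suc k))) (y :: real^'n))"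
      by (rule term_le[where g = "\<lambda>k. ennreal (1 / real (Suc k) ^ p) * indicator (ball 0 (real (Suc k))) y"])
    finally show "ennreal (norm (1 / (1 + norm (y :: real^'n)) ^ p)) \<le> \<dots>" .
  qed
  also have "\<dots> = (\<Sum>k. \<integral>\<^sup>+y. ennreal (1 / real (Suc k) ^ p) * indicator (ball 0 (real (Suc k))) (y :: real^'n) \<partial>lborel)"
    by (intro nn_integral_suminf borel_measurable_times_ennreal borel_measurable_const borel_measurable_indicator) auto
  also have "\<dots> = (\<Sum>k. ennreal (1 / real (Suc k) ^ p) * ennreal (v * real (Suc k) ^ ?d))"
    by (simp add: nn_integral_cmult_indicator emeasure_ball v_def del: of_nat_Suc)
  also have "\<dots> \<le> (\<Sum>k. ennreal (v * (1 / real (Suc k) ^ 2)))"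
  proof (rule suminf_le)
    fix k
    define a where "a = real (Suc k)"
    have a: "1 \<le> a" by (simp add: a_def)
    then have "a ^ ?d * a ^ 2 \<le> a ^ p"
      unfolding power_add[symmetric] using assms by (intro power_increasing) auto
    then have "a ^ ?d / a ^ p \<le> 1 / a ^ 2"
      using a by (simp add: pos_divide_le_eq pos_le_divide_eq)
    then have "v * (a ^ ?d / a ^ p) \<le> v * (1 / a ^ 2)"
      using v by (rule mult_left_mono)
    then have "(1 / real (Suc k) ^ p) * (v * real (Suc k) ^ ?d) \<le> v * (1 / real (Suc k) ^ 2)"
      by (simp add: a_def mult.commute del: of_nat_Suc)
    then show "ennreal (1 / real (Suc k) ^ p) * ennreal (v * real (Suc k) ^ ?d) \<le> ennreal (v * (1 / real (Suc k) ^ 2))"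
      using v by (simp add: ennreal_mult[symmetric] ennreal_leI del: of_nat_Suc)
  qed auto
  also have "\<dots> < \<infinity>"
  proof -
    have "summable (\<lambda>k. v * (1 / real (Suc k) ^ 2))"
      using inverse_power_summable[of 2, where 'a = real]
      by (intro summable_mult) (subst summable_Suc_iff, simp add: inverse_eq_divide)
    then show ?thesis
      using v ennreal_suminf_neq_top by (simp add: less_top del: of_nat_Suc)
  qed
  finally show "(\<integral>\<^sup>+y. ennreal (norm (1 / (1 + norm (y :: real^'n)) ^ p)) \<partial>lborel) < \<infinity>" .
qed simp

lemma integrable_gauss_weight: "integrable lborel (\<lambda>w::real^'n::finite. gauss w * (1 + norm w) ^ k)"
proof -
  let ?q = "CARD('n) + 2"
  (* completing the square absorbs all powers of 1 + norm w into the Gaussian *)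
  define N where "N = real (k + ?q)"
  have le: "gauss w * (1 + norm w) ^ k \<le> exp (N\<^sup>2) * (1 / (1 + norm w) ^ ?q)" for w :: "real^'n"
  proof -
    have "(1 + norm w) ^ (k + ?q) \<le> exp (norm w) ^ (k + ?q)"
      by (intro power_mono exp_ge_add_one_self) auto
    also have "\<dots> = exp (N * norm w)"
      by (simp only: N_def exp_of_nat_mult)
    also have "\<dots> \<le> exp (N\<^sup>2 + (norm w)\<^sup>2 / 4)"
    proof -
      have "0 \<le> (N - norm w / 2)\<^sup>2" by simp
      then have "N * norm w \<le> N\<^sup>2 + (norm w)\<^sup>2 / 4"
        by (simp add: power2_eq_square algebra_simps)
      then show ?thesis by simp
    qed
    finally have "(1 + norm w) ^ k * (1 + norm w) ^ ?q \<le> exp (N\<^sup>2) * exp ((norm w)\<^sup>2 / 4)"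
      by (simp only: power_add exp_add)
    then have "gauss w * ((1 + norm w) ^ k * (1 + norm w) ^ ?q) \<le> gauss w * (exp (N\<^sup>2) * exp ((norm w)\<^sup>2 / 4))"
      by (rule mult_left_mono) (rule less_imp_le[OF gauss_pos])
    also have "\<dots> = exp (N\<^sup>2)"
      by (simp add: gauss_def exp_add[symmetric])
    finally have "gauss w * ((1 + norm w) ^ k * (1 + norm w) ^ ?q) \<le> exp (N\<^sup>2)" .
    moreover have "0 < (1 + norm w) ^ ?q"
      by (intro zero_less_power) (simp add: add_pos_nonneg)
    ultimately show ?thesis
      by (simp add: pos_le_divide_eq mult.assoc)
  qed
  show ?thesis
  proof (rule Bochner_Integration.integrable_bound)
    show "integrable lborel (\<lambda>w::real^'n. exp (N\<^sup>2) * (1 / (1 + norm w) ^ ?q))"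
      by (intro integrable_mult_right integrable_weight) auto
    show "AE w::real^'n in lborel. norm (gauss w * (1 + norm w) ^ k) \<le> norm (exp (N\<^sup>2) * (1 / (1 + norm w) ^ ?q))"
    proof (intro AE_I2)
      fix w :: "real^'n"
      have "0 \<le> gauss w * (1 + norm w) ^ k" using gauss_pos[of w] by simp
      then show "norm (gauss w * (1 + norm w) ^ k) \<le> norm (exp (N\<^sup>2) * (1 / (1 + norm w) ^ ?q))"
        using le[of w] by simp
    qed
  qed simp
qed

definition gauss_mass :: "'n::finite itself \<Rightarrow> real" where
  "gauss_mass _ = (\<integral>w. gauss (w :: real^'n) \<partial>lborel)"

lemma integrable_gauss: "integrable lborel (gauss :: real^'n::finite \<Rightarrow> real)"
  using integrable_gauss_weight[of 0, where 'n = 'n] by simp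

lemma gauss_mass_pos: "0 < gauss_mass TYPE('n::finite)"
proof -
  have "0 \<le> gauss_mass TYPE('n)"
    unfolding gauss_mass_def by (intro integral_nonneg_AE AE_I2 less_imp_le gauss_pos)
  moreover have "gauss_mass TYPE('n) \<noteq> 0"
  proof
    assume "gauss_mass TYPE('n) = 0"
    then have "AE w in lborel. gauss (w :: real^'n) = 0"
      unfolding gauss_mass_def
      by (subst (asm) integral_nonneg_eq_0_iff_AE[OF integrable_gauss]) (auto intro: less_imp_le gauss_pos)
    then have "AE w :: real^'n in lborel. False"
      by (rule eventually_mono) (use gauss_pos in \<open>auto simp: less_le\<close>)
    then show False
      by (simp add: AE_iff_null null_sets_def)
  qed
  ultimately show ?thesis by simp
qed

text \<open>Since \<open>gauss\<close> is the heat kernel at time \<open>1\<close>, this is the heat semigroup at time \<open>s\<^sup>2\<close>.\<close>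

definition gauss_avg :: "real \<Rightarrow> (real^'n::finite \<Rightarrow> real) \<Rightarrow> real^'n \<Rightarrow> real" where
  "gauss_avg s f y = (\<integral>w. gauss w * f (y - s *\<^sub>R w) \<partial>lborel) / gauss_mass TYPE('n)"

lemma gauss_avg_measurable [measurable]:
  assumes [measurable]: "f \<in> borel_measurable borel"
  shows "gauss_avg s f \<in> borel_measurable borel"
  unfolding gauss_avg_def by measurable

lemma integrable_gauss_mult:
  assumes [measurable]: "f \<in> borel_measurable borel" and b: "\<And>y. \<bar>f y\<bar> \<le> b"
  shows "integrable lborel (\<lambda>w. gauss w * f (y - s *\<^sub>R w))"
proof (rule Bochner_Integration.integrable_bound)
  show "integrable lborel (\<lambda>w. b * gauss w)"
    by (intro integrable_mult_right integrable_gauss)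
  show "AE w in lborel. norm (gauss w * f (y - s *\<^sub>R w)) \<le> norm (b * gauss w)"
  proof (intro AE_I2)
    fix w
    have "\<bar>gauss w\<bar> * \<bar>f (y - s *\<^sub>R w)\<bar> \<le> \<bar>gauss w\<bar> * \<bar>b\<bar>"
      using b[of "y - s *\<^sub>R w"] by (intro mult_left_mono) auto
    then show "norm (gauss w * f (y - s *\<^sub>R w)) \<le> norm (b * gauss w)"
      by (simp add: abs_mult mult.commute)
  qed
qed simp

lemma gauss_avg_diff:
  assumes "f \<in> borel_measurable borel" "\<And>y. \<bar>f y\<bar> \<le> b"
  shows "gauss_avg s f y - gauss_avg s f (y - z) = gauss_avg s (\<lambda>y. f y - f (y - z)) y"
proof -
  have eq: "y - z - s *\<^sub>R w = y - s *\<^sub>R w - z" for w by simp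
  have "(\<integral>w. gauss w * f (y - s *\<^sub>R w) - gauss w * f (y - z - s *\<^sub>R w) \<partial>lborel)
      = (\<integral>w. gauss w * f (y - s *\<^sub>R w) \<partial>lborel) - (\<integral>w. gauss w * f (y - z - s *\<^sub>R w) \<partial>lborel)"
    by (rule Bochner_Integration.integral_diff[OF integrable_gauss_mult[OF assms] integrable_gauss_mult[OF assms]])
  then show ?thesis
    unfolding gauss_avg_def diff_divide_distrib[symmetric] right_diff_distrib eq by simp
qed

lemma gauss_avg_residual:
  fixes f :: "real^'n::finite \<Rightarrow> real"
  assumes "f \<in> borel_measurable borel" "\<And>y. \<bar>f y\<bar> \<le> b"
  shows "f y - gauss_avg s f y = (\<integral>w. gauss w * (f y - f (y - s *\<^sub>R w)) \<partial>lborel) / gauss_mass TYPE('n)"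
proof -
  have "(\<integral>w. gauss w * f y - gauss w * f (y - s *\<^sub>R w) \<partial>lborel)
      = (\<integral>w. gauss (w :: real^'n) * f y \<partial>lborel) - (\<integral>w. gauss w * f (y - s *\<^sub>R w) \<partial>lborel)"
    by (rule Bochner_Integration.integral_diff[OF integrable_mult_left[OF integrable_gauss] integrable_gauss_mult[OF assms]])
  also have "(\<integral>w. gauss (w :: real^'n) * f y \<partial>lborel) = gauss_mass TYPE('n) * f y"
    by (simp add: gauss_mass_def)
  finally show ?thesis
    using gauss_mass_pos[where 'n = 'n] by (simp add: gauss_avg_def right_diff_distrib diff_divide_distrib)
qed

definition avg_const :: "'n::finite itself \<Rightarrow> nat \<Rightarrow> real" where
  "avg_const _ p = (\<integral>w. gauss w * (1 + norm (w :: real^'n)) ^ p \<partial>lborel) / gauss_mass TYPE('n)"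

definition res_const :: "'n::finite itself \<Rightarrow> nat \<Rightarrow> real" where
  "res_const _ p = (\<integral>w. gauss w * diff_weight p (w :: real^'n) \<partial>lborel) / gauss_mass TYPE('n)"

lemma avg_const_nonneg: "0 \<le> avg_const TYPE('n::finite) p"
  unfolding avg_const_def using gauss_mass_pos[where 'n = 'n] gauss_pos
  by (intro divide_nonneg_pos integral_nonneg_AE AE_I2 mult_nonneg_nonneg) (auto intro: less_imp_le)

lemma integrable_gauss_diff_weight: "integrable lborel (\<lambda>w::real^'n::finite. gauss w * diff_weight p w)"
proof (rule Bochner_Integration.integrable_bound)
  show "integrable lborel (\<lambda>w::real^'n. real CARD('n) * (gauss w * (1 + norm w) ^ Suc p))"
    by (intro integrable_mult_right integrable_gauss_weight)
  show "AE w::real^'n in lborel. norm (gauss w * diff_weight p w) \<le> norm (real CARD('n) * (gauss w * (1 + norm w) ^ Suc p))"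
  proof (intro AE_I2)
    fix w :: "real^'n"
    have "norm w * (1 + norm w) ^ p \<le> (1 + norm w) ^ Suc p"
      unfolding power_Suc by (intro mult_right_mono) auto
    then have "diff_weight p w \<le> real CARD('n) * (1 + norm w) ^ Suc p"
      unfolding diff_weight_def mult.assoc by (rule mult_left_mono) simp
    then have "gauss w * diff_weight p w \<le> gauss w * (real CARD('n) * (1 + norm w) ^ Suc p)"
      by (intro mult_left_mono less_imp_le[OF gauss_pos])
    moreover have "0 \<le> gauss w * diff_weight p w"
      by (intro mult_nonneg_nonneg diff_weight_nonneg less_imp_le[OF gauss_pos])
    ultimately show "norm (gauss w * diff_weight p w) \<le> norm (real CARD('n) * (gauss w * (1 + norm w) ^ Suc p))"
      by (simp only: real_norm_def abs_of_nonneg mult.left_commute)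
  qed
qed (simp add: diff_weight_def)

lemma gauss_avg_test_class_zero:
  fixes f :: "real^'n::finite \<Rightarrow> real"
  assumes f: "test_class p 0 B f" and s: "0 < s" "s \<le> 1"
  shows "test_class p 0 (avg_const TYPE('n) p * B) (gauss_avg s f)"
proof -
  note [measurable] = test_class_measurable[OF f]
  have "\<bar>gauss_avg s f y\<bar> * (1 + norm y) ^ p \<le> avg_const TYPE('n) p * B" for y
  proof -
    have "\<bar>\<integral>w. gauss w * f (y - s *\<^sub>R w) \<partial>lborel\<bar> * (1 + norm y) ^ p
        \<le> (\<integral>w. \<bar>gauss w * f (y - s *\<^sub>R w)\<bar> \<partial>lborel) * (1 + norm y) ^ p"
      by (intro mult_right_mono integral_abs_bound) auto
    also have "\<dots> = (\<integral>w. \<bar>gauss w * f (y - s *\<^sub>R w)\<bar> * (1 + norm y) ^ p \<partial>lborel)"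
      by simp
    also have "\<dots> \<le> (\<integral>w. (gauss w * (1 + norm (w :: real^'n)) ^ p) * B \<partial>lborel)"
    proof (rule integral_mono)
      show "integrable lborel (\<lambda>w. \<bar>gauss w * f (y - s *\<^sub>R w)\<bar> * (1 + norm y) ^ p)"
        using integrable_gauss_mult[of f B] test_class_bounded[OF f]
        by (intro integrable_mult_left integrable_abs) auto
      show "integrable lborel (\<lambda>w::real^'n. (gauss w * (1 + norm w) ^ p) * B)"
        by (intro integrable_mult_left integrable_gauss_weight)
      fix w
      let ?x = "y - s *\<^sub>R w"
      have "norm (s *\<^sub>R w) \<le> norm w"
        using s by (simp add: mult_left_le_one_le)
      then have "(1 + norm (s *\<^sub>R w)) ^ p \<le> (1 + norm w) ^ p"
        by (intro power_mono) auto
      then have "(1 + norm y) ^ p \<le> (1 + norm ?x) ^ p * (1 + norm w) ^ p"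
        using weight_shift[of y p "s *\<^sub>R w"] by (meson mult_left_mono norm_ge_zero add_nonneg_nonneg order_trans zero_le_one zero_le_power)
      then have "\<bar>f ?x\<bar> * (1 + norm y) ^ p \<le> \<bar>f ?x\<bar> * ((1 + norm ?x) ^ p * (1 + norm w) ^ p)"
        by (intro mult_left_mono) auto
      also have "\<dots> = (\<bar>f ?x\<bar> * (1 + norm ?x) ^ p) * (1 + norm w) ^ p"
        by (simp only: mult.assoc)
      also have "\<dots> \<le> B * (1 + norm w) ^ p"
        by (intro mult_right_mono test_class_decay[OF f]) auto
      finally have "gauss w * (\<bar>f ?x\<bar> * (1 + norm y) ^ p) \<le> gauss w * (B * (1 + norm w) ^ p)"
        by (intro mult_left_mono less_imp_le[OF gauss_pos])
      then show "\<bar>gauss w * f ?x\<bar> * (1 + norm y) ^ p \<le> (gauss w * (1 + norm w) ^ p) * B"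
        using gauss_pos[of w] by (simp add: abs_mult mult_ac)
    qed
    also have "\<dots> = (\<integral>w. gauss w * (1 + norm (w :: real^'n)) ^ p \<partial>lborel) * B"
      by simp
    finally show ?thesis
      using gauss_mass_pos[where 'n = 'n]
      by (simp add: gauss_avg_def avg_const_def divide_right_mono)
  qed
  then show ?thesis by (intro test_class_zeroI) auto
qed

lemma gauss_avg_test_class:
  fixes f :: "real^'n::finite \<Rightarrow> real"
  assumes f: "test_class p m B f" and s: "0 < s" "s \<le> 1"
  shows "test_class p m (avg_const TYPE('n) p * B) (gauss_avg s f)"
  using f
proof (induction m arbitrary: B f)
  case (Suc m)
  show ?case
  proof (rule test_class_SucI)
    show "test_class p 0 (avg_const TYPE('n) p * B) (gauss_avg s f)"
      by (rule gauss_avg_test_class_zero[OF test_class_zero[OF Suc.prems] s])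
    fix z
    have "(\<lambda>y. gauss_avg s f y - gauss_avg s f (y - z)) = gauss_avg s (\<lambda>y. f y - f (y - z))"
      using gauss_avg_diff[OF test_class_measurable test_class_bounded, OF Suc.prems Suc.prems] by (intro ext)
    moreover have "test_class p m (avg_const TYPE('n) p * (B * diff_weight p z)) (gauss_avg s (\<lambda>y. f y - f (y - z)))"
      by (rule Suc.IH[OF test_class_SucD[OF Suc.prems]])
    ultimately show "test_class p m (avg_const TYPE('n) p * B * diff_weight p z)
        (\<lambda>y. gauss_avg s f y - gauss_avg s f (y - z))"
      by (simp add: mult.assoc)
  qed
qed (rule gauss_avg_test_class_zero[OF _ s])

text \<open>The residual is an average of first differences with shifts \<open>s *\<^sub>R w\<close>, so one order of differences is
traded for a factor \<open>s\<close>.\<close>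

lemma gauss_residual_test_class:
  fixes f :: "real^'n::finite \<Rightarrow> real"
  assumes f: "test_class p (Suc m) B f" and s: "0 < s" "s \<le> 1"
  shows "test_class p m (res_const TYPE('n) p * s * B) (\<lambda>y. f y - gauss_avg s f y)"
  using f
proof (induction m arbitrary: B f)
  case 0
  note f0 = test_class_zero[OF 0]
  note [measurable] = test_class_measurable[OF f0]
  have B: "0 \<le> B" using 0 by (rule test_class_nonneg)
  have "\<bar>f y - gauss_avg s f y\<bar> * (1 + norm y) ^ p \<le> res_const TYPE('n) p * s * B" for y
  proof -
    have int: "integrable lborel (\<lambda>w. gauss w * (f y - f (y - s *\<^sub>R w)))"
      using integrable_gauss_mult[of f B] test_class_bounded[OF f0] integrable_gauss
      unfolding right_diff_distrib by (intro Bochner_Integration.integrable_diff) auto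
    have "\<bar>\<integral>w. gauss w * (f y - f (y - s *\<^sub>R w)) \<partial>lborel\<bar> * (1 + norm y) ^ p
        \<le> (\<integral>w. \<bar>gauss w * (f y - f (y - s *\<^sub>R w))\<bar> \<partial>lborel) * (1 + norm y) ^ p"
      by (intro mult_right_mono integral_abs_bound) auto
    also have "\<dots> = (\<integral>w. \<bar>gauss w * (f y - f (y - s *\<^sub>R w))\<bar> * (1 + norm y) ^ p \<partial>lborel)"
      by simp
    also have "\<dots> \<le> (\<integral>w. (gauss w * diff_weight p (w :: real^'n)) * (s * B) \<partial>lborel)"
    proof (rule integral_mono)
      show "integrable lborel (\<lambda>w. \<bar>gauss w * (f y - f (y - s *\<^sub>R w))\<bar> * (1 + norm y) ^ p)"
        using int by (intro integrable_mult_left integrable_abs)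
      show "integrable lborel (\<lambda>w::real^'n. (gauss w * diff_weight p w) * (s * B))"
        by (intro integrable_mult_left integrable_gauss_diff_weight)
      fix w :: "real^'n"
      have "diff_weight p (s *\<^sub>R w) \<le> s * diff_weight p w"
      proof -
        have "(1 + norm (s *\<^sub>R w)) ^ p \<le> (1 + norm w) ^ p"
          using s by (intro power_mono) (auto simp: mult_left_le_one_le)
        then have "s * (real CARD('n) * norm w) * (1 + norm (s *\<^sub>R w)) ^ p \<le> s * (real CARD('n) * norm w) * (1 + norm w) ^ p"
          using s by (intro mult_left_mono) auto
        then show ?thesis using s by (simp add: diff_weight_def mult_ac)
      qed
      then have "B * diff_weight p (s *\<^sub>R w) \<le> B * (s * diff_weight p w)"
        using B by (intro mult_left_mono)
      moreover have "\<bar>f y - f (y - s *\<^sub>R w)\<bar> * (1 + norm y) ^ p \<le> B * diff_weight p (s *\<^sub>R w)"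
        by (rule test_class_decay[OF test_class_SucD[OF 0]])
      ultimately have "gauss w * (\<bar>f y - f (y - s *\<^sub>R w)\<bar> * (1 + norm y) ^ p) \<le> gauss w * (B * (s * diff_weight p w))"
        by (intro mult_left_mono less_imp_le[OF gauss_pos]) linarith
      then show "\<bar>gauss w * (f y - f (y - s *\<^sub>R w))\<bar> * (1 + norm y) ^ p \<le> (gauss w * diff_weight p w) * (s * B)"
        using gauss_pos[of w] by (simp add: abs_mult mult_ac)
    qed
    also have "\<dots> = (\<integral>w. gauss w * diff_weight p (w :: real^'n) \<partial>lborel) * (s * B)"
      by simp
    finally have "\<bar>\<integral>w. gauss w * (f y - f (y - s *\<^sub>R w)) \<partial>lborel\<bar> * (1 + norm y) ^ p / gauss_mass TYPE('n)
        \<le> (\<integral>w. gauss w * diff_weight p (w :: real^'n) \<partial>lborel) * (s * B) / gauss_mass TYPE('n)"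
      using gauss_mass_pos[where 'n = 'n] by (intro divide_right_mono) auto
    then show ?thesis
      using gauss_mass_pos[where 'n = 'n]
        gauss_avg_residual[OF test_class_measurable[OF f0] test_class_bounded[OF f0], of y s]
      by (simp add: res_const_def mult_ac)
  qed
  then show ?case by (intro test_class_zeroI) auto
next
  case (Suc m)
  show ?case
  proof (rule test_class_SucI)
    show "test_class p 0 (res_const TYPE('n) p * s * B) (\<lambda>y. f y - gauss_avg s f y)"
      using Suc.IH[OF test_class_Suc_down[OF Suc.prems]] by (rule test_class_zero)
    fix z
    have "(\<lambda>y. f y - gauss_avg s f y - (f (y - z) - gauss_avg s f (y - z)))
        = (\<lambda>y. (f y - f (y - z)) - gauss_avg s (\<lambda>y. f y - f (y - z)) y)"
      using gauss_avg_diff[OF test_class_measurable test_class_bounded, OF Suc.prems Suc.prems, symmetric]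
      by (intro ext) simp
    moreover have "test_class p m (res_const TYPE('n) p * s * (B * diff_weight p z)) \<dots>"
      by (rule Suc.IH[OF test_class_SucD[OF Suc.prems]])
    ultimately show "test_class p m (res_const TYPE('n) p * s * B * diff_weight p z)
        (\<lambda>y. f y - gauss_avg s f y - (f (y - z) - gauss_avg s f (y - z)))"
      by (simp add: mult.assoc)
  qed
qed

text \<open>The properties of the functional \<open>g \<mapsto> \<integral> g((x - y) / t) da(y)\<close> that enter the argument for general test
functions: it is additive, it is bounded by some constant \<open>K\<close>, which makes remainders of small size vanish, and on
Gaussian averages of width \<open>s\<close> it is bounded with a loss of order \<open>\<gamma>\<close>.\<close>

definition smoothing_bounded ::
    "nat \<Rightarrow> real \<Rightarrow> real \<Rightarrow> real \<Rightarrow> ((real^'n::finite \<Rightarrow> real) \<Rightarrow> real) \<Rightarrow> bool" where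
  "smoothing_bounded p \<gamma> H K L \<longleftrightarrow> 0 \<le> H \<and> 0 \<le> K \<and>
    (\<forall>f h b. f \<in> borel_measurable borel \<longrightarrow> h \<in> borel_measurable borel \<longrightarrow>
       (\<forall>y. \<bar>f y\<bar> \<le> b) \<longrightarrow> (\<forall>y. \<bar>h y\<bar> \<le> b) \<longrightarrow> L (\<lambda>y. f y - h y) = L f - L h) \<and>
    (\<forall>f b. f \<in> borel_measurable borel \<longrightarrow> (\<forall>y. \<bar>f y\<bar> \<le> b) \<longrightarrow> \<bar>L f\<bar> \<le> K * b) \<and>
    (\<forall>s f b. 0 < s \<longrightarrow> s \<le> 1 \<longrightarrow> test_class p 0 b f \<longrightarrow> \<bar>L (gauss_avg s f)\<bar> \<le> H * s powr (- \<gamma>) * b)"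

text \<open>Put \<open>\<Phi> 0 = g\<close> and let \<open>\<Phi> (Suc j)\<close> be the residual of \<open>\<Phi> j\<close> after averaging at width \<open>u ^ j\<close>. Then \<open>L g\<close> is
the sum of the values of \<open>L\<close> on the averages plus \<open>L (\<Phi> j)\<close>. Each step multiplies the norms by at most
\<open>A\<close>, and the last \<open>m\<close> steps before \<open>j\<close> gain about \<open>u ^ (j * m)\<close> altogether, against a loss of
\<open>(u ^ j) powr (- \<gamma>)\<close> from the averages. As \<open>\<gamma> < m\<close>, a small \<open>u\<close> makes both the averages and the remainder
decay like \<open>(1 / 2) ^ j\<close>; the constant \<open>K\<close> only multiplies the remainder and disappears in the limit.\<close>

lemma bound_from_gauss_averages:
  fixes \<gamma> :: real
  assumes \<gamma>: "0 \<le> \<gamma>" "\<gamma> < real m"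
  obtains C where "0 < C"
    "\<And>(L :: (real^'n::finite \<Rightarrow> real) \<Rightarrow> real) g B H K.
      smoothing_bounded p \<gamma> H K L \<Longrightarrow> test_class p m B g \<Longrightarrow> \<bar>L g\<bar> \<le> C * H * B"
proof -
  define A where "A = 1 + avg_const TYPE('n) p"
  have A: "1 \<le> A" using avg_const_nonneg[of p, where 'n = 'n] by (simp add: A_def)
  define C0 where "C0 = max 1 (res_const TYPE('n) p)"
  have C0: "1 \<le> C0" "res_const TYPE('n) p \<le> C0" by (simp_all add: C0_def)
  (* the ratio of successive widths for which the net gain per step, times the growth factor A, is 1/2 *)
  define u where "u = (1 / (2 * A)) powr (1 / (real m - \<gamma>))"
  have u: "0 < u" "u \<le> 1"
    using A \<gamma> by (auto simp: u_def intro!: powr_le1)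
  have Au: "A * u powr (real m - \<gamma>) = 1 / 2"
    using A \<gamma> by (simp add: u_def powr_powr)
  (* a constant that absorbs the first m steps, in which the full gain is not yet available *)
  define M where "M = C0 / u ^ m"
  have M: "1 \<le> M"
  proof -
    have "u ^ m \<le> 1" using u by (simp add: power_le_one)
    then have "u ^ m \<le> C0" using C0(1) by linarith
    then show ?thesis using u by (simp add: M_def)
  qed
  define C where "C = 2 * M ^ m"
  have core: "\<bar>L g\<bar> \<le> C * H * B"
    if L: "smoothing_bounded p \<gamma> H K L" and g: "test_class p m B g"
    for L :: "(real^'n \<Rightarrow> real) \<Rightarrow> real" and g B H K
  proof -
    have lin: "L (\<lambda>y. f y - h y) = L f - L h"
      if "f \<in> borel_measurable borel" "h \<in> borel_measurable borel" "\<And>y. \<bar>f y\<bar> \<le> b" "\<And>y. \<bar>h y\<bar> \<le> b" for f h b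
      using L that unfolding smoothing_bounded_def by blast
    have bnd: "\<bar>L f\<bar> \<le> K * b" if "f \<in> borel_measurable borel" "\<And>y. \<bar>f y\<bar> \<le> b" for f b
      using L that unfolding smoothing_bounded_def by blast
    have avg: "\<bar>L (gauss_avg s f)\<bar> \<le> H * s powr (- \<gamma>) * b" if "0 < s" "s \<le> 1" "test_class p 0 b f" for s f b
      using L that unfolding smoothing_bounded_def by blast
    have H: "0 \<le> H" and K: "0 \<le> K"
      using L unfolding smoothing_bounded_def by blast+
    have B: "0 \<le> B" using g by (rule test_class_nonneg)
    define \<Phi> where "\<Phi> = rec_nat g (\<lambda>j f y. f y - gauss_avg (u ^ j) f y)"
    have \<Phi>0: "\<Phi> 0 = g" and \<Phi>S: "\<Phi> (Suc j) = (\<lambda>y. \<Phi> j y - gauss_avg (u ^ j) (\<Phi> j) y)" for j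
      by (simp_all add: \<Phi>_def)
    have uj: "0 < u ^ j" "u ^ j \<le> 1" for j
      using u by (auto simp: power_le_one)
    (* bound for the differences of order k after j steps: m - k orders have been traded for powers of the width *)
    define b where "b j k = B * A ^ j * M ^ (m - k) * (u ^ j) ^ (m - k)" for j k
    have cls: "test_class p k (b j k) (\<Phi> j)" if "k \<le> m" for j k
      using that
    proof (induction j arbitrary: k)
      case 0
      have "B \<le> b 0 k"
        using B M by (simp add: b_def mult_left_le one_le_power mult_le_cancel_left1)
      then show ?case
        unfolding \<Phi>0 using test_class_mono test_class_down[OF g 0] by blast
    next
      case (Suc j)
      show ?case
      proof (cases "k = m")
        case True
        have "test_class p m (b j m + avg_const TYPE('n) p * b j m) (\<Phi> (Suc j))"
          unfolding \<Phi>S by (intro test_class_diff gauss_avg_test_class Suc.IH uj order_refl)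
        moreover have "b j m + avg_const TYPE('n) p * b j m = b (Suc j) m"
          by (simp add: b_def A_def algebra_simps)
        ultimately show ?thesis using True by simp
      next
        case False
        then have k: "Suc k \<le> m" using Suc.prems by simp
        have "test_class p k (res_const TYPE('n) p * u ^ j * b j (Suc k)) (\<Phi> (Suc j))"
          unfolding \<Phi>S by (intro gauss_residual_test_class Suc.IH uj k)
        moreover have "res_const TYPE('n) p * u ^ j * b j (Suc k) \<le> b (Suc j) k"
        proof -
          define n where "n = m - Suc k"
          have n: "m - k = Suc n" "m - Suc k = n" "Suc n \<le> m" using k by (auto simp: n_def)
          have "res_const TYPE('n) p \<le> C0 * 1" using C0 by simp
          also have "\<dots> \<le> C0 * (A * (u ^ Suc n / u ^ m))"
          proof -
            have "u ^ m \<le> u ^ Suc n"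
              using u n(3) by (intro power_decreasing) auto
            then have "1 \<le> u ^ Suc n / u ^ m" using u by simp
            then have "1 * 1 \<le> A * (u ^ Suc n / u ^ m)"
              using A by (intro mult_mono) auto
            then show ?thesis using C0 by (intro mult_left_mono) auto
          qed
          also have "\<dots> = A * M * u ^ Suc n"
            by (simp add: M_def)
          finally have "res_const TYPE('n) p * (u ^ j * b j (Suc k)) \<le> (A * M * u ^ Suc n) * (u ^ j * b j (Suc k))"
            using B A M u by (intro mult_right_mono) (auto simp: b_def)
          also have "\<dots> = b (Suc j) k"
            by (simp add: b_def n power_mult_distrib power_mult[symmetric] mult_ac)
          finally show ?thesis by (simp add: mult.assoc)
        qed
        ultimately show ?thesis by (rule test_class_mono)
      qed
    qed
    note meas = test_class_measurable[OF cls[OF le0]]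
    have step: "L (\<Phi> (Suc j)) = L (\<Phi> j) - L (gauss_avg (u ^ j) (\<Phi> j))" for j
      unfolding \<Phi>S
    proof (rule lin)
      let ?b = "max (b j 0) (avg_const TYPE('n) p * b j 0)"
      show "\<Phi> j \<in> borel_measurable borel" by (rule meas)
      then show "gauss_avg (u ^ j) (\<Phi> j) \<in> borel_measurable borel" by (rule gauss_avg_measurable)
      show "\<bar>\<Phi> j y\<bar> \<le> ?b" for y
        using test_class_bounded[OF cls[OF le0], of j y] by simp
      show "\<bar>gauss_avg (u ^ j) (\<Phi> j) y\<bar> \<le> ?b" for y
        using test_class_bounded[OF gauss_avg_test_class[OF cls[OF le0] uj], of j j y] by simp
    qed
    have pw: "A ^ j * (u ^ j) ^ m * (u ^ j) powr (- \<gamma>) = (1 / 2) ^ j" for j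
    proof -
      have "(u ^ j) ^ m * (u ^ j) powr (- \<gamma>) = (u powr (real m - \<gamma>)) ^ j"
        using u by (simp add: powr_realpow[symmetric] powr_powr powr_add[symmetric] algebra_simps)
      then show ?thesis
        by (simp add: mult.assoc power_mult_distrib[symmetric] Au)
    qed
    have main: "\<bar>L (gauss_avg (u ^ j) (\<Phi> j))\<bar> \<le> H * B * M ^ m * (1 / 2) ^ j" for j
    proof -
      have "\<bar>L (gauss_avg (u ^ j) (\<Phi> j))\<bar> \<le> H * (u ^ j) powr (- \<gamma>) * b j 0"
        using uj cls[OF le0] by (rule avg)
      also have "\<dots> = H * B * M ^ m * (A ^ j * (u ^ j) ^ m * (u ^ j) powr (- \<gamma>))"
        by (simp add: b_def mult_ac)
      finally show ?thesis by (simp only: pw)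
    qed
    have tail: "\<bar>L (\<Phi> j)\<bar> \<le> K * B * M ^ m * (1 / 2) ^ j" for j
    proof -
      have "\<bar>L (\<Phi> j)\<bar> \<le> K * b j 0"
        using meas test_class_bounded[OF cls[OF le0]] by (rule bnd)
      also have "\<dots> = K * B * M ^ m * (A ^ j * (u ^ j) ^ m * 1)"
        by (simp add: b_def mult_ac)
      also have "\<dots> \<le> K * B * M ^ m * (A ^ j * (u ^ j) ^ m * (u ^ j) powr (- \<gamma>))"
      proof -
        have "1 powr (- \<gamma>) \<le> (u ^ j) powr (- \<gamma>)"
          using uj \<gamma> by (intro powr_mono2') auto
        then show ?thesis
          using K B M A u by (intro mult_left_mono) auto
      qed
      finally show ?thesis by (simp only: pw)
    qed
    have sum: "\<bar>L g\<bar> \<le> H * B * M ^ m * (\<Sum>i<j. (1 / 2) ^ i) + \<bar>L (\<Phi> j)\<bar>" for j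
    proof (induction j)
      case (Suc j)
      have "\<bar>L (\<Phi> j)\<bar> \<le> \<bar>L (gauss_avg (u ^ j) (\<Phi> j))\<bar> + \<bar>L (\<Phi> (Suc j))\<bar>"
        using step[of j] by linarith
      then show ?case
        using Suc main[of j] by (simp add: distrib_left)
    qed (simp add: \<Phi>0)
    have "\<bar>L g\<bar> \<le> C * H * B + K * B * M ^ m * (1 / 2) ^ j" for j
    proof -
      have "(\<Sum>i<j. (1 / 2 :: real) ^ i) \<le> 2"
        by (simp add: geometric_sum)
      then have "H * B * M ^ m * (\<Sum>i<j. (1 / 2) ^ i) \<le> H * B * M ^ m * 2"
        using H B M by (intro mult_left_mono) auto
      then show ?thesis
        using sum[of j] tail[of j] by (simp add: C_def mult_ac)
    qed
    moreover have "(\<lambda>j. C * H * B + K * B * M ^ m * (1 / 2) ^ j) \<longlonglongrightarrow> C * H * B + K * B * M ^ m * 0"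
      by (intro tendsto_intros) simp_all
    ultimately show ?thesis
      by (intro LIMSEQ_le_const[of _ "C * H * B"]) auto
  qed
  have "0 < C" using M by (simp add: C_def)
  then show thesis
    using core by (rule that)
qed

section \<open>Schwartz functions as test functions\<close>

lemma partial_deriv_eq:
  fixes f :: "real^'n::finite \<Rightarrow> 'b::real_normed_vector"
  assumes "(f has_derivative f') (at x)"
  shows "partial_deriv i f x = f' (axis i 1)"
proof -
  have "((\<lambda>h. x + h *\<^sub>R axis i 1) has_derivative (\<lambda>h. h *\<^sub>R axis i 1)) (at 0)"
    by (auto intro!: derivative_eq_intros)
  moreover have "(f has_derivative f') (at (x + 0 *\<^sub>R axis i 1))"
    using assms by simp
  ultimately have "((\<lambda>h. f (x + h *\<^sub>R axis i 1)) has_derivative (\<lambda>h. f' (h *\<^sub>R axis i 1))) (at 0)"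
    using diff_chain_at[of "\<lambda>h. x + h *\<^sub>R axis i 1" _ 0 f f'] by (simp add: o_def)
  moreover have "f' (h *\<^sub>R axis i 1) = h *\<^sub>R f' (axis i 1)" for h
    using assms by (simp add: has_derivative_def bounded_linear.linear linear_scale)
  ultimately have "((\<lambda>h. f (x + h *\<^sub>R axis i 1)) has_vector_derivative f' (axis i 1)) (at 0)"
    by (simp add: has_vector_derivative_def)
  then show ?thesis
    unfolding partial_deriv_def by (rule vector_derivative_at)
qed

lemma has_derivative_affine_image:
  assumes "bounded_linear T" "(f has_derivative f') (at (x + v))"
  shows "((\<lambda>u. T (f (u + v))) has_derivative (\<lambda>h. T (f' h))) (at x)"
proof -
  have "((\<lambda>u. u + v) has_derivative (\<lambda>h. h)) (at x)"
    by (auto intro!: derivative_eq_intros)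
  from diff_chain_at[OF this, of f f'] assms(2)
  have "((\<lambda>u. f (u + v)) has_derivative f') (at x)"
    by (simp add: o_def)
  then show ?thesis
    by (rule bounded_linear.has_derivative[OF assms(1)])
qed

lemma iter_deriv_affine_image:
  fixes f :: "real^'n::finite \<Rightarrow> 'b::real_normed_vector"
  assumes T: "bounded_linear T" and f: "smooth f"
  shows "iter_deriv is (\<lambda>u. T (f (u + v))) = (\<lambda>u. T (iter_deriv is f (u + v)))"
proof (induction "is")
  case (Cons i "is")
  show ?case
  proof
    fix x
    obtain f' where f': "(iter_deriv is f has_derivative f') (at (x + v))"
      using f unfolding smooth_def differentiable_def by blast
    show "iter_deriv (i # is) (\<lambda>u. T (f (u + v))) x = T (iter_deriv (i # is) f (x + v))"
      using partial_deriv_eq[OF has_derivative_affine_image[OF T f'], of i] partial_deriv_eq[OF f', of i]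
      by (simp add: Cons.IH)
  qed
qed simp

lemma smooth_affine_image:
  assumes T: "bounded_linear T" and f: "smooth f"
  shows "smooth (\<lambda>u. T (f (u + v)))"
  unfolding smooth_def iter_deriv_affine_image[OF assms]
proof (intro allI)
  fix "is" x
  obtain f' where f': "(iter_deriv is f has_derivative f') (at (x + v))"
    using f unfolding smooth_def differentiable_def by blast
  show "(\<lambda>u. T (iter_deriv is f (u + v))) differentiable at x"
    using has_derivative_affine_image[OF T f'] unfolding differentiable_def by blast
qed

lemma iter_deriv_difference:
  fixes f :: "real^'n::finite \<Rightarrow> 'b::real_normed_vector"
  assumes f: "smooth f"
  shows "iter_deriv is (\<lambda>y. f y - f (y - z)) = (\<lambda>y. iter_deriv is f y - iter_deriv is f (y - z))"
    and "\<And>x. iter_deriv is (\<lambda>y. f y - f (y - z)) differentiable at x"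
proof -
  have der: "\<exists>f' g'. (iter_deriv is f has_derivative f') (at x) \<and> (iter_deriv is f has_derivative g') (at (x - z))
      \<and> ((\<lambda>y. iter_deriv is f y - iter_deriv is f (y - z)) has_derivative (\<lambda>h. f' h - g' h)) (at x)" for "is" x
  proof -
    obtain f' g' where f': "(iter_deriv is f has_derivative f') (at x)"
      and g': "(iter_deriv is f has_derivative g') (at (x - z))"
      using f unfolding smooth_def differentiable_def by blast
    have "((\<lambda>y. iter_deriv is f (y - z)) has_derivative g') (at x)"
      using has_derivative_affine_image[OF bounded_linear_ident, of "iter_deriv is f" g' x "- z"] g' by simp
    then show ?thesis
      using has_derivative_diff[OF f'] f' g' by blast
  qed
  show eq: "iter_deriv is (\<lambda>y. f y - f (y - z)) = (\<lambda>y. iter_deriv is f y - iter_deriv is f (y - z))" for "is"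
  proof (induction "is")
    case (Cons i "is")
    show ?case
    proof
      fix x
      obtain f' g' where "(iter_deriv is f has_derivative f') (at x)" "(iter_deriv is f has_derivative g') (at (x - z))"
        "((\<lambda>y. iter_deriv is f y - iter_deriv is f (y - z)) has_derivative (\<lambda>h. f' h - g' h)) (at x)"
        using der by blast
      from this[THEN partial_deriv_eq, of i]
      show "iter_deriv (i # is) (\<lambda>y. f y - f (y - z)) x = iter_deriv (i # is) f x - iter_deriv (i # is) f (x - z)"
        by (simp add: Cons.IH)
    qed
  qed simp
  show "iter_deriv is (\<lambda>y. f y - f (y - z)) differentiable at x" for x
    unfolding eq differentiable_def using der by blast
qed

lemma smooth_difference: "smooth f \<Longrightarrow> smooth (\<lambda>y. f y - f (y - z))"
  using iter_deriv_difference(2) unfolding smooth_def by blast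

text \<open>The mean value theorem on the segment from \<open>y - z\<close> to \<open>y\<close>, with the weight moved from the intermediate point
to \<open>y\<close>.\<close>

lemma difference_bound:
  fixes h :: "real^'n::finite \<Rightarrow> real"
  assumes h: "\<And>x. h differentiable at x"
    and b: "\<And>i x. \<bar>partial_deriv i h x\<bar> * (1 + norm x) ^ p \<le> B"
  shows "\<bar>h y - h (y - z)\<bar> * (1 + norm y) ^ p \<le> B * diff_weight p z"
proof -
  obtain h' where h': "\<And>x. (h has_derivative h' x) (at x)"
    using h unfolding differentiable_def by metis
  define l where "l t = (y - z) + t *\<^sub>R z" for t :: real
  have "((\<lambda>t. h (l t)) has_derivative (\<lambda>s. h' (l t) (s *\<^sub>R z))) (at t within {0..1})" for t
  proof -
    have "(l has_derivative (\<lambda>s. s *\<^sub>R z)) (at t)"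
      unfolding l_def by (auto intro!: derivative_eq_intros)
    from diff_chain_at[OF this h'] show ?thesis
      by (auto simp: o_def intro: has_derivative_at_withinI)
  qed
  then obtain t where t: "0 < t" "t < 1" "h (l 1) - h (l 0) = h' (l t) ((1 - 0) *\<^sub>R z)"
    using mvt_simple[of 0 1 "\<lambda>t. h (l t)" "\<lambda>t s. h' (l t) (s *\<^sub>R z)"] by auto
  define \<xi> where "\<xi> = l t"
  have eq: "h y - h (y - z) = h' \<xi> z"
    using t(3) by (simp add: l_def \<xi>_def)
  have lin: "linear (h' \<xi>)"
    using h'[of \<xi>] by (simp add: has_derivative_def bounded_linear.linear)
  have "h' \<xi> z = h' \<xi> (\<Sum>i\<in>UNIV. z $ i *\<^sub>R axis i 1)"
    by (simp add: basis_expansion scalar_mult_eq_scaleR[symmetric])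
  also have "\<dots> = (\<Sum>i\<in>UNIV. z $ i * partial_deriv i h \<xi>)"
    using lin by (simp add: linear_sum linear_scale partial_deriv_eq[OF h'])
  finally have hz: "h' \<xi> z = (\<Sum>i\<in>UNIV. z $ i * partial_deriv i h \<xi>)" .
  have w: "(1 + norm y) ^ p \<le> (1 + norm \<xi>) ^ p * (1 + norm z) ^ p"
  proof -
    have yx: "y - \<xi> = (1 - t) *\<^sub>R z"
      by (simp add: \<xi>_def l_def algebra_simps)
    then have n: "norm (y - \<xi>) \<le> norm z"
      using t by (simp add: mult_left_le_one_le)
    have "(1 + norm y) ^ p \<le> (1 + norm \<xi>) ^ p * (1 + norm (y - \<xi>)) ^ p"
      using weight_shift[of y p "y - \<xi>"] by simp
    also have "\<dots> \<le> (1 + norm \<xi>) ^ p * (1 + norm z) ^ p"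
      using n by (intro mult_left_mono power_mono) auto
    finally show ?thesis .
  qed
  have "\<bar>h' \<xi> z\<bar> * (1 + norm y) ^ p \<le> (\<Sum>i\<in>UNIV. \<bar>z $ i\<bar> * \<bar>partial_deriv i h \<xi>\<bar>) * (1 + norm y) ^ p"
    unfolding hz by (intro mult_right_mono order_trans[OF sum_abs]) (auto simp: abs_mult)
  also have "\<dots> = (\<Sum>i\<in>UNIV. \<bar>z $ i\<bar> * (\<bar>partial_deriv i h \<xi>\<bar> * (1 + norm y) ^ p))"
    by (simp add: sum_distrib_right mult.assoc)
  also have "\<dots> \<le> (\<Sum>i\<in>(UNIV::'n set). norm z * (B * (1 + norm z) ^ p))"
  proof (rule sum_mono, rule mult_mono)
    fix i :: 'n
    show "\<bar>z $ i\<bar> \<le> norm z" by (rule component_le_norm_cart)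
    have "\<bar>partial_deriv i h \<xi>\<bar> * (1 + norm y) ^ p \<le> \<bar>partial_deriv i h \<xi>\<bar> * ((1 + norm \<xi>) ^ p * (1 + norm z) ^ p)"
      using w by (intro mult_left_mono) auto
    also have "\<dots> = (\<bar>partial_deriv i h \<xi>\<bar> * (1 + norm \<xi>) ^ p) * (1 + norm z) ^ p"
      by (simp only: mult.assoc)
    also have "\<dots> \<le> B * (1 + norm z) ^ p"
      by (intro mult_right_mono b) auto
    finally show "\<bar>partial_deriv i h \<xi>\<bar> * (1 + norm y) ^ p \<le> B * (1 + norm z) ^ p" .
  qed auto
  also have "\<dots> = B * diff_weight p z"
    by (simp add: diff_weight_def mult_ac)
  finally show ?thesis unfolding eq .
qed

lemma test_class_of_derivatives:
  assumes "smooth f"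
    and "\<And>is y. length is \<le> m \<Longrightarrow> \<bar>iter_deriv is f y\<bar> * (1 + norm y) ^ p \<le> B"
  shows "test_class p m B f"
  using assms
proof (induction m arbitrary: B f)
  case 0
  have "f differentiable at x" for x
    using 0(1) unfolding smooth_def by (metis iter_deriv.simps(1))
  then have "continuous_on UNIV f"
    by (simp add: continuous_on_eq_continuous_at differentiable_imp_continuous_within)
  then have "f \<in> borel_measurable borel" by (rule borel_measurable_continuous_onI)
  then show ?case
    using 0(2)[of "[]"] by (intro test_class_zeroI) auto
next
  case (Suc m)
  show ?case
  proof (rule test_class_SucI)
    show "test_class p 0 B f"
      using Suc by (intro test_class_zero[OF Suc.IH]) auto
    show "test_class p m (B * diff_weight p z) (\<lambda>y. f y - f (y - z))" for z
    proof (rule Suc.IH)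
      show "smooth (\<lambda>y. f y - f (y - z))" by (rule smooth_difference[OF Suc.prems(1)])
      fix "is" :: "'a list" and y
      assume len: "length is \<le> m"
      show "\<bar>iter_deriv is (\<lambda>y. f y - f (y - z)) y\<bar> * (1 + norm y) ^ p \<le> B * diff_weight p z"
        unfolding iter_deriv_difference(1)[OF Suc.prems(1)]
      proof (rule difference_bound)
        show "iter_deriv is f differentiable at x" for x
          using Suc.prems(1) unfolding smooth_def by blast
        show "\<bar>partial_deriv i (iter_deriv is f) x\<bar> * (1 + norm x) ^ p \<le> B" for i x
          using Suc.prems(2)[of "i # is" x] len by simp
      qed
    qed
  qed
qed

text \<open>The rotation \<open>\<theta>\<close> reduces complex test functions to real ones, and the shift \<open>v\<close> makes the later estimates
nontangential.\<close>

lemma schwartz_test_class: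
  fixes \<Phi> :: "real^'n::finite \<Rightarrow> complex"
  assumes \<Phi>: "\<Phi> \<in> schwartz" and semi: "seminorm p m \<Phi> \<le> 1" and \<theta>: "norm \<theta> = 1" and v: "norm v \<le> 1"
  shows "test_class p m (2 ^ p) (\<lambda>u. Re (\<theta> * \<Phi> (u + v)))"
proof (rule test_class_of_derivatives)
  have T: "bounded_linear (\<lambda>c. Re (\<theta> * c))"
    by (intro bounded_linear_compose[OF bounded_linear_Re] bounded_linear_mult_right)
  have sm: "smooth \<Phi>" using \<Phi> by (simp add: schwartz_def)
  show "smooth (\<lambda>u. Re (\<theta> * \<Phi> (u + v)))"
    by (rule smooth_affine_image[OF T sm])
  fix "is" :: "'n list" and y
  assume len: "length is \<le> m"
  have "ennreal ((1 + norm (y + v)) ^ p * norm (iter_deriv is \<Phi> (y + v))) \<le> seminorm p m \<Phi>"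
    unfolding seminorm_def using len by (intro SUP_upper2[where i = "y + v"] SUP_upper) auto
  then have "ennreal ((1 + norm (y + v)) ^ p * norm (iter_deriv is \<Phi> (y + v))) \<le> 1"
    using semi by (rule order_trans)
  then have 1: "(1 + norm (y + v)) ^ p * norm (iter_deriv is \<Phi> (y + v)) \<le> 1"
    by simp
  have "(1 + norm y) ^ p \<le> (1 + norm (y + v)) ^ p * (1 + norm v) ^ p"
    using weight_shift[of y p "- v"] by simp
  also have "\<dots> \<le> (1 + norm (y + v)) ^ p * 2 ^ p"
    using v by (intro mult_left_mono power_mono) auto
  finally have 2: "(1 + norm y) ^ p \<le> (1 + norm (y + v)) ^ p * 2 ^ p" .
  have "\<bar>Re (\<theta> * iter_deriv is \<Phi> (y + v))\<bar> \<le> norm (iter_deriv is \<Phi> (y + v))"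
    using abs_Re_le_cmod[of "\<theta> * iter_deriv is \<Phi> (y + v)"] \<theta> by (simp add: norm_mult)
  then have "\<bar>Re (\<theta> * iter_deriv is \<Phi> (y + v))\<bar> * (1 + norm y) ^ p
      \<le> norm (iter_deriv is \<Phi> (y + v)) * ((1 + norm (y + v)) ^ p * 2 ^ p)"
    using 2 by (intro mult_mono) auto
  also have "\<dots> = ((1 + norm (y + v)) ^ p * norm (iter_deriv is \<Phi> (y + v))) * 2 ^ p"
    by (simp add: mult_ac)
  also have "\<dots> \<le> 1 * 2 ^ p"
    using 1 by (intro mult_right_mono) auto
  finally show "\<bar>iter_deriv is (\<lambda>u. Re (\<theta> * \<Phi> (u + v))) y\<bar> * (1 + norm y) ^ p \<le> 2 ^ p"
    unfolding iter_deriv_affine_image[OF T sm] by simp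
qed

section \<open>Atoms tested against dilated functions\<close>

text \<open>Fubini's theorem on both Jordan parts; the difference may be taken inside because both inner integrals are
integrable.\<close>

lemma signed_integral_Fubini:
  fixes F :: "real^'n::finite \<Rightarrow> real^'n \<Rightarrow> real"
  assumes \<mu>: "signed_measure \<mu>"
    and F: "case_prod F \<in> borel_measurable (borel \<Otimes>\<^sub>M borel)"
    and g: "integrable lborel g" and Fg: "\<And>y v. \<bar>F y v\<bar> \<le> g v"
  shows "signed_integral \<mu> (\<lambda>y. \<integral>v. F y v \<partial>lborel) = (\<integral>v. signed_integral \<mu> (\<lambda>y. F y v) \<partial>lborel)"
proof -
  have swap: "(\<integral>y. \<integral>v. F y v \<partial>lborel \<partial>M) = (\<integral>v. \<integral>y. F y v \<partial>M \<partial>lborel)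
      \<and> integrable lborel (\<lambda>v. \<integral>y. F y v \<partial>M)"
    if M: "finite_measure M" and sets[measurable_cong]: "sets M = sets borel" for M :: "(real^'n) measure"
  proof -
    interpret M: finite_measure M by fact
    interpret P: pair_sigma_finite M lborel by unfold_locales
    have Fm[measurable]: "case_prod F \<in> borel_measurable (M \<Otimes>\<^sub>M lborel)"
      using F by (simp cong: measurable_cong_sets add: sets)
    have "(\<integral>\<^sup>+x. ennreal (norm (case_prod F x)) \<partial>(M \<Otimes>\<^sub>M lborel))
        = (\<integral>\<^sup>+y. \<integral>\<^sup>+v. ennreal (norm (F y v)) \<partial>lborel \<partial>M)"
      by (subst lborel.nn_integral_fst[symmetric]) auto
    also have "\<dots> \<le> (\<integral>\<^sup>+y. \<integral>\<^sup>+v. ennreal (norm (g v)) \<partial>lborel \<partial>M)"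
    proof (intro nn_integral_mono ennreal_leI)
      show "norm (F y v) \<le> norm (g v)" for y v
        using Fg[of y v] abs_ge_self[of "g v"] unfolding real_norm_def by linarith
    qed
    also have "\<dots> = (\<integral>\<^sup>+v. ennreal (norm (g v)) \<partial>lborel) * emeasure M (space M)"
      by simp
    also have "\<dots> < \<infinity>"
      using g unfolding integrable_iff_bounded
      using M.emeasure_finite[of "space M"] by (auto simp: ennreal_mult_eq_top_iff less_top[symmetric])
    finally have "integrable (M \<Otimes>\<^sub>M lborel) (case_prod F)"
      using Fm by (intro integrableI_bounded)
    then show ?thesis
      using P.Fubini_integral[of F] P.integrable_snd[of F] by simp
  qed
  show ?thesis
    unfolding signed_integral_def
    using swap[OF finite_measure_pos_part[OF \<mu>] sets_pos_part] swap[OF finite_measure_neg_part[OF \<mu>] sets_neg_part]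
    by simp
qed

text \<open>The substitution \<open>v = u - s *\<^sub>R w\<close>, which moves the kernel away from \<open>f\<close>.\<close>

lemma gauss_avg_convolution:
  fixes f :: "real^'n::finite \<Rightarrow> real"
  assumes [measurable]: "f \<in> borel_measurable borel" and s: "0 < s"
  shows "gauss_avg s f u
    = (\<integral>v. s powr (- real CARD('n)) * gauss ((1 / s) *\<^sub>R (u - v)) * f v \<partial>lborel) / gauss_mass TYPE('n)"
proof -
  define c where "c = - 1 / s"
  define T where "T = (1 / s) *\<^sub>R u"
  have c: "c \<noteq> 0" using s by (simp add: c_def)
  have cd: "\<bar>c\<bar> ^ CARD('n) = s powr (- real CARD('n))"
    using s by (simp add: c_def powr_minus powr_realpow power_divide inverse_eq_divide)
  have "(\<integral>w. gauss w * f (u - s *\<^sub>R w) \<partial>lborel)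
      = (\<integral>w. gauss w * f (u - s *\<^sub>R w) \<partial>(density (distr lborel borel (\<lambda>x. T + c *\<^sub>R x)) (\<lambda>_. \<bar>c\<bar> ^ DIM(real^'n))))"
    by (subst lborel_affine[OF c, of T]) simp
  also have "\<dots> = (\<integral>v. \<bar>c\<bar> ^ CARD('n) * (gauss (T + c *\<^sub>R v) * f (u - s *\<^sub>R (T + c *\<^sub>R v))) \<partial>lborel)"
    by (subst integral_density) (auto simp: integral_distr)
  also have "\<dots> = (\<integral>v. s powr (- real CARD('n)) * gauss ((1 / s) *\<^sub>R (u - v)) * f v \<partial>lborel)"
  proof -
    have "T + c *\<^sub>R v = (1 / s) *\<^sub>R (u - v)" for v
      by (simp add: T_def c_def algebra_simps)
    moreover have "u - s *\<^sub>R ((1 / s) *\<^sub>R (u - v)) = v" for v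
      using s by simp
    ultimately show ?thesis by (simp add: cd mult.assoc)
  qed
  finally show ?thesis by (simp add: gauss_avg_def)
qed

lemma gauss_heat_kernel:
  fixes z :: "real^'n::finite"
  assumes "0 < r"
  shows "gauss ((1 / r) *\<^sub>R z) = (4 * pi * r\<^sup>2) powr (real CARD('n) / 2)
     * ((4 * pi * r\<^sup>2) powr (- real CARD('n) / 2) * exp (- (norm z)\<^sup>2 / (4 * r\<^sup>2)))"
proof -
  have "(4 * pi * r\<^sup>2) powr (real CARD('n) / 2) * (4 * pi * r\<^sup>2) powr (- real CARD('n) / 2) = 1"
    using assms by (simp add: powr_add[symmetric])
  moreover have "gauss ((1 / r) *\<^sub>R z) = exp (- (norm z)\<^sup>2 / (4 * r\<^sup>2))"
    using assms by (simp add: gauss_def power_mult_distrib power_divide)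
  ultimately show ?thesis by (simp add: mult.assoc[symmetric])
qed

text \<open>Up to the factor \<open>t ^ d\<close> this is the convolution of \<open>a\<close> with the dilate \<open>g\<^sub>t\<close> at \<open>x\<close>. Keeping \<open>g\<close> undilated
lets all scales be treated with the same test class.\<close>

definition dilated_integral :: "'n::finite set_fun \<Rightarrow> real^'n \<Rightarrow> real \<Rightarrow> (real^'n \<Rightarrow> real) \<Rightarrow> real" where
  "dilated_integral a x t g = signed_integral a (\<lambda>y. g ((1 / t) *\<^sub>R (x - y)))"

lemma signed_integral_mult_right:
  "signed_integral \<mu> (\<lambda>y. c * f y) = (c::real) * signed_integral \<mu> f"
  by (simp add: signed_integral_def right_diff_distrib)

text \<open>On a Gaussian average of width \<open>s\<close> the functional sees \<open>a\<close> only through its heat extension at time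
\<open>(s * t)\<^sup>2\<close>.\<close>

lemma dilated_integral_gauss_avg:
  fixes f :: "real^'n::finite \<Rightarrow> real"
  assumes a: "signed_measure a" and f: "test_class p 0 b f" and p: "CARD('n) + 2 \<le> p"
    and s: "0 < s" and t: "0 < t"
  shows "dilated_integral a x t (gauss_avg s f)
    = s powr (- real CARD('n)) * (4 * pi * (s * t)\<^sup>2) powr (real CARD('n) / 2) / gauss_mass TYPE('n)
      * (\<integral>v. heat ((s * t)\<^sup>2) a (x - t *\<^sub>R v) * f v \<partial>lborel)"
proof -
  note [measurable] = test_class_measurable[OF f]
  let ?u = "\<lambda>y. (1 / t) *\<^sub>R (x - y)"
  let ?k = "\<lambda>y v. gauss ((1 / s) *\<^sub>R (?u y - v))"
  have fint: "integrable lborel (\<lambda>v. b * (1 / (1 + norm (v :: real^'n)) ^ p))"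
    by (intro integrable_mult_right integrable_weight p)
  have bound: "\<bar>?k y v * f v\<bar> \<le> b * (1 / (1 + norm v) ^ p)" for y v
  proof -
    have "0 < (1 + norm v) ^ p"
      by (intro zero_less_power) (simp add: add_pos_nonneg)
    then have "\<bar>f v\<bar> \<le> b * (1 / (1 + norm v) ^ p)"
      using test_class_decay[OF f, of v] by (simp add: pos_le_divide_eq)
    moreover have "gauss w \<le> 1" for w :: "real^'n"
      by (simp add: gauss_def)
    then have "\<bar>?k y v * f v\<bar> \<le> 1 * \<bar>f v\<bar>"
      unfolding abs_mult by (intro mult_right_mono) (auto simp: gauss_pos less_imp_le abs_of_pos)
    ultimately show ?thesis by simp
  qed
  have kern: "?k y v = (4 * pi * (s * t)\<^sup>2) powr (real CARD('n) / 2)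
      * ((4 * pi * (s * t)\<^sup>2) powr (- real CARD('n) / 2) * exp (- (norm (x - t *\<^sub>R v - y))\<^sup>2 / (4 * (s * t)\<^sup>2)))" for y v
  proof -
    have "(1 / s) *\<^sub>R (?u y - v) = (1 / (s * t)) *\<^sub>R (x - t *\<^sub>R v - y)"
      using s t by (simp add: algebra_simps)
    then show ?thesis
      using gauss_heat_kernel[of "s * t" "x - t *\<^sub>R v - y"] s t by simp
  qed
  have inner: "signed_integral a (\<lambda>y. ?k y v * f v)
      = (4 * pi * (s * t)\<^sup>2) powr (real CARD('n) / 2) * (heat ((s * t)\<^sup>2) a (x - t *\<^sub>R v) * f v)" for v
  proof -
    have "signed_integral a (\<lambda>y. ?k y v * f v) = signed_integral a (\<lambda>y. ((4 * pi * (s * t)\<^sup>2) powr (real CARD('n) / 2) * f v)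
        * ((4 * pi * (s * t)\<^sup>2) powr (- real CARD('n) / 2) * exp (- (norm (x - t *\<^sub>R v - y))\<^sup>2 / (4 * (s * t)\<^sup>2))))"
      by (intro arg_cong[where f = "signed_integral a"] ext) (simp only: kern mult_ac)
    also have "\<dots> = ((4 * pi * (s * t)\<^sup>2) powr (real CARD('n) / 2) * f v) * heat ((s * t)\<^sup>2) a (x - t *\<^sub>R v)"
      unfolding signed_integral_mult_right heat_def ..
    finally show ?thesis by (simp add: mult_ac)
  qed
  have "dilated_integral a x t (gauss_avg s f)
      = signed_integral a (\<lambda>y. (s powr (- real CARD('n)) / gauss_mass TYPE('n)) * (\<integral>v. ?k y v * f v \<partial>lborel))"
    unfolding dilated_integral_def
    by (intro arg_cong[where f = "signed_integral a"] ext)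
      (simp add: gauss_avg_convolution[OF \<open>f \<in> borel_measurable borel\<close> s] mult.assoc)
  also have "\<dots> = (s powr (- real CARD('n)) / gauss_mass TYPE('n)) * signed_integral a (\<lambda>y. \<integral>v. ?k y v * f v \<partial>lborel)"
    by (rule signed_integral_mult_right)
  also have "signed_integral a (\<lambda>y. \<integral>v. ?k y v * f v \<partial>lborel) = (\<integral>v. signed_integral a (\<lambda>y. ?k y v * f v) \<partial>lborel)"
    using bound by (intro signed_integral_Fubini[OF a _ fint]) measurable
  also have "\<dots> = (4 * pi * (s * t)\<^sup>2) powr (real CARD('n) / 2) * (\<integral>v. heat ((s * t)\<^sup>2) a (x - t *\<^sub>R v) * f v \<partial>lborel)"
    unfolding inner by simp
  finally show ?thesis by simp
qed

definition weight_mass :: "'n::finite itself \<Rightarrow> nat \<Rightarrow> real" where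
  "weight_mass _ p = (\<integral>v. 1 / (1 + norm (v :: real^'n)) ^ p \<partial>lborel)"

lemma weight_mass_nonneg: "0 \<le> weight_mass TYPE('n::finite) p"
  unfolding weight_mass_def by (intro integral_nonneg_AE AE_I2) auto

lemma dilated_integral_measurable_bound:
  fixes f :: "real^'n::finite \<Rightarrow> real"
  assumes a: "signed_measure a" and m: "mass a \<le> K" and f: "f \<in> borel_measurable borel" "\<And>y. \<bar>f y\<bar> \<le> b"
  shows "\<bar>dilated_integral a x t f\<bar> \<le> K * b"
proof -
  note [measurable] = f(1)
  have "\<bar>dilated_integral a x t f\<bar> \<le> mass a * b"
    unfolding dilated_integral_def using f(2) by (intro signed_integral_bound[OF a]) auto
  also have "\<dots> \<le> K * b"
    using m order_trans[OF abs_ge_zero f(2)] by (rule mult_right_mono)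
  finally show ?thesis .
qed

lemma dilated_integral_smoothing_bounded:
  fixes a :: "'n::finite set_fun"
  assumes a: "signed_measure a" and m: "mass a \<le> K" and p: "CARD('n) + 2 \<le> p"
    and N: "0 \<le> N" and heat: "\<And>x t. 0 < t \<Longrightarrow> \<bar>t powr (\<gamma> / 2) * heat t a x\<bar> \<le> N"
    and t: "0 < t"
  shows "smoothing_bounded p \<gamma>
    ((4 * pi) powr (real CARD('n) / 2) * weight_mass TYPE('n) p / gauss_mass TYPE('n) * N * t powr (real CARD('n) - \<gamma>))
    K (dilated_integral a x t)"
  unfolding smoothing_bounded_def
proof (intro conjI allI impI)
  let ?d = "real CARD('n)"
  show "0 \<le> (4 * pi) powr (?d / 2) * weight_mass TYPE('n) p / gauss_mass TYPE('n) * N * t powr (?d - \<gamma>)"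
    using N weight_mass_nonneg[where 'n = 'n] gauss_mass_pos[where 'n = 'n] by (simp add: less_imp_le)
  show "0 \<le> K" using m mass_nonneg order_trans by blast
  show "\<bar>dilated_integral a x t f\<bar> \<le> K * b"
    if "f \<in> borel_measurable borel" "\<forall>y. \<bar>f y\<bar> \<le> b" for f b
    using that by (intro dilated_integral_measurable_bound[OF a m]) auto
  show "dilated_integral a x t (\<lambda>y. f y - h y) = dilated_integral a x t f - dilated_integral a x t h"
    if [measurable]: "f \<in> borel_measurable borel" "h \<in> borel_measurable borel"
      and "\<forall>y. \<bar>f y\<bar> \<le> b" "\<forall>y. \<bar>h y\<bar> \<le> b" for f h b
    unfolding dilated_integral_def using that(3,4) by (intro signed_integral_diff[OF a, of _ b _ b]) auto
  fix s b :: real and f :: "real^'n \<Rightarrow> real" assume s: "0 < s" "s \<le> 1" and f: "test_class p 0 b f"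
  note [measurable] = test_class_measurable[OF f]
  let ?r = "s * t"
  have r: "0 < ?r" using s t by simp
  have b: "0 \<le> b" using f by (rule test_class_nonneg)
  have hb: "\<bar>heat (?r\<^sup>2) a z\<bar> \<le> N * ?r powr (- \<gamma>)" for z
  proof -
    have "(?r\<^sup>2) powr (\<gamma> / 2) = ?r powr \<gamma>"
      using r by (simp add: powr_powr powr_realpow[symmetric] flip: powr_numeral)
    then have "?r powr \<gamma> * \<bar>heat (?r\<^sup>2) a z\<bar> \<le> N"
      using heat[of "?r\<^sup>2" z] s t by (simp add: abs_mult)
    then show ?thesis
      using s t by (simp add: powr_minus_divide pos_le_divide_eq mult.commute)
  qed
  have fd: "\<bar>f v\<bar> \<le> b * (1 / (1 + norm v) ^ p)" for v
  proof -
    have "0 < (1 + norm v) ^ p"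
      by (intro zero_less_power) (simp add: add_pos_nonneg)
    then show ?thesis
      using test_class_decay[OF f, of v] by (simp add: pos_le_divide_eq)
  qed
  have "\<bar>\<integral>v. heat (?r\<^sup>2) a (x - t *\<^sub>R v) * f v \<partial>lborel\<bar>
      \<le> (\<integral>v. (N * ?r powr (- \<gamma>) * b) * (1 / (1 + norm (v :: real^'n)) ^ p) \<partial>lborel)"
  proof -
    have i: "integrable lborel (\<lambda>v. (N * ?r powr (- \<gamma>) * b) * (1 / (1 + norm (v :: real^'n)) ^ p))"
      by (intro integrable_mult_right integrable_weight p)
    have le: "\<bar>heat (?r\<^sup>2) a (x - t *\<^sub>R v) * f v\<bar> \<le> (N * ?r powr (- \<gamma>) * b) * (1 / (1 + norm v) ^ p)" for v
    proof -
      have "\<bar>heat (?r\<^sup>2) a (x - t *\<^sub>R v)\<bar> * \<bar>f v\<bar> \<le> (N * ?r powr (- \<gamma>)) * (b * (1 / (1 + norm v) ^ p))"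
        using N by (intro mult_mono hb fd) auto
      then show ?thesis by (simp add: abs_mult mult.assoc)
    qed
    show ?thesis
      using b N by (intro order_trans[OF integral_abs_bound integral_mono'[OF i]] le) auto
  qed
  also have "\<dots> = (N * ?r powr (- \<gamma>) * b) * weight_mass TYPE('n) p"
    by (simp only: weight_mass_def integral_mult_right_zero)
  finally have I: "\<bar>\<integral>v. heat (?r\<^sup>2) a (x - t *\<^sub>R v) * f v \<partial>lborel\<bar> \<le> (N * ?r powr (- \<gamma>) * b) * weight_mass TYPE('n) p" .
  let ?c = "s powr (- ?d) * (4 * pi * ?r\<^sup>2) powr (?d / 2) / gauss_mass TYPE('n)"
  have c: "0 \<le> ?c" using gauss_mass_pos[where 'n = 'n] by (simp add: less_imp_le)
  have c2: "s powr (- ?d) * (4 * pi * ?r\<^sup>2) powr (?d / 2) = (4 * pi) powr (?d / 2) * t powr ?d"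
  proof -
    have "(?r\<^sup>2) powr (?d / 2) = ?r powr ?d"
      using r by (simp add: powr_powr flip: powr_numeral)
    moreover have "?r powr ?d = s powr ?d * t powr ?d"
      using s t by (simp add: powr_mult)
    ultimately have "(4 * pi * ?r\<^sup>2) powr (?d / 2) = (4 * pi) powr (?d / 2) * (s powr ?d * t powr ?d)"
      by (simp add: powr_mult)
    then show ?thesis
      using s by (simp add: powr_minus_divide)
  qed
  have "\<bar>dilated_integral a x t (gauss_avg s f)\<bar> = ?c * \<bar>\<integral>v. heat (?r\<^sup>2) a (x - t *\<^sub>R v) * f v \<partial>lborel\<bar>"
    by (simp only: dilated_integral_gauss_avg[OF a f p s(1) t] abs_mult[of ?c] abs_of_nonneg[OF c])
  also have "\<dots> \<le> ?c * ((N * ?r powr (- \<gamma>) * b) * weight_mass TYPE('n) p)"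
    using I c by (rule mult_left_mono)
  also have "?r powr (- \<gamma>) = s powr (- \<gamma>) * t powr (- \<gamma>)"
    using s t by (simp add: powr_mult)
  also have "?c * ((N * (s powr (- \<gamma>) * t powr (- \<gamma>)) * b) * weight_mass TYPE('n) p)
      = (4 * pi) powr (?d / 2) * weight_mass TYPE('n) p / gauss_mass TYPE('n) * N * (t powr ?d * t powr (- \<gamma>)) * s powr (- \<gamma>) * b"
    unfolding c2 by simp
  also have "t powr ?d * t powr (- \<gamma>) = t powr (?d - \<gamma>)"
    by (simp add: powr_add[symmetric])
  finally show "\<bar>dilated_integral a x t (gauss_avg s f)\<bar>
      \<le> (4 * pi) powr (?d / 2) * weight_mass TYPE('n) p / gauss_mass TYPE('n) * N * t powr (?d - \<gamma>) * s powr (- \<gamma>) * b" .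
qed

text \<open>The part of the definition of an atom that is used near its cube.\<close>

definition heat_bounded :: "real \<Rightarrow> 'n::finite set_fun \<Rightarrow> real \<Rightarrow> bool" where
  "heat_bounded \<beta> a l \<longleftrightarrow> signed_measure a \<and> mass a \<le> 2 \<and>
     (\<forall>x. \<forall>t>0. \<bar>t powr ((real CARD('n) - \<beta>) / 2) * heat t a x\<bar> \<le> l powr (- \<beta>))"

lemma atom_heat_bounded:
  fixes a :: "'n::finite set_fun"
  assumes "atom \<beta> a"
  obtains c l where "heat_bounded \<beta> a l" "0 < l"
    "supp a \<subseteq> cbox c (\<chi> i. c $ i + l)" "a (cbox c (\<chi> i. c $ i + l)) = 0"
  using assms mass_le_total_variation unfolding atom_def heat_bounded_def by blast

text \<open>Uses \<open>bound_from_gauss_averages\<close> with \<open>m = d\<close> and \<open>\<gamma> = d - \<beta>\<close>.\<close>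

lemma atom_near_bound:
  fixes \<beta> :: real
  assumes \<beta>: "0 < \<beta>" "\<beta> \<le> real CARD('n::finite)" and p: "CARD('n) + 2 \<le> p"
  obtains C where "0 < C"
    "\<And>(a :: 'n set_fun) l B x t g. heat_bounded \<beta> a l \<Longrightarrow> 0 < t \<Longrightarrow> test_class p CARD('n) B g \<Longrightarrow>
      t powr (- \<beta>) * \<bar>dilated_integral a x t g\<bar> \<le> C * B * l powr (- \<beta>)"
proof -
  obtain C1 where C1: "0 < C1" "\<And>(L :: (real^'n \<Rightarrow> real) \<Rightarrow> real) g B H K.
      smoothing_bounded p (real CARD('n) - \<beta>) H K L \<Longrightarrow> test_class p CARD('n) B g \<Longrightarrow> \<bar>L g\<bar> \<le> C1 * H * B"
    using bound_from_gauss_averages[of "real CARD('n) - \<beta>" "CARD('n)" p, where 'n = 'n] \<beta> by auto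
  define D where "D = (4 * pi) powr (real CARD('n) / 2) * weight_mass TYPE('n) p / gauss_mass TYPE('n)"
  have D: "0 \<le> D"
    using weight_mass_nonneg[where 'n = 'n] gauss_mass_pos[where 'n = 'n] by (simp add: D_def less_imp_le)
  have main: "t powr (- \<beta>) * \<bar>dilated_integral a x t g\<bar> \<le> (C1 * D + 1) * B * l powr (- \<beta>)"
    if ab: "heat_bounded \<beta> a l" and t: "0 < t" and g: "test_class p CARD('n) B g"
    for a :: "'n set_fun" and l B x t g
  proof -
    have a: "signed_measure a" "mass a \<le> 2"
      using ab by (auto simp: heat_bounded_def)
    have heat: "\<bar>t powr ((real CARD('n) - \<beta>) / 2) * heat t a x\<bar> \<le> l powr (- \<beta>)" if "0 < t" for x t
      using ab that by (simp add: heat_bounded_def)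
    have "smoothing_bounded p (real CARD('n) - \<beta>) (D * l powr (- \<beta>) * t powr \<beta>) 2 (dilated_integral a x t)"
      using dilated_integral_smoothing_bounded[OF a p _ heat t, of x] by (simp add: D_def)
    then have "\<bar>dilated_integral a x t g\<bar> \<le> C1 * (D * l powr (- \<beta>) * t powr \<beta>) * B"
      using g by (rule C1(2))
    then have "t powr (- \<beta>) * \<bar>dilated_integral a x t g\<bar> \<le> t powr (- \<beta>) * (C1 * (D * l powr (- \<beta>) * t powr \<beta>) * B)"
      by (intro mult_left_mono) auto
    also have "\<dots> = (t powr (- \<beta>) * t powr \<beta>) * (C1 * D * B * l powr (- \<beta>))"
      by (simp add: mult_ac)
    also have "t powr (- \<beta>) * t powr \<beta> = 1"
      using t by (simp add: powr_add[symmetric])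
    also have "1 * (C1 * D * B * l powr (- \<beta>)) \<le> (C1 * D + 1) * B * l powr (- \<beta>)"
      using test_class_nonneg[OF g] by (simp add: algebra_simps)
    finally show ?thesis .
  qed
  show thesis
    by (rule that[OF _ main]) (use C1 D in \<open>auto simp: add_nonneg_pos\<close>)
qed

lemma cube_corner_dist:
  fixes y c :: "real^'n::finite"
  assumes "y \<in> cbox c (\<chi> i. c $ i + l)"
  shows "norm (y - c) \<le> real CARD('n) * l"
proof -
  have "norm (y - c) \<le> (\<Sum>i\<in>UNIV. \<bar>(y - c) $ i\<bar>)"
    by (rule norm_le_l1_cart)
  also have "\<dots> \<le> (\<Sum>i\<in>(UNIV::'n set). l)"
  proof (rule sum_mono)
    fix i
    have "c $ i \<le> y $ i" "y $ i \<le> c $ i + l"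
      using assms by (auto simp: mem_box_cart)
    then show "\<bar>(y - c) $ i\<bar> \<le> l" by simp
  qed
  finally show ?thesis by simp
qed

text \<open>Since \<open>\<beta> + 1 \<le> p\<close>, the decay of order \<open>p\<close> may be weakened to the homogeneous decay of order \<open>\<beta> + 1\<close>.\<close>

lemma weight_decay:
  fixes \<rho> t \<beta> :: real
  assumes "0 < t" "0 < \<rho>" "0 < \<beta>" "\<beta> + 1 \<le> real p"
  shows "t powr (- \<beta>) / (1 + \<rho> / t) ^ p \<le> t * \<rho> powr (- \<beta> - 1)"
proof -
  have "(\<rho> / t) powr (\<beta> + 1) \<le> (1 + \<rho> / t) powr (\<beta> + 1)"
    using assms by (intro powr_mono2) auto
  also have "\<dots> \<le> (1 + \<rho> / t) powr (real p)"
    using assms by (intro powr_mono) auto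
  also have "\<dots> = (1 + \<rho> / t) ^ p"
    using assms by (intro powr_realpow) (simp add: add_pos_pos)
  finally have "t powr (- \<beta>) / (1 + \<rho> / t) ^ p \<le> t powr (- \<beta>) / (\<rho> / t) powr (\<beta> + 1)"
    using assms by (intro divide_left_mono mult_pos_pos) (auto simp: add_pos_pos)
  also have "\<dots> = t powr (- \<beta>) * t powr (\<beta> + 1) * \<rho> powr (- (\<beta> + 1))"
  proof -
    define e where "e = \<beta> + 1"
    show ?thesis
      using assms unfolding e_def[symmetric] by (simp add: powr_divide powr_minus_divide)
  qed
  also have "t powr (- \<beta>) * t powr (\<beta> + 1) = t"
    using assms by (simp add: powr_add[symmetric])
  finally show ?thesis by simp
qed

text \<open>For \<open>t \<ge> l\<close> subtract the value at the corner of the cube, which costs nothing because the atom has integral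
zero; the first difference of \<open>g\<close> then gains \<open>l / t\<close>. For \<open>t < l\<close> the decay of \<open>g\<close> alone suffices, with
\<open>t\<close> in the place of \<open>l\<close>.\<close>

lemma atom_far_bound:
  fixes a :: "'n::finite set_fun" and c x :: "real^'n"
  assumes \<beta>: "0 < \<beta>" "\<beta> \<le> real CARD('n)" and p: "CARD('n) + 2 \<le> p"
    and a: "signed_measure a" "mass a \<le> 2" and l: "0 < l"
    and supp: "supp a \<subseteq> cbox c (\<chi> i. c $ i + l)" and zero: "a (cbox c (\<chi> i. c $ i + l)) = 0"
    and t: "0 < t" and g: "test_class p 1 B g" and far: "2 * real CARD('n) * l \<le> norm (x - c)"
  shows "t powr (- \<beta>) * \<bar>dilated_integral a x t g\<bar>
    \<le> 2 ^ (p + 1) * real CARD('n) ^ 2 * (1 + real CARD('n)) ^ p * B * l * norm (x - c) powr (- \<beta> - 1)"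
proof -
  let ?d = "real CARD('n)"
  let ?Q = "cbox c (\<chi> i. c $ i + l)"
  define \<rho> where "\<rho> = norm (x - c)"
  note [measurable] = test_class_measurable[OF g]
  have B: "0 \<le> B" using g by (rule test_class_nonneg)
  have d: "1 \<le> ?d" by simp
  have \<rho>: "0 < \<rho>" using far l d unfolding \<rho>_def by (smt (verit) mult_pos_pos)
  have \<beta>p: "\<beta> + 1 \<le> real p" using \<beta> p by linarith
  define f where "f y = g ((1 / t) *\<^sub>R (x - y))" for y
  have [measurable]: "f \<in> borel_measurable borel" unfolding f_def by measurable
  have local_bound: "\<bar>dilated_integral a x t g\<bar> \<le> 2 * b"
    if b: "\<And>y. y \<in> ?Q \<Longrightarrow> \<bar>f y - r\<bar> \<le> b" and b0: "0 \<le> b" for r b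
  proof -
    have fb: "\<bar>f y\<bar> \<le> B" for y unfolding f_def by (rule test_class_bounded[OF g])
    have QB[measurable]: "?Q \<in> sets borel" by simp
    have "signed_integral a (\<lambda>y. f y - r * indicator ?Q y) = signed_integral a f - signed_integral a (\<lambda>y. r * indicator ?Q y)"
      using fb by (intro signed_integral_diff[OF a(1), of _ B _ "\<bar>r\<bar>"]) (auto simp: indicator_def)
    also have "signed_integral a (\<lambda>y. r * indicator ?Q y) = 0"
      by (simp only: signed_integral_mult_right signed_integral_indicator[OF a(1) QB] zero mult_zero_right)
    finally have "signed_integral a f = signed_integral a (\<lambda>y. f y - r * indicator ?Q y)" by simp
    also have "\<dots> = signed_integral a (\<lambda>y. (f y - r) * indicator ?Q y)"
      by (intro signed_integral_cong_supp[OF a(1) supp]) (auto simp: closed_cbox)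
    finally have "\<bar>signed_integral a f\<bar> \<le> mass a * b"
      using b b0 signed_integral_bound[OF a(1), of "\<lambda>y. (f y - r) * indicator ?Q y" b]
      by (auto simp: indicator_def)
    also have "\<dots> \<le> 2 * b" using a(2) b0 by (rule mult_right_mono)
    finally show ?thesis by (simp only: dilated_integral_def f_def[abs_def])
  qed
  show ?thesis
  proof (cases "l \<le> t")
    case True
    define b where "b = B * (?d * (?d * (l / t)) * (1 + ?d) ^ p) / (1 + \<rho> / t) ^ p"
    have b0: "0 \<le> b" using B l t \<rho> by (simp add: b_def)
    have "\<bar>f y - f c\<bar> \<le> b" if y: "y \<in> ?Q" for y
    proof -
      define u z where "u = (1 / t) *\<^sub>R (x - c)" and "z = (1 / t) *\<^sub>R (y - c)"
      have uz: "f c = g u" "f y = g (u - z)"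
        by (simp_all add: f_def u_def z_def algebra_simps)
      have nz: "norm z \<le> ?d * (l / t)"
        using cube_corner_dist[OF y] t by (simp add: z_def divide_right_mono)
      have nz1: "norm z \<le> ?d"
        using nz True t d by (smt (verit) divide_le_eq_1_pos mult_left_le)
      have nu: "norm u = \<rho> / t" using t by (simp add: u_def \<rho>_def)
      have "\<bar>g u - g (u - z)\<bar> * (1 + norm u) ^ p \<le> B * diff_weight p z"
        using g unfolding One_nat_def by (rule test_class_decay[OF test_class_SucD])
      also have "\<dots> \<le> B * (?d * (?d * (l / t)) * (1 + ?d) ^ p)"
        unfolding diff_weight_def using nz nz1 B l t by (intro mult_left_mono mult_mono power_mono) auto
      finally have "\<bar>g u - g (u - z)\<bar> * (1 + \<rho> / t) ^ p \<le> B * (?d * (?d * (l / t)) * (1 + ?d) ^ p)"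
        unfolding nu .
      moreover have "0 < (1 + \<rho> / t) ^ p"
        using \<rho> t by (intro zero_less_power) (simp add: add_pos_pos)
      ultimately have "\<bar>g u - g (u - z)\<bar> \<le> b"
        by (simp only: b_def pos_le_divide_eq)
      then show ?thesis by (simp add: uz abs_minus_commute)
    qed
    then have "\<bar>dilated_integral a x t g\<bar> \<le> 2 * b"
      using b0 by (rule local_bound)
    then have "t powr (- \<beta>) * \<bar>dilated_integral a x t g\<bar> \<le> t powr (- \<beta>) * (2 * b)"
      by (intro mult_left_mono) auto
    also have "\<dots> = (2 * B * ?d ^ 2 * (1 + ?d) ^ p * (l / t)) * (t powr (- \<beta>) / (1 + \<rho> / t) ^ p)"
      by (simp add: b_def power2_eq_square mult_ac)
    also have "\<dots> \<le> (2 * B * ?d ^ 2 * (1 + ?d) ^ p * (l / t)) * (t * \<rho> powr (- \<beta> - 1))"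
      using B l t by (intro mult_left_mono weight_decay \<rho> \<beta>(1) \<beta>p) auto
    also have "\<dots> = 2 * (?d ^ 2 * (1 + ?d) ^ p * B * l * \<rho> powr (- \<beta> - 1))"
      using t by (simp add: mult_ac)
    also have "\<dots> \<le> 2 ^ (p + 1) * (?d ^ 2 * (1 + ?d) ^ p * B * l * \<rho> powr (- \<beta> - 1))"
      using B l power_increasing[of 1 "p + 1" "2::real"] by (intro mult_right_mono) auto
    finally show ?thesis by (simp add: \<rho>_def mult_ac)
  next
    case False
    define b where "b = B * 2 ^ p / (1 + \<rho> / t) ^ p"
    have b0: "0 \<le> b" using B t \<rho> by (simp add: b_def)
    have "\<bar>f y - 0\<bar> \<le> b" if y: "y \<in> ?Q" for y
    proof -
      define u where "u = (1 / t) *\<^sub>R (x - y)"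
      have "\<rho> \<le> norm (x - y) + norm (y - c)"
        using norm_triangle_ineq[of "x - y" "y - c"] by (simp add: \<rho>_def)
      then have "\<rho> \<le> 2 * norm (x - y)"
        using cube_corner_dist[OF y] far by (simp add: \<rho>_def)
      then have "\<rho> / t \<le> 2 * norm u"
      proof -
        have "norm u = norm (x - y) / t" using t unfolding u_def by simp
        then show ?thesis using \<open>\<rho> \<le> 2 * norm (x - y)\<close> t by (simp add: divide_right_mono)
      qed
      then have "(1 + \<rho> / t) ^ p \<le> (2 * (1 + norm u)) ^ p"
        using \<rho> t by (intro power_mono) auto
      then have "\<bar>g u\<bar> * (1 + \<rho> / t) ^ p \<le> \<bar>g u\<bar> * (2 ^ p * (1 + norm u) ^ p)"
        unfolding power_mult_distrib by (rule mult_left_mono) simp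
      also have "\<dots> = (\<bar>g u\<bar> * (1 + norm u) ^ p) * 2 ^ p"
        by (simp add: mult_ac)
      also have "\<dots> \<le> B * 2 ^ p"
        by (intro mult_right_mono test_class_decay[OF g]) auto
      finally have "\<bar>g u\<bar> \<le> b"
        using \<rho> t by (simp add: b_def pos_le_divide_eq add_pos_pos)
      then show ?thesis by (simp add: f_def u_def)
    qed
    then have "\<bar>dilated_integral a x t g\<bar> \<le> 2 * b"
      using b0 by (rule local_bound)
    then have "t powr (- \<beta>) * \<bar>dilated_integral a x t g\<bar> \<le> t powr (- \<beta>) * (2 * b)"
      by (intro mult_left_mono) auto
    also have "\<dots> = (2 ^ (p + 1) * B) * (t powr (- \<beta>) / (1 + \<rho> / t) ^ p)"
      by (simp add: b_def)
    also have "\<dots> \<le> (2 ^ (p + 1) * B) * (t * \<rho> powr (- \<beta> - 1))"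
      using B t by (intro mult_left_mono weight_decay \<rho> \<beta>(1) \<beta>p) auto
    also have "\<dots> \<le> (2 ^ (p + 1) * B) * (l * \<rho> powr (- \<beta> - 1))"
      using B False by (intro mult_left_mono mult_right_mono) auto
    also have "\<dots> = 1 * (2 ^ (p + 1) * B * l * \<rho> powr (- \<beta> - 1))"
      by simp
    also have "\<dots> \<le> (?d ^ 2 * (1 + ?d) ^ p) * (2 ^ (p + 1) * B * l * \<rho> powr (- \<beta> - 1))"
    proof (rule mult_right_mono)
      have "1 * 1 \<le> ?d ^ 2 * (1 + ?d) ^ p"
        using d by (intro mult_mono one_le_power) auto
      then show "1 \<le> ?d ^ 2 * (1 + ?d) ^ p" by simp
    qed (use B l in auto)
    finally show ?thesis by (simp add: \<rho>_def mult_ac)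
  qed
qed

section \<open>Dyadic majorants of atoms\<close>

lemma finite_int_box: "finite {v :: int^'n::finite. \<forall>i. \<bar>v $ i\<bar> \<le> N}"
proof -
  have "{v :: int^'n. \<forall>i. \<bar>v $ i\<bar> \<le> N} \<subseteq> vec_lambda ` (PiE UNIV (\<lambda>_. {- N..N}))"
  proof
    fix v :: "int^'n" assume "v \<in> {v. \<forall>i. \<bar>v $ i\<bar> \<le> N}"
    then have "vec_nth v \<in> PiE UNIV (\<lambda>_. {- N..N})" by (auto simp: abs_le_iff minus_le_iff)
    moreover have "v = vec_lambda (vec_nth v)" by simp
    ultimately show "v \<in> vec_lambda ` (PiE UNIV (\<lambda>_. {- N..N}))" by blast
  qed
  then show ?thesis
    by (rule finite_subset) (intro finite_imageI finite_PiE, auto)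
qed

text \<open>Sums of weighted indicators of dyadic cubes whose Choquet integral is at most \<open>C\<close> by
\<open>dchoquet_weighted_cubes\<close>. The index type is large enough to hold, at each of finitely many scales, the
neighbours of one cube.\<close>

definition cube_sum :: "real \<Rightarrow> real \<Rightarrow> (real^'n::finite \<Rightarrow> real) \<Rightarrow> bool" where
  "cube_sum \<beta> C h \<longleftrightarrow>
     (\<exists>(I :: (nat \<times> (int^'n)) set) w (Q :: nat \<times> (int^'n) \<Rightarrow> int \<times> (int^'n)).
        finite I \<and> (\<forall>i\<in>I. 0 \<le> w i) \<and> (\<Sum>i\<in>I. w i * side (Q i) powr \<beta>) \<le> C \<and>
        h = (\<lambda>x. \<Sum>i\<in>I. w i * indicator (cube (Q i)) x))"

lemma dchoquet_combination_of_cube_sums: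
  fixes h :: "'k \<Rightarrow> real^'n::finite \<Rightarrow> real"
  assumes K: "finite K" and h: "\<And>k. k \<in> K \<Longrightarrow> cube_sum \<beta> C (h k)" and c: "\<And>k. k \<in> K \<Longrightarrow> 0 \<le> c k"
  shows "dchoquet \<beta> (\<lambda>x. \<Sum>k\<in>K. c k * h k x) \<le> ennreal (\<Sum>k\<in>K. c k * C)"
proof -
  have "\<forall>k\<in>K. \<exists>(I :: (nat \<times> (int^'n)) set) w (Q :: nat \<times> (int^'n) \<Rightarrow> int \<times> (int^'n)).
      finite I \<and> (\<forall>i\<in>I. 0 \<le> w i) \<and> (\<Sum>i\<in>I. w i * side (Q i) powr \<beta>) \<le> C \<and>
      h k = (\<lambda>x. \<Sum>i\<in>I. w i * indicator (cube (Q i)) x)"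
    using h unfolding cube_sum_def by blast
  then obtain I :: "'k \<Rightarrow> (nat \<times> (int^'n)) set" and w and Q :: "'k \<Rightarrow> nat \<times> (int^'n) \<Rightarrow> int \<times> (int^'n)"
    where I: "\<forall>k\<in>K. finite (I k) \<and> (\<forall>i\<in>I k. 0 \<le> w k i) \<and> (\<Sum>i\<in>I k. w k i * side (Q k i) powr \<beta>) \<le> C \<and>
      h k = (\<lambda>x. \<Sum>i\<in>I k. w k i * indicator (cube (Q k i)) x)"
    unfolding bchoice_iff by blast
  define J where "J = (SIGMA k:K. I k)"
  define e where "e j = c (fst j) * w (fst j) (snd j)" for j
  define q where "q j = Q (fst j) (snd j)" for j
  have J: "finite J" "\<And>j. j \<in> J \<Longrightarrow> 0 \<le> e j"
    using K I c by (auto simp: J_def e_def)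
  have sumJ: "(\<Sum>j\<in>J. e j * H (q j)) = (\<Sum>k\<in>K. c k * (\<Sum>i\<in>I k. w k i * H (Q k i)))" for H :: "int \<times> (int^'n) \<Rightarrow> real"
  proof -
    have "(\<Sum>k\<in>K. c k * (\<Sum>i\<in>I k. w k i * H (Q k i))) = (\<Sum>k\<in>K. \<Sum>i\<in>I k. (c k * w k i) * H (Q k i))"
      by (simp only: sum_distrib_left mult.assoc)
    also have "\<dots> = (\<Sum>(k, i)\<in>J. (c k * w k i) * H (Q k i))"
      unfolding J_def using K I by (intro sum.Sigma) auto
    finally show ?thesis by (simp add: e_def q_def case_prod_unfold)
  qed
  have "(\<lambda>x. \<Sum>k\<in>K. c k * h k x) = (\<lambda>x. \<Sum>j\<in>J. e j * indicator (cube (q j)) x)"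
  proof
    fix x
    have "(\<Sum>k\<in>K. c k * h k x) = (\<Sum>k\<in>K. c k * (\<Sum>i\<in>I k. w k i * indicator (cube (Q k i)) x))"
      using I by (intro sum.cong refl arg_cong2[where f = "(*)"]) simp
    then show "(\<Sum>k\<in>K. c k * h k x) = (\<Sum>j\<in>J. e j * indicator (cube (q j)) x)"
      by (simp only: sumJ[of "\<lambda>q. indicator (cube q) x"])
  qed
  then have "dchoquet \<beta> (\<lambda>x. \<Sum>k\<in>K. c k * h k x) \<le> ennreal (\<Sum>j\<in>J. e j * side (q j) powr \<beta>)"
    using dchoquet_weighted_cubes[where \<beta> = \<beta> and Q = q, OF J] by (simp only:)
  also have "(\<Sum>j\<in>J. e j * side (q j) powr \<beta>) = (\<Sum>k\<in>K. c k * (\<Sum>i\<in>I k. w k i * side (Q k i) powr \<beta>))"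
    by (rule sumJ)
  also have "ennreal \<dots> \<le> ennreal (\<Sum>k\<in>K. c k * C)"
    using I c by (intro ennreal_leI sum_mono mult_left_mono) auto
  finally show ?thesis .
qed

text \<open>At a point whose distance from \<open>c\<close> is comparable to \<open>2 ^ k * l\<close> the two bounds give about
\<open>2 ^ (- k) * (2 ^ k * l) powr (- \<beta>)\<close>. So put this weight on each of the boundedly many dyadic cubes of side
comparable to \<open>2 ^ k * l\<close> that meet the corresponding ball around \<open>c\<close>; the costs then form a geometric
series. Restricting to \<open>norm x \<le> R\<close> keeps the number of scales finite, with a bound independent of \<open>R\<close>.\<close>

lemma cube_sum_majorant:
  fixes c :: "real^'n::finite" and \<beta> A l R :: real
  assumes \<beta>: "0 < \<beta>" and l: "0 < l" and A: "0 \<le> A"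
  shows "\<exists>h. cube_sum \<beta> (2 powr (\<beta> + 1) * real (card {v :: int^'n. \<forall>i. \<bar>v $ i\<bar> \<le> 2 * int CARD('n) + 1}) * A) h \<and>
    (\<forall>x r. norm x \<le> R \<longrightarrow> r \<le> A * l powr (- \<beta>) \<longrightarrow>
       (2 * real CARD('n) * l \<le> norm (x - c) \<longrightarrow> r \<le> A * l * norm (x - c) powr (- \<beta> - 1)) \<longrightarrow> r \<le> h x)"
proof -
  let ?d = "real CARD('n)"
  have d: "1 \<le> ?d" by simp
  define V where "V = {v :: int^'n. \<forall>i. \<bar>v $ i\<bar> \<le> 2 * int CARD('n) + 1}"
  (* the dyadic side s 0 lies between l and 2 * l *)
  define j0 where "j0 = \<lfloor>- log 2 l\<rfloor>"
  define s where "s k = 2 powr (- real_of_int (j0 - int k))" for k :: nat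
  have s: "0 < s k" for k by (simp add: s_def)
  have s_Suc: "s (Suc k) = 2 * s k" for k
  proof -
    have "s (Suc k) = 2 powr (1 + (- real_of_int (j0 - int k)))"
      unfolding s_def by (rule arg_cong[where f = "\<lambda>x. 2 powr x"]) simp
    then show ?thesis unfolding s_def powr_add by simp
  qed
  have s_pow: "s k = 2 ^ k * s 0" for k
    by (induction k) (simp_all add: s_Suc)
  have ls: "l \<le> s 0" "s 0 \<le> 2 * l"
  proof -
    have l2: "l = 2 powr (log 2 l)" using l by simp
    have "2 powr (log 2 l) \<le> s 0"
      unfolding s_def j0_def by (intro powr_mono) (simp_all, linarith)
    then show "l \<le> s 0" using l2 by simp
    have "s 0 \<le> 2 powr (1 + log 2 l)"
      unfolding s_def j0_def by (intro powr_mono) (simp_all, linarith)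
    then show "s 0 \<le> 2 * l" using l by (simp add: powr_add)
  qed
  have V: "finite V" unfolding V_def by (rule finite_int_box)
  (* every x of norm at most R is within the distance 2 * d * s K from c *)
  obtain K where K: "R + norm c < 2 * ?d * s K"
  proof -
    obtain K where "(R + norm c) / (2 * ?d * s 0) < 2 ^ K"
      using real_arch_pow[of 2 "(R + norm c) / (2 * ?d * s 0)"] by auto
    then have "R + norm c < 2 ^ K * (2 * ?d * s 0)"
      using s[of 0] by (simp add: pos_divide_less_eq)
    then show thesis using that[of K] s_pow[of K] by (simp add: mult_ac)
  qed
  define Q where "Q i = (j0 - int (fst i), snd (cube_at (j0 - int (fst i)) c) + snd i)" for i :: "nat \<times> (int^'n)"
  define w where "w i = A * 2 powr \<beta> * (1 / 2) ^ fst i * s (fst i) powr (- \<beta>)" for i :: "nat \<times> (int^'n)"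
  define I where "I = {..K} \<times> V"
  have sideQ: "side (Q i) = s (fst i)" for i by (simp add: side_def Q_def s_def)
  define h where "h x = (\<Sum>i\<in>I. w i * indicator (cube (Q i)) x)" for x
  have "finite I" using V by (simp add: I_def)
  have w0: "0 \<le> w i" for i using A by (simp add: w_def)
  have "cube_sum \<beta> (2 powr (\<beta> + 1) * real (card V) * A) h"
  proof -
    have "(\<Sum>i\<in>I. w i * side (Q i) powr \<beta>) = (\<Sum>i\<in>I. A * 2 powr \<beta> * (1 / 2) ^ fst i)"
    proof (rule sum.cong[OF refl])
      fix i :: "nat \<times> (int^'n)"
      have "s (fst i) powr (- \<beta>) * s (fst i) powr \<beta> = 1"
        using s by (simp add: powr_add[symmetric] less_imp_neq[symmetric])
      then show "w i * side (Q i) powr \<beta> = A * 2 powr \<beta> * (1 / 2) ^ fst i"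
        by (simp add: w_def sideQ mult.assoc)
    qed
    also have "\<dots> = (\<Sum>k\<le>K. \<Sum>v\<in>V. A * 2 powr \<beta> * (1 / 2) ^ k)"
      unfolding I_def by (subst sum.cartesian_product) (simp add: case_prod_beta)
    also have "\<dots> = A * 2 powr \<beta> * real (card V) * (\<Sum>k\<le>K. (1 / 2) ^ k)"
      by (simp add: sum_distrib_left mult_ac)
    also have "\<dots> \<le> A * 2 powr \<beta> * real (card V) * 2"
    proof (rule mult_left_mono)
      show "(\<Sum>k\<le>K. (1 / 2 :: real) ^ k) \<le> 2"
        unfolding lessThan_Suc_atMost[symmetric] by (simp add: geometric_sum)
    qed (use A in auto)
    also have "\<dots> = 2 powr (\<beta> + 1) * real (card V) * A"
      by (simp add: powr_add mult_ac)
    finally show ?thesis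
      unfolding cube_sum_def h_def[abs_def] using \<open>finite I\<close> w0
      by (intro exI[of _ I] exI[of _ w] exI[of _ Q] conjI) auto
  qed
  moreover have "r \<le> h x"
    if x: "norm x \<le> R" and near: "r \<le> A * l powr (- \<beta>)"
      and far: "2 * ?d * l \<le> norm (x - c) \<longrightarrow> r \<le> A * l * norm (x - c) powr (- \<beta> - 1)" for x r
  proof -
    define P where "P k \<longleftrightarrow> norm (x - c) \<le> 2 * ?d * s k" for k
    have "P K"
      using norm_triangle_ineq4[of x c] x K by (simp add: P_def)
    (* the first scale at which x is seen; at the previous one x is still far, which activates the far bound *)
    define k where "k = (LEAST k. P k)"
    have k: "P k" "k \<le> K"
      unfolding k_def using \<open>P K\<close> by (auto intro: LeastI Least_le)
    have rk: "r \<le> A * 2 powr \<beta> * (1 / 2) ^ k * s k powr (- \<beta>)"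
    proof (cases k)
      case 0
      have "l powr (- \<beta>) \<le> (s 0 / 2) powr (- \<beta>)"
        using ls s[of 0] \<beta> by (intro powr_mono2') auto
      also have "\<dots> = 2 powr \<beta> * s 0 powr (- \<beta>)"
        using s[of 0] by (simp add: powr_divide powr_minus_divide)
      finally have "A * l powr (- \<beta>) \<le> A * (2 powr \<beta> * s 0 powr (- \<beta>))"
        using A by (rule mult_left_mono)
      then show ?thesis using near 0 by simp
    next
      case (Suc m)
      have "\<not> P m"
        using not_less_Least[of m P] Suc by (simp add: k_def)
      then have n: "?d * s k \<le> norm (x - c)"
        by (simp add: P_def Suc s_Suc)
      have "l \<le> s m"
      proof -
        have "1 * s 0 \<le> 2 ^ m * s 0"
          using s[of 0] by (intro mult_right_mono) auto
        then show ?thesis using ls(1) s_pow[of m] by simp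
      qed
      then have "2 * ?d * l \<le> ?d * s k"
        using d by (simp add: Suc s_Suc)
      then have "r \<le> A * l * norm (x - c) powr (- \<beta> - 1)"
        using n by (intro far[rule_format]) linarith
      also have "\<dots> \<le> A * l * s k powr (- \<beta> - 1)"
      proof (rule mult_left_mono)
        have "1 * s k \<le> ?d * s k" using d s[of k] by (intro mult_right_mono) auto
        then have "s k \<le> norm (x - c)" using n by linarith
        then show "norm (x - c) powr (- \<beta> - 1) \<le> s k powr (- \<beta> - 1)"
          using s[of k] \<beta> by (intro powr_mono2') auto
      qed (use A l in auto)
      also have "\<dots> \<le> A * s 0 * s k powr (- \<beta> - 1)"
        using A ls by (intro mult_right_mono mult_left_mono) auto
      also have "\<dots> = A * (s 0 * (1 / s k)) * s k powr (- \<beta>)"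
        using s[of k] by (simp add: powr_diff)
      also have "s 0 * (1 / s k) = (1 / 2) ^ k"
        using s[of 0] by (simp add: s_pow[of k] power_one_over)
      also have "A * (1 / 2) ^ k * s k powr (- \<beta>) \<le> 2 powr \<beta> * (A * (1 / 2) ^ k * s k powr (- \<beta>))"
        using A \<beta> ge_one_powr_ge_zero[of 2 \<beta>] mult_right_mono[of 1 "2 powr \<beta>" "A * (1 / 2) ^ k * s k powr (- \<beta>)"] by simp
      finally show ?thesis by (simp add: mult_ac)
    qed
    define j where "j = j0 - int k"
    define v where "v = snd (cube_at j x) - snd (cube_at j c)"
    have js: "2 powr real_of_int j = 1 / s k"
    proof -
      have "s k = 2 powr (- real_of_int j)" by (simp add: s_def j_def)
      then show ?thesis by (simp add: powr_minus_divide)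
    qed
    have "\<bar>v $ i\<bar> \<le> 2 * int CARD('n) + 1" for i
    proof -
      have "\<bar>x $ i - c $ i\<bar> \<le> 2 * ?d * s k"
        using component_le_norm_cart[of "x - c" i] k(1) by (simp add: P_def)
      then have "\<bar>x $ i / s k - c $ i / s k\<bar> \<le> 2 * ?d"
        using s[of k] by (simp add: diff_divide_distrib[symmetric] pos_divide_le_eq)
      moreover have "v $ i = \<lfloor>x $ i / s k\<rfloor> - \<lfloor>c $ i / s k\<rfloor>"
        by (simp add: v_def cube_at_def js)
      ultimately show ?thesis by linarith
    qed
    then have ki: "(k, v) \<in> I" using k(2) by (simp add: I_def V_def)
    have "Q (k, v) = cube_at j x"
      unfolding Q_def v_def by (simp add: j_def prod_eq_iff)
    then have xQ: "x \<in> cube (Q (k, v))" by simp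
    have "r \<le> w (k, v) * indicator (cube (Q (k, v))) x"
      using rk xQ by (simp add: w_def)
    also have "\<dots> \<le> (\<Sum>i\<in>I. w i * indicator (cube (Q i)) x)"
      using ki w0 \<open>finite I\<close> by (intro member_le_sum[where f = "\<lambda>i. w i * indicator (cube (Q i)) x"]) (auto intro: mult_nonneg_nonneg)
    finally show "r \<le> h x" unfolding h_def .
  qed
  ultimately show ?thesis
    unfolding V_def by blast
qed

lemma cube_sum_mono:
  fixes h :: "real^'n::finite \<Rightarrow> real"
  assumes h: "cube_sum \<beta> C h" and "C \<le> D"
  shows "cube_sum \<beta> D h"
proof -
  from h obtain I :: "(nat \<times> (int^'n)) set" and w and Q :: "nat \<times> (int^'n) \<Rightarrow> int \<times> (int^'n)"
    where *: "finite I" "\<forall>i\<in>I. 0 \<le> w i"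
    and le: "(\<Sum>i\<in>I. w i * side (Q i) powr \<beta>) \<le> C" and eq: "h = (\<lambda>x. \<Sum>i\<in>I. w i * indicator (cube (Q i)) x)"
    unfolding cube_sum_def by blast
  show ?thesis
    unfolding cube_sum_def
    by (intro exI[of _ I] exI[of _ w] exI[of _ Q] conjI * eq order_trans[OF le assms(2)])
qed

text \<open>The class bound \<open>2 ^ p\<close> is the one that \<open>schwartz_test_class\<close> provides for shifted Schwartz functions.\<close>

lemma atom_majorant:
  fixes \<beta> :: real
  assumes \<beta>: "0 < \<beta>" "\<beta> \<le> real CARD('n::finite)" and p: "CARD('n) + 2 \<le> p"
  obtains C where "0 < C"
    "\<And>(a :: 'n set_fun) R. atom \<beta> a \<Longrightarrow>
      \<exists>h. cube_sum \<beta> C h \<and>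
        (\<forall>x t g. norm x \<le> R \<longrightarrow> 0 < t \<longrightarrow> test_class p CARD('n) (2 ^ p) g \<longrightarrow>
          t powr (- \<beta>) * \<bar>dilated_integral a x t g\<bar> \<le> h x)"
proof -
  obtain C1 where C1: "0 < C1"
    "\<And>(a :: 'n set_fun) l B x t g. heat_bounded \<beta> a l \<Longrightarrow> 0 < t \<Longrightarrow> test_class p CARD('n) B g \<Longrightarrow>
      t powr (- \<beta>) * \<bar>dilated_integral a x t g\<bar> \<le> C1 * B * l powr (- \<beta>)"
    using atom_near_bound[OF \<beta> p] by blast
  define C2 where "C2 = 2 ^ (p + 1) * real CARD('n) ^ 2 * (1 + real CARD('n)) ^ p"
  have C2: "0 \<le> C2" by (simp add: C2_def)
  define A where "A = (C1 + C2) * 2 ^ p"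
  have A: "0 \<le> A" using C1(1) C2 by (simp add: A_def)
  define V where "V = {v :: int^'n. \<forall>i. \<bar>v $ i\<bar> \<le> 2 * int CARD('n) + 1}"
  define C where "C = 2 powr (\<beta> + 1) * real (card V) * A + 1"
  have "0 < C" using A by (simp add: C_def add_nonneg_pos)
  moreover have "\<exists>h. cube_sum \<beta> C h \<and>
        (\<forall>x t g. norm x \<le> R \<longrightarrow> 0 < t \<longrightarrow> test_class p CARD('n) (2 ^ p) g \<longrightarrow>
          t powr (- \<beta>) * \<bar>dilated_integral a x t g\<bar> \<le> h x)"
    if at: "atom \<beta> a" for a :: "'n set_fun" and R
  proof -
    obtain c l where heat: "heat_bounded \<beta> a l" and l: "0 < l"
      and supp: "supp a \<subseteq> cbox c (\<chi> i. c $ i + l)" and zero: "a (cbox c (\<chi> i. c $ i + l)) = 0"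
      using atom_heat_bounded[OF at] by blast
    then have a: "signed_measure a" "mass a \<le> 2" by (auto simp: heat_bounded_def)
    obtain h where h: "cube_sum \<beta> (2 powr (\<beta> + 1) * real (card V) * A) h"
      and maj: "\<And>x r. norm x \<le> R \<Longrightarrow> r \<le> A * l powr (- \<beta>) \<Longrightarrow>
       (2 * real CARD('n) * l \<le> norm (x - c) \<longrightarrow> r \<le> A * l * norm (x - c) powr (- \<beta> - 1)) \<Longrightarrow> r \<le> h x"
      using cube_sum_majorant[OF \<beta>(1) l A, of R c] unfolding V_def[symmetric] by blast
    have "t powr (- \<beta>) * \<bar>dilated_integral a x t g\<bar> \<le> h x"
      if x: "norm x \<le> R" and t: "0 < t" and g: "test_class p CARD('n) (2 ^ p) g" for x t g
    proof (rule maj[OF x _ impI])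
      have "t powr (- \<beta>) * \<bar>dilated_integral a x t g\<bar> \<le> C1 * 2 ^ p * l powr (- \<beta>)"
        by (rule C1(2)[OF heat t g])
      also have "\<dots> \<le> A * l powr (- \<beta>)"
        using C2 by (intro mult_right_mono) (auto simp: A_def)
      finally show "t powr (- \<beta>) * \<bar>dilated_integral a x t g\<bar> \<le> A * l powr (- \<beta>)" .
      assume far: "2 * real CARD('n) * l \<le> norm (x - c)"
      have g1: "test_class p 1 (2 ^ p) g"
        using g by (rule test_class_down) (simp add: Suc_leI)
      have "t powr (- \<beta>) * \<bar>dilated_integral a x t g\<bar> \<le> C2 * 2 ^ p * l * norm (x - c) powr (- \<beta> - 1)"
        using atom_far_bound[OF \<beta> p a l supp zero t g1 far] by (simp only: C2_def)
      also have "\<dots> \<le> A * l * norm (x - c) powr (- \<beta> - 1)"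
        using C1(1) l by (intro mult_right_mono) (auto simp: A_def)
      finally show "t powr (- \<beta>) * \<bar>dilated_integral a x t g\<bar> \<le> A * l * norm (x - c) powr (- \<beta> - 1)" .
    qed
    moreover have "cube_sum \<beta> C h"
      using h by (rule cube_sum_mono) (simp add: C_def)
    ultimately show ?thesis
      by (intro exI[of _ h] conjI allI impI)
  qed
  ultimately show thesis by (rule that)
qed

section \<open>The grand maximal function as a supremum over tests\<close>

lemma schwartz_continuous:
  assumes "\<Phi> \<in> schwartz"
  shows "continuous_on UNIV (\<Phi> :: real^'n::finite \<Rightarrow> complex)"
proof -
  have "\<Phi> differentiable at x" for x
    using assms unfolding schwartz_def smooth_def by (metis (mono_tags, lifting) iter_deriv.simps(1) mem_Collect_eq)
  then show ?thesis
    by (simp add: continuous_on_eq_continuous_at differentiable_imp_continuous_within)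
qed

lemma schwartz_decay:
  fixes \<Phi> :: "real^'n::finite \<Rightarrow> complex"
  assumes "seminorm p m \<Phi> \<le> 1"
  shows "(1 + norm x) ^ p * norm (\<Phi> x) \<le> 1"
proof -
  have "ennreal ((1 + norm x) ^ p * norm (iter_deriv [] \<Phi> x)) \<le> seminorm p m \<Phi>"
    unfolding seminorm_def by (intro SUP_upper2[where i = x] SUP_upper) auto
  then have "ennreal ((1 + norm x) ^ p * norm (\<Phi> x)) \<le> 1"
    unfolding iter_deriv.simps using assms by (rule order_trans)
  then show ?thesis by simp
qed

text \<open>Rotate the value of the convolution onto the positive real axis. Weak-star convergence is formulated with
real functions, and this turns the modulus of a complex integral into the integral of one of them.\<close>

lemma conv_dilate_eq_real_integral:
  fixes \<mu> :: "'n::finite set_fun"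
  assumes \<mu>: "signed_measure \<mu>" and \<Phi>: "\<Phi> \<in> schwartz" "seminorm p m \<Phi> \<le> 1"
  obtains \<theta> where "norm \<theta> = 1"
    "norm (conv (signed_integral \<mu>) (dilate t \<Phi>) x)
      = t powr (- real CARD('n)) * signed_integral \<mu> (\<lambda>y. Re (\<theta> * \<Phi> ((1 / t) *\<^sub>R (x - y))))"
proof -
  let ?F = "\<lambda>y. dilate t \<Phi> (x - y)"
  let ?k = "t powr (- real CARD('n))"
  define c where "c = signed_integral \<mu> ?F"
  (* for c = 0 any unimodular number would do *)
  define \<theta> where "\<theta> = (if c = 0 then 1 else cnj c / of_real (norm c))"
  have \<theta>: "norm \<theta> = 1" by (simp add: \<theta>_def norm_divide)
  have \<theta>c: "Re (\<theta> * c) = norm c"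
  proof (cases "c = 0")
    case False
    have "\<theta> * c = of_real (norm c)"
      using False by (simp add: \<theta>_def complex_norm_square[symmetric] power2_eq_square mult.commute)
    then show ?thesis by simp
  qed (simp add: \<theta>_def)
  have b: "norm (\<Phi> u) \<le> 1" for u
  proof -
    have "1 * norm (\<Phi> u) \<le> (1 + norm u) ^ p * norm (\<Phi> u)"
      by (intro mult_right_mono one_le_power) auto
    then show ?thesis using schwartz_decay[OF \<Phi>(2), of u] by linarith
  qed
  have [measurable]: "\<Phi> \<in> borel_measurable borel"
    using schwartz_continuous[OF \<Phi>(1)] by (rule borel_measurable_continuous_onI)
  have Fm: "?F \<in> borel_measurable borel"
    unfolding dilate_def by measurable
  have Fb: "norm (?F y) \<le> \<bar>?k\<bar> * 1" for y
    unfolding dilate_def norm_mult by (intro mult_mono b) auto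
  note i = integrable_pos_part[OF \<mu> Fm Fb]
  have bl: "bounded_linear (\<lambda>c. Re (\<theta> * c))"
    by (intro bounded_linear_compose[OF bounded_linear_Re] bounded_linear_mult_right)
  have "Re (\<theta> * c) = signed_integral \<mu> (\<lambda>y. Re (\<theta> * ?F y))"
    unfolding c_def signed_integral_def
    using integral_bounded_linear[OF bl i(1)] integral_bounded_linear[OF bl i(2)]
    by (simp only: right_diff_distrib minus_complex.sel)
  also have "(\<lambda>y. Re (\<theta> * ?F y)) = (\<lambda>y. ?k * Re (\<theta> * \<Phi> ((1 / t) *\<^sub>R (x - y))))"
    unfolding dilate_def by (intro ext) (simp add: algebra_simps)
  also have "signed_integral \<mu> \<dots> = ?k * signed_integral \<mu> (\<lambda>y. Re (\<theta> * \<Phi> ((1 / t) *\<^sub>R (x - y))))"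
    by (rule signed_integral_mult_right)
  finally have "norm (conv (signed_integral \<mu>) (dilate t \<Phi>) x)
      = ?k * signed_integral \<mu> (\<lambda>y. Re (\<theta> * \<Phi> ((1 / t) *\<^sub>R (x - y))))"
    by (simp only: \<theta>c conv_def c_def[symmetric])
  with \<theta> show thesis by (rule that)
qed

lemma real_test_in_C0:
  fixes \<Phi> :: "real^'n::finite \<Rightarrow> complex"
  assumes \<Phi>: "\<Phi> \<in> schwartz" "seminorm p m \<Phi> \<le> 1" and p: "1 \<le> p" and \<theta>: "norm \<theta> = 1" and t: "0 < t"
  shows "(\<lambda>y. Re (\<theta> * \<Phi> ((1 / t) *\<^sub>R (x - y)))) \<in> C0"
proof -
  let ?f = "\<lambda>y. Re (\<theta> * \<Phi> ((1 / t) *\<^sub>R (x - y)))"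
  have "continuous_on UNIV ?f"
    by (intro continuous_intros continuous_on_compose2[OF schwartz_continuous[OF \<Phi>(1)]]) auto
  moreover have "(?f \<longlongrightarrow> 0) at_infinity"
  proof (rule tendstoI)
    fix e :: real assume e: "0 < e"
    have small: "dist (?f y) 0 < e" if y: "norm x + t / e < norm y" for y
    proof -
      define u where "u = (1 / t) *\<^sub>R (x - y)"
      have "norm y - norm x \<le> norm (x - y)"
        using norm_triangle_ineq2[of y x] by (simp add: norm_minus_commute)
      then have "t / e < norm (x - y)" using y by linarith
      then have u: "1 / e < norm u"
      proof -
        have "norm u = norm (x - y) / t" using t unfolding u_def by simp
        then show ?thesis using divide_strict_right_mono[OF \<open>t / e < norm (x - y)\<close> t] t by simp
      qed
      have "norm u \<le> (1 + norm u) ^ p"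
        using p self_le_power[of "1 + norm u" p] by simp
      then have "norm u * norm (\<Phi> u) \<le> (1 + norm u) ^ p * norm (\<Phi> u)"
        by (intro mult_right_mono) auto
      also have "\<dots> \<le> 1" by (rule schwartz_decay[OF \<Phi>(2)])
      finally have le: "norm u * norm (\<Phi> u) \<le> 1" .
      have "norm (\<Phi> u) < e"
      proof (rule ccontr)
        assume "\<not> norm (\<Phi> u) < e"
        then have "(1 / e) * e < norm u * norm (\<Phi> u)"
          using u e by (intro mult_less_le_imp_less) auto
        then show False using le e by simp
      qed
      moreover have "\<bar>Re (\<theta> * \<Phi> u)\<bar> \<le> norm (\<Phi> u)"
        using abs_Re_le_cmod[of "\<theta> * \<Phi> u"] \<theta> by (simp add: norm_mult)
      ultimately show ?thesis by (simp add: u_def)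
    qed
    show "\<forall>\<^sub>F y in at_infinity. dist (?f y) 0 < e"
      unfolding eventually_at_infinity
      by (intro exI[of _ "norm x + t / e + 1"] allI impI small) linarith
  qed
  ultimately show ?thesis by (simp add: C0_def)
qed

text \<open>A test \<open>(t, \<Phi>, x)\<close> is one competitor in the maximal function, together with the point at which it is evaluated.\<close>

definition test_triples :: "nat \<Rightarrow> nat \<Rightarrow> (real \<times> (real^'n::finite \<Rightarrow> complex) \<times> (real^'n)) set" where
  "test_triples p m = {(t, \<Phi>, x). 0 < t \<and> \<Phi> \<in> schwartz \<and> seminorm p m \<Phi> \<le> 1}"

definition test_value :: "real \<Rightarrow> 'n::finite set_fun \<Rightarrow> real \<times> (real^'n \<Rightarrow> complex) \<times> (real^'n) \<Rightarrow> real" where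
  "test_value \<beta> \<mu> = (\<lambda>(t, \<Phi>, x).
     t powr (real CARD('n) - \<beta>) * norm (conv (signed_integral \<mu>) (dilate t \<Phi>) x))"

definition test_ball :: "real \<times> (real^'n::finite \<Rightarrow> complex) \<times> (real^'n) \<Rightarrow> (real^'n) set" where
  "test_ball = (\<lambda>(t, \<Phi>, x). ball x t)"

abbreviation test_region ::
    "real \<Rightarrow> 'n::finite set_fun \<Rightarrow> (real \<times> (real^'n \<Rightarrow> complex) \<times> (real^'n)) set \<Rightarrow> real \<Rightarrow> (real^'n) set" where
  "test_region \<beta> \<mu> F \<tau> \<equiv> (\<Union>s\<in>{s\<in>F. \<tau> < test_value \<beta> \<mu> s}. test_ball s)"

text \<open>Enlarging each point of a level set to the ball of radius \<open>t\<close> of a test that witnesses it gives an open set.\<close>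

lemma grand_maximal_level_subset:
  fixes \<mu> :: "'n::finite set_fun"
  shows "{x. ennreal \<tau> < grand_maximal {(p, m)} (real CARD('n) - \<beta>) (signed_integral \<mu>) x}
    \<subseteq> test_region \<beta> \<mu> (test_triples p m) \<tau>"
proof
  fix x assume "x \<in> {x. ennreal \<tau> < grand_maximal {(p, m)} (real CARD('n) - \<beta>) (signed_integral \<mu>) x}"
  then obtain t \<Phi> where t: "0 < t" and \<Phi>: "\<Phi> \<in> schwartz" "seminorm_max {(p, m)} \<Phi> \<le> 1"
    and v: "ennreal \<tau> < ennreal (t powr (real CARD('n) - \<beta>) * norm (conv (signed_integral \<mu>) (dilate t \<Phi>) x))"
    unfolding grand_maximal_def by (auto simp: less_Sup_iff)
  have "(t, \<Phi>, x) \<in> {s \<in> test_triples p m. \<tau> < test_value \<beta> \<mu> s}"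
    using t \<Phi> v by (auto simp: test_triples_def test_value_def seminorm_max_def ennreal_less_iff
        dest: ennreal_lessI intro: ccontr)
      (metis ennreal_leI leD linorder_not_less)
  moreover have "x \<in> test_ball (t, \<Phi>, x)"
    using t by (simp add: test_ball_def)
  ultimately show "x \<in> test_region \<beta> \<mu> (test_triples p m) \<tau>"
    by blast
qed

text \<open>Lindelof's theorem for each rational level gives one countable subfamily that serves all real levels.\<close>

lemma countable_levels:
  fixes B :: "'s \<Rightarrow> 'b::second_countable_topology set" and v :: "'s \<Rightarrow> real"
  assumes "\<And>s. s \<in> S \<Longrightarrow> open (B s)"
  obtains S0 where "countable S0" "S0 \<subseteq> S"
    "\<And>\<tau>. (\<Union>s\<in>{s\<in>S. \<tau> < v s}. B s) = (\<Union>s\<in>{s\<in>S0. \<tau> < v s}. B s)"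
proof -
  have "\<forall>q. \<exists>C. countable C \<and> C \<subseteq> {s\<in>S. q < v s} \<and> (\<Union>s\<in>C. B s) = (\<Union>s\<in>{s\<in>S. q < v s}. B s)"
  proof
    fix q
    obtain F where F: "F \<subseteq> B ` {s\<in>S. q < v s}" "countable F" "\<Union>F = \<Union>(B ` {s\<in>S. q < v s})"
      using Lindelof[of "B ` {s\<in>S. q < v s}"] assms by blast
    have "countable F \<and> F \<subseteq> B ` {s\<in>S. q < v s}"
      using F(2,1) by (rule conjI)
    then obtain C where C: "countable C" "C \<subseteq> {s\<in>S. q < v s}" "F = B ` C"
      unfolding countable_subset_image by (elim exE conjE)
    show "\<exists>C. countable C \<and> C \<subseteq> {s\<in>S. q < v s} \<and> (\<Union>s\<in>C. B s) = (\<Union>s\<in>{s\<in>S. q < v s}. B s)"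
      using F(3) unfolding C(3) by (intro exI[of _ C] conjI C(1,2))
  qed
  from choice[OF this] obtain C where
    C': "\<forall>q. countable (C q) \<and> C q \<subseteq> {s\<in>S. q < v s} \<and> (\<Union>s\<in>C q. B s) = (\<Union>s\<in>{s\<in>S. q < v s}. B s)"
    ..
  note C = C'[THEN spec, THEN conjunct1] C'[THEN spec, THEN conjunct2, THEN conjunct1]
    C'[THEN spec, THEN conjunct2, THEN conjunct2]
  define S0 where "S0 = (\<Union>q\<in>\<rat>. C q)"
  show thesis
  proof (rule that)
    show "countable S0" unfolding S0_def by (intro countable_UN countable_rat C(1))
    show S0: "S0 \<subseteq> S" unfolding S0_def by (intro UN_least subset_trans[OF C(2)]) auto
    fix \<tau>
    show "(\<Union>s\<in>{s\<in>S. \<tau> < v s}. B s) = (\<Union>s\<in>{s\<in>S0. \<tau> < v s}. B s)"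
    proof (intro equalityI subsetI)
      fix y assume "y \<in> (\<Union>s\<in>{s\<in>S. \<tau> < v s}. B s)"
      then obtain s where s: "s \<in> S" "\<tau> < v s" "y \<in> B s" by blast
      obtain q where q: "q \<in> \<rat>" "\<tau> < q" "q < v s"
        using Rats_dense_in_real[OF s(2)] by blast
      have "y \<in> (\<Union>s\<in>{s\<in>S. q < v s}. B s)"
        using s q by blast
      then obtain s' where s': "s' \<in> C q" "y \<in> B s'"
        unfolding C(3)[symmetric] by blast
      then have "q < v s'" using C(2)[of q] by blast
      then have "s' \<in> {s\<in>S0. \<tau> < v s}"
        using s'(1) q unfolding S0_def by auto
      then show "y \<in> (\<Union>s\<in>{s\<in>S0. \<tau> < v s}. B s)"
        using s'(2) by blast
    next
      fix y assume "y \<in> (\<Union>s\<in>{s\<in>S0. \<tau> < v s}. B s)"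
      then show "y \<in> (\<Union>s\<in>{s\<in>S. \<tau> < v s}. B s)" using S0 by blast
    qed
  qed
qed

lemma test_value_real:
  fixes \<mu> :: "'n::finite set_fun"
  assumes \<mu>: "signed_measure \<mu>" and s: "(t, \<Phi>, x) \<in> test_triples p m"
  obtains \<theta> where "norm \<theta> = 1"
    "test_value \<beta> \<mu> (t, \<Phi>, x) = t powr (- \<beta>) * signed_integral \<mu> (\<lambda>y. Re (\<theta> * \<Phi> ((1 / t) *\<^sub>R (x - y))))"
proof -
  have t: "0 < t" and \<Phi>: "\<Phi> \<in> schwartz" "seminorm p m \<Phi> \<le> 1"
    using s by (auto simp: test_triples_def)
  obtain \<theta> where \<theta>: "norm \<theta> = 1"
    "norm (conv (signed_integral \<mu>) (dilate t \<Phi>) x)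
      = t powr (- real CARD('n)) * signed_integral \<mu> (\<lambda>y. Re (\<theta> * \<Phi> ((1 / t) *\<^sub>R (x - y))))"
    by (rule conv_dilate_eq_real_integral[OF \<mu> \<Phi>])
  have "t powr (real CARD('n) - \<beta>) * t powr (- real CARD('n)) = t powr (- \<beta>)"
    by (simp add: powr_add[symmetric])
  then have "test_value \<beta> \<mu> (t, \<Phi>, x) = t powr (- \<beta>) * signed_integral \<mu> (\<lambda>y. Re (\<theta> * \<Phi> ((1 / t) *\<^sub>R (x - y))))"
    by (simp only: test_value_def case_prod_conv \<theta>(2) mult.assoc[symmetric])
  with \<theta>(1) show thesis by (rule that)
qed

text \<open>Moving from \<open>x\<close> to \<open>x'\<close> amounts to shifting \<open>\<Phi>\<close> by \<open>(x - x') / t\<close>, which has norm at most \<open>1\<close>.\<close>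

lemma test_function_class:
  fixes \<Phi> :: "real^'n::finite \<Rightarrow> complex"
  assumes s: "(t, \<Phi>, x) \<in> test_triples p m" and \<theta>: "norm \<theta> = 1" and x': "x' \<in> ball x t"
  shows "\<exists>g. test_class p m (2 ^ p) g \<and>
    (\<forall>a. signed_integral a (\<lambda>y. Re (\<theta> * \<Phi> ((1 / t) *\<^sub>R (x - y)))) = dilated_integral a x' t g)"
proof -
  have t: "0 < t" and \<Phi>: "\<Phi> \<in> schwartz" "seminorm p m \<Phi> \<le> 1"
    using s by (auto simp: test_triples_def)
  define v where "v = (1 / t) *\<^sub>R (x - x')"
  have "norm v = dist x x' / t"
    using t unfolding v_def by (simp add: dist_norm)
  then have v: "norm v \<le> 1"
    using x' t by (simp add: less_imp_le)
  have eq: "(1 / t) *\<^sub>R (x - y) = (1 / t) *\<^sub>R (x' - y) + v" for y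
    by (simp add: v_def algebra_simps)
  show ?thesis
  proof (intro exI conjI allI)
    show "test_class p m (2 ^ p) (\<lambda>u. Re (\<theta> * \<Phi> (u + v)))"
      by (rule schwartz_test_class[OF \<Phi> \<theta> v])
    show "signed_integral a (\<lambda>y. Re (\<theta> * \<Phi> ((1 / t) *\<^sub>R (x - y)))) = dilated_integral a x' t (\<lambda>u. Re (\<theta> * \<Phi> (u + v)))" for a
      unfolding dilated_integral_def eq ..
  qed
qed

lemma test_triple_function:
  fixes \<mu> :: "'n::finite set_fun"
  assumes \<mu>: "signed_measure \<mu>" and s: "s \<in> test_triples p m" and p: "1 \<le> p"
  shows "\<exists>\<phi>. \<phi> \<in> C0 \<and> (\<forall>y. \<bar>\<phi> y\<bar> \<le> 1) \<and>
    test_value \<beta> \<mu> s = fst s powr (- \<beta>) * signed_integral \<mu> \<phi> \<and>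
    (\<forall>x\<in>test_ball s. \<exists>g. test_class p m (2 ^ p) g \<and> (\<forall>a. signed_integral a \<phi> = dilated_integral a x (fst s) g))"
proof -
  obtain t \<Phi> z where st: "s = (t, \<Phi>, z)" by (cases s)
  have t: "0 < t" and \<Phi>: "\<Phi> \<in> schwartz" "seminorm p m \<Phi> \<le> 1"
    using s by (auto simp: test_triples_def st)
  obtain \<theta> where \<theta>: "norm \<theta> = 1" and
    val: "test_value \<beta> \<mu> (t, \<Phi>, z) = t powr (- \<beta>) * signed_integral \<mu> (\<lambda>y. Re (\<theta> * \<Phi> ((1 / t) *\<^sub>R (z - y))))"
    by (rule test_value_real[OF \<mu> s[unfolded st]])
  define \<phi> where "\<phi> = (\<lambda>y. Re (\<theta> * \<Phi> ((1 / t) *\<^sub>R (z - y))))"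
  have "\<phi> \<in> C0"
    unfolding \<phi>_def by (rule real_test_in_C0[OF \<Phi> p \<theta> t])
  moreover have "\<bar>\<phi> y\<bar> \<le> 1" for y
  proof -
    let ?u = "(1 / t) *\<^sub>R (z - y)"
    have "1 * norm (\<Phi> ?u) \<le> (1 + norm ?u) ^ p * norm (\<Phi> ?u)"
      by (intro mult_right_mono one_le_power) auto
    then have "norm (\<Phi> ?u) \<le> 1" using schwartz_decay[OF \<Phi>(2), of ?u] by linarith
    then show ?thesis
      unfolding \<phi>_def using abs_Re_le_cmod[of "\<theta> * \<Phi> ?u"] \<theta> by (simp add: norm_mult)
  qed
  moreover have "test_value \<beta> \<mu> s = fst s powr (- \<beta>) * signed_integral \<mu> \<phi>"
    using val by (simp only: st \<phi>_def fst_conv)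
  moreover have "\<exists>g. test_class p m (2 ^ p) g \<and> (\<forall>a. signed_integral a \<phi> = dilated_integral a x (fst s) g)"
    if "x \<in> test_ball s" for x
  proof -
    have x: "x \<in> ball z t" using that by (simp add: st test_ball_def)
    show ?thesis
      unfolding \<phi>_def st fst_conv by (rule test_function_class[OF s[unfolded st] \<theta> x])
  qed
  ultimately show ?thesis
    by - (rule exI[of _ \<phi>], intro conjI allI ballI)
qed

section \<open>From atoms to weak-star limits\<close>

text \<open>For large \<open>n\<close> every one of the finitely many tests has, for the \<open>n\<close>-th approximation, at least half of its
value for \<open>\<mu>\<close>. By the majorants of the atoms this forces the sum of the majorants to be at least half of
that value on the whole ball of the test. The coefficient sums enter for all large \<open>n\<close>, so their limes
superior remains.\<close>

lemma finite_stage_bound: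
  fixes \<mu> :: "'n::finite set_fun"
  assumes \<mu>: "signed_measure \<mu>" and rep: "atomic_rep \<beta> lam a \<mu>" and p: "1 \<le> p"
    and C: "\<And>(a :: 'n set_fun) R. atom \<beta> a \<Longrightarrow>
      \<exists>h. cube_sum \<beta> C h \<and>
        (\<forall>x t g. norm x \<le> R \<longrightarrow> 0 < t \<longrightarrow> test_class p CARD('n) (2 ^ p) g \<longrightarrow>
          t powr (- \<beta>) * \<bar>dilated_integral a x t g\<bar> \<le> h x)"
    and F: "finite F" "F \<subseteq> test_triples p CARD('n)" and C0: "0 < C"
  shows "(\<integral>\<^sup>+\<tau>\<in>{0<..}. dcontent \<beta> (test_region \<beta> \<mu> F \<tau>) \<partial>lborel)
    \<le> ennreal (2 * C) * coeff_size lam"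
proof -
  let ?\<nu> = "\<lambda>n E. \<Sum>i=1..n. lam i n * a i n E"
  have at: "atom \<beta> (a i n)" if "i \<in> {1..n}" for i n
    using rep that by (simp add: atomic_rep_def)
  have sm: "signed_measure (a i n)" if "i \<in> {1..n}" for i n
    using at[OF that] by (simp add: atom_def)
  have "\<forall>s\<in>F. \<exists>\<phi>. \<phi> \<in> C0 \<and> (\<forall>y. \<bar>\<phi> y\<bar> \<le> 1) \<and>
    test_value \<beta> \<mu> s = fst s powr (- \<beta>) * signed_integral \<mu> \<phi> \<and>
    (\<forall>x\<in>test_ball s. \<exists>g. test_class p CARD('n) (2 ^ p) g \<and> (\<forall>a. signed_integral a \<phi> = dilated_integral a x (fst s) g))"
    using F(2) by (intro ballI test_triple_function[OF \<mu> _ p]) (rule subsetD)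
  from bchoice[OF this] obtain \<phi> where \<phi>: "\<forall>s\<in>F. \<phi> s \<in> C0 \<and> (\<forall>y. \<bar>\<phi> s y\<bar> \<le> 1) \<and>
    test_value \<beta> \<mu> s = fst s powr (- \<beta>) * signed_integral \<mu> (\<phi> s) \<and>
    (\<forall>x\<in>test_ball s. \<exists>g. test_class p CARD('n) (2 ^ p) g \<and> (\<forall>a. signed_integral a (\<phi> s) = dilated_integral a x (fst s) g))"
    ..
  have fstF: "0 < fst s" if "s \<in> F" for s
    using that F(2) unfolding test_triples_def by fastforce
  have val: "test_value \<beta> \<mu> s = fst s powr (- \<beta>) * signed_integral \<mu> (\<phi> s)"
    and C0: "\<phi> s \<in> C0" and \<phi>b: "\<And>y. \<bar>\<phi> s y\<bar> \<le> 1" if "s \<in> F" for s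
    using \<phi> that by blast+
  have lim: "(\<lambda>n. fst s powr (- \<beta>) * signed_integral (?\<nu> n) (\<phi> s)) \<longlonglongrightarrow> test_value \<beta> \<mu> s" if "s \<in> F" for s
    using rep C0[OF that] unfolding val[OF that] atomic_rep_def weak_star_lim_def
    by (intro tendsto_mult_left) blast
  have "\<forall>\<^sub>F n in sequentially. \<forall>s\<in>F. 0 < test_value \<beta> \<mu> s \<longrightarrow>
      test_value \<beta> \<mu> s / 2 < fst s powr (- \<beta>) * signed_integral (?\<nu> n) (\<phi> s)"
  proof (intro eventually_ball_finite F(1) ballI)
    fix s assume "s \<in> F"
    show "\<forall>\<^sub>F n in sequentially. 0 < test_value \<beta> \<mu> s \<longrightarrow>
        test_value \<beta> \<mu> s / 2 < fst s powr (- \<beta>) * signed_integral (?\<nu> n) (\<phi> s)"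
    proof (cases "0 < test_value \<beta> \<mu> s")
      case True
      (* half of the limit leaves room that works for all levels below the value simultaneously *)
      then have half: "test_value \<beta> \<mu> s / 2 < test_value \<beta> \<mu> s" by simp
      show ?thesis
        by (rule eventually_mono[OF order_tendstoD(1)[OF lim[OF \<open>s \<in> F\<close>] half]]) (rule impI)
    qed simp
  qed
  then have "\<forall>\<^sub>F n in sequentially. (\<integral>\<^sup>+\<tau>\<in>{0<..}. dcontent \<beta> (test_region \<beta> \<mu> F \<tau>) \<partial>lborel)
      / ennreal (2 * C) \<le> (\<Sum>i=1..n. ennreal \<bar>lam i n\<bar>)"
  proof eventually_elim
    case (elim n)
    obtain R where R: "\<And>x. x \<in> (\<Union>s\<in>F. test_ball s) \<Longrightarrow> norm x \<le> R"
    proof -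
      have "bounded (\<Union>s\<in>F. test_ball s)"
        using F(1) by (intro bounded_UN) (auto simp: test_ball_def)
      then show thesis using that unfolding bounded_iff by blast
    qed
    have "\<forall>k\<in>{1..n}. \<exists>h. cube_sum \<beta> C h \<and>
        (\<forall>x t g. norm x \<le> R \<longrightarrow> 0 < t \<longrightarrow> test_class p CARD('n) (2 ^ p) g \<longrightarrow>
          t powr (- \<beta>) * \<bar>dilated_integral (a k n) x t g\<bar> \<le> h x)"
      using C at by blast
    then obtain h where h: "\<And>k. k \<in> {1..n} \<Longrightarrow> cube_sum \<beta> C (h k)"
        "\<And>k x t g. k \<in> {1..n} \<Longrightarrow> norm x \<le> R \<Longrightarrow> 0 < t \<Longrightarrow> test_class p CARD('n) (2 ^ p) g \<Longrightarrow>
          t powr (- \<beta>) * \<bar>dilated_integral (a k n) x t g\<bar> \<le> h k x"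
      unfolding bchoice_iff by blast
    define f where "f x = (\<Sum>k=1..n. (2 * \<bar>lam k n\<bar>) * h k x)" for x
    have pt: "test_value \<beta> \<mu> s \<le> f x" if s: "s \<in> F" and pos: "0 < test_value \<beta> \<mu> s" and x: "x \<in> test_ball s" for s x
    proof -
      define t where "t = fst s"
      have t: "0 < t" using fstF[OF s] by (simp add: t_def)
      obtain g where g: "test_class p CARD('n) (2 ^ p) g"
        "\<And>a. signed_integral a (\<phi> s) = dilated_integral a x t g"
        using \<phi> s x unfolding t_def by blast
      have xR: "norm x \<le> R" using R s x by blast
      have \<phi>m: "\<phi> s \<in> borel_measurable borel"
        using C0[OF s] by (auto simp: C0_def intro: borel_measurable_continuous_onI)
      have "test_value \<beta> \<mu> s \<le> 2 * (t powr (- \<beta>) * signed_integral (?\<nu> n) (\<phi> s))"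
        using elim[rule_format, OF s pos] unfolding t_def by linarith
      also have "signed_integral (?\<nu> n) (\<phi> s) = (\<Sum>k=1..n. lam k n * signed_integral (a k n) (\<phi> s))"
        using sm \<phi>b[OF s] by (intro signed_integral_linear_combination[where b = 1] \<phi>m) auto
      also have "2 * (t powr (- \<beta>) * (\<Sum>k=1..n. lam k n * signed_integral (a k n) (\<phi> s)))
          = (\<Sum>k=1..n. 2 * (lam k n * (t powr (- \<beta>) * dilated_integral (a k n) x t g)))"
        by (simp add: g(2) sum_distrib_left mult_ac)
      also have "\<dots> \<le> (\<Sum>k=1..n. 2 * (\<bar>lam k n\<bar> * h k x))"
      proof (intro sum_mono mult_left_mono)
        fix k assume k: "k \<in> {1..n}"
        have "lam k n * (t powr (- \<beta>) * dilated_integral (a k n) x t g)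
            \<le> \<bar>lam k n * (t powr (- \<beta>) * dilated_integral (a k n) x t g)\<bar>" by (rule abs_ge_self)
        also have "\<dots> = \<bar>lam k n\<bar> * (t powr (- \<beta>) * \<bar>dilated_integral (a k n) x t g\<bar>)"
          by (simp add: abs_mult)
        also have "\<dots> \<le> \<bar>lam k n\<bar> * h k x"
          by (intro mult_left_mono h(2)[OF k xR t g(1)]) simp
        finally show "lam k n * (t powr (- \<beta>) * dilated_integral (a k n) x t g)
          \<le> \<bar>lam k n\<bar> * h k x" .
      qed simp
      also have "\<dots> = f x"
        unfolding f_def by (simp only: mult.assoc)
      finally show ?thesis .
    qed
    have "(\<integral>\<^sup>+\<tau>\<in>{0<..}. dcontent \<beta> (test_region \<beta> \<mu> F \<tau>) \<partial>lborel) \<le> dchoquet \<beta> f"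
      unfolding dchoquet_def
    proof (rule nn_integral_mono)
      fix \<tau> :: real
      have "test_region \<beta> \<mu> F \<tau> \<subseteq> {x. \<tau> < f x}" if "0 < \<tau>"
      proof
        fix x assume "x \<in> test_region \<beta> \<mu> F \<tau>"
        then obtain s where "s \<in> F" "\<tau> < test_value \<beta> \<mu> s" "x \<in> test_ball s" by blast
        then show "x \<in> {x. \<tau> < f x}" using pt[of s x] that by simp
      qed
      then show "dcontent \<beta> (test_region \<beta> \<mu> F \<tau>) * indicator {0<..} \<tau>
          \<le> dcontent \<beta> {x. \<tau> < f x} * indicator {0<..} \<tau>"
        by (cases "0 < \<tau>") (auto intro: dcontent_mono)
    qed
    also have "\<dots> \<le> ennreal (\<Sum>k=1..n. 2 * \<bar>lam k n\<bar> * C)"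
      unfolding f_def using h(1) by (intro dchoquet_combination_of_cube_sums) auto
    also have "(\<Sum>k=1..n. 2 * \<bar>lam k n\<bar> * C) = (2 * C) * (\<Sum>k=1..n. \<bar>lam k n\<bar>)"
      by (simp add: sum_distrib_left mult_ac)
    also have "ennreal \<dots> = ennreal (2 * C) * (\<Sum>k=1..n. ennreal \<bar>lam k n\<bar>)"
      using \<open>0 < C\<close> by (simp add: ennreal_mult sum_nonneg)
    finally show ?case
      using \<open>0 < C\<close> by (intro divide_le_posI_ennreal) auto
  qed
  then have "(\<integral>\<^sup>+\<tau>\<in>{0<..}. dcontent \<beta> (test_region \<beta> \<mu> F \<tau>) \<partial>lborel)
      / ennreal (2 * C) \<le> coeff_size lam"
    unfolding coeff_size_def by (intro le_Limsup) auto
  then show ?thesis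
    using \<open>0 < C\<close> by (intro ennreal_le_mult_if_divide_le) auto
qed

text \<open>Exhaust a countable family of tests by finite ones. The associated open sets increase to sets that contain the
level sets of the maximal function.\<close>

lemma choquet_norm_le_if_finite_stages_le:
  fixes \<mu> :: "'n::finite set_fun"
  assumes \<beta>: "0 < \<beta>" "\<beta> \<le> real CARD('n)"
    and stage: "\<And>F. finite F \<Longrightarrow> F \<subseteq> test_triples p m \<Longrightarrow>
      (\<integral>\<^sup>+\<tau>\<in>{0<..}. dcontent \<beta> (test_region \<beta> \<mu> F \<tau>) \<partial>lborel) \<le> X"
  shows "choquet_norm \<beta> (grand_maximal {(p, m)} (real CARD('n) - \<beta>) (signed_integral \<mu>))
    \<le> ennreal (unit_ball_vol \<beta> * real CARD('n) powr \<beta>) * X"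
proof -
  let ?k = "ennreal (unit_ball_vol \<beta> * real CARD('n) powr \<beta>)"
  let ?M = "grand_maximal {(p, m)} (real CARD('n) - \<beta>) (signed_integral \<mu>)"
  have op: "open (test_ball s)" for s :: "real \<times> (real^'n \<Rightarrow> complex) \<times> (real^'n)"
    by (cases s) (simp add: test_ball_def)
  obtain S0 where S0: "countable S0" "S0 \<subseteq> test_triples p m"
    "\<And>\<tau>. test_region \<beta> \<mu> (test_triples p m) \<tau>
        = test_region \<beta> \<mu> S0 \<tau>"
    using countable_levels[of "test_triples p m" test_ball "test_value \<beta> \<mu>"] op by blast
  define F where "F N = {s\<in>S0. to_nat_on S0 s \<le> N}" for N
  define E where "E N \<tau> = test_region \<beta> \<mu> (F N) \<tau>" for N \<tau>
  have F: "finite (F N)" "F N \<subseteq> test_triples p m" for N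
  proof -
    have "inj_on (to_nat_on S0) (F N)"
      using inj_on_to_nat_on[OF S0(1)] by (rule inj_on_subset) (auto simp: F_def)
    moreover have "to_nat_on S0 ` F N \<subseteq> {..N}" by (auto simp: F_def)
    ultimately show "finite (F N)"
      by (meson finite_atMost finite_imageD finite_subset)
    show "F N \<subseteq> test_triples p m" using S0(2) by (auto simp: F_def)
  qed
  have Finc: "F N \<subseteq> F (Suc N)" for N by (auto simp: F_def)
  have inc: "incseq (\<lambda>N. E N \<tau>)" for \<tau>
    unfolding E_def using Finc by (intro incseq_SucI UN_mono) auto
  have lev: "{x. ennreal \<tau> < ?M x} \<subseteq> (\<Union>N. E N \<tau>)" for \<tau>
  proof -
    have "test_region \<beta> \<mu> S0 \<tau> \<subseteq> (\<Union>N. E N \<tau>)"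
      unfolding E_def F_def by blast
    then show ?thesis
      using grand_maximal_level_subset[of \<tau> p m \<beta> \<mu>] S0(3)[of \<tau>] by simp
  qed
  have meas[measurable]: "(\<lambda>\<tau>. dcontent \<beta> (E N \<tau>)) \<in> borel_measurable borel" for N
  proof (intro antimono_ennreal_borel antimonoI dcontent_mono)
    fix \<sigma> \<tau> :: real assume "\<sigma> \<le> \<tau>"
    then show "E N \<tau> \<subseteq> E N \<sigma>" unfolding E_def by fastforce
  qed
  have "choquet_norm \<beta> ?M \<le> (\<integral>\<^sup>+\<tau>. ?k * (SUP N. dcontent \<beta> (E N \<tau>) * indicator {0<..} \<tau>) \<partial>lborel)"
    unfolding choquet_norm_def
  proof (rule nn_integral_mono)
    fix \<tau> :: real
    have "hausdorff_content \<beta> {x. ennreal \<tau> < ?M x} \<le> ?k * dcontent \<beta> {x. ennreal \<tau> < ?M x}"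
      by (rule hausdorff_content_le_dcontent[OF \<beta>(1)])
    also have "\<dots> \<le> ?k * dcontent \<beta> (\<Union>N. E N \<tau>)"
      by (intro mult_left_mono dcontent_mono lev) simp
    also have "\<dots> \<le> ?k * (SUP N. dcontent \<beta> (E N \<tau>))"
      using op by (intro mult_left_mono dcontent_UN_incseq[OF \<beta> inc]) (auto simp: E_def)
    finally show "hausdorff_content \<beta> {x. ennreal \<tau> < ?M x} * indicator {0<..} \<tau>
        \<le> ?k * (SUP N. dcontent \<beta> (E N \<tau>) * indicator {0<..} \<tau>)"
      by (cases "0 < \<tau>") auto
  qed
  also have "\<dots> = ?k * (\<integral>\<^sup>+\<tau>. (SUP N. dcontent \<beta> (E N \<tau>) * indicator {0<..} \<tau>) \<partial>lborel)"
    by (intro nn_integral_cmult) measurable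
  also have "(\<integral>\<^sup>+\<tau>. (SUP N. dcontent \<beta> (E N \<tau>) * indicator {0<..} \<tau>) \<partial>lborel)
      = (SUP N. \<integral>\<^sup>+\<tau>. dcontent \<beta> (E N \<tau>) * indicator {0<..} \<tau> \<partial>lborel)"
  proof (rule nn_integral_monotone_convergence_SUP)
    show "incseq (\<lambda>N \<tau>. dcontent \<beta> (E N \<tau>) * indicator {0<..} \<tau>)"
      using inc by (auto simp: incseq_def le_fun_def intro!: mult_right_mono dcontent_mono)
  qed measurable
  also have "\<dots> \<le> X"
    unfolding E_def using F by (intro SUP_least stage)
  finally show ?thesis
    by (meson mult_left_mono order_trans zero_le)
qed

theorem theorem6:
  fixes \<beta> :: real
  assumes "0 < \<beta>" and "\<beta> \<le> real CARD('n::finite)"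
  shows "\<exists>(\<F> :: (nat \<times> nat) set) C :: real. finite \<F> \<and> \<F> \<noteq> {} \<and> 0 < C \<and>
    (\<forall>\<mu> \<in> (DS \<beta> :: 'n set_fun set).
       choquet_norm \<beta> (grand_maximal \<F> (real CARD('n) - \<beta>) (signed_integral \<mu>))
         \<le> ennreal C * DS_norm \<beta> \<mu>)"
proof -
  define p where "p = CARD('n) + 2"
  obtain C where C: "0 < C"
    "\<And>(a :: 'n set_fun) R. atom \<beta> a \<Longrightarrow>
      \<exists>h. cube_sum \<beta> C h \<and>
        (\<forall>x t g. norm x \<le> R \<longrightarrow> 0 < t \<longrightarrow> test_class p CARD('n) (2 ^ p) g \<longrightarrow>
          t powr (- \<beta>) * \<bar>dilated_integral a x t g\<bar> \<le> h x)"
    by (rule atom_majorant[OF assms, of p]) (auto simp: p_def)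
  define k where "k = unit_ball_vol \<beta> * real CARD('n) powr \<beta>"
  have k: "0 < k" using assms by (simp add: k_def)
  define D where "D = k * (2 * C)"
  have D: "0 < D" using k C(1) by (simp add: D_def)
  have "choquet_norm \<beta> (grand_maximal {(p, CARD('n))} (real CARD('n) - \<beta>) (signed_integral \<mu>)) \<le> ennreal D * DS_norm \<beta> \<mu>"
    (is "?L \<le> _") if "\<mu> \<in> DS \<beta>" for \<mu> :: "'n set_fun"
  proof -
    have \<mu>: "signed_measure \<mu>" using that by (simp add: DS_def)
    have "?L / ennreal D \<le> DS_norm \<beta> \<mu>"
      unfolding DS_norm_def
    proof (rule Inf_greatest, clarify)
      fix lam and a :: "nat \<Rightarrow> nat \<Rightarrow> 'n set_fun"
      assume rep: "atomic_rep \<beta> lam a \<mu>"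
      have "?L \<le> ennreal k * (ennreal (2 * C) * coeff_size lam)"
        unfolding k_def
        by (intro choquet_norm_le_if_finite_stages_le[OF assms] finite_stage_bound[OF \<mu> rep _ C(2) _ _ C(1)]) (auto simp: p_def)
      also have "\<dots> = ennreal D * coeff_size lam"
        using k C(1) by (simp add: D_def ennreal_mult mult.assoc)
      finally show "?L / ennreal D \<le> coeff_size lam"
        using D by (intro divide_le_posI_ennreal) auto
    qed
    then show ?thesis
      by (rule ennreal_le_mult_if_divide_le[OF D])
  qed
  then show ?thesis
    using D by (intro exI[of _ "{(p, CARD('n))}"] exI[of _ D]) auto
qed

end
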